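(* Let $\kappa,\tau\in\mathbb{R}$ with $\kappa\neq 4\tau^2$ and $\tau\neq 0$, and let $\mathcal{M}$ be a surface of revolution in the Bianchi-Cartan-Vranceanu space $\mathcal{N}_{\kappa,\tau}$. Assume that the mean curvature function $f$ of $\mathcal{M}$ satisfies $f\neq 0$ at every point of $\mathcal{M}$ and that the angle function $\alpha$ of $\mathcal{M}$ takes values in $(0,\pi)$. Then $\mathcal{M}$ is a biconservative surface if and only if it is a Hopf circular cylinder.
   Context: BCV-spaces. For $\kappa,\tau\in\mathbb{R}$ put $F(x,y)=1+\frac{\kappa}{4}(x^2+y^2)$ and $\mathcal{N}=\{(x,y,z)\in\mathbb{R}^3: F(x,y)>0\}$. The Bianchi-Cartan-Vranceanu space (BCV-space) is $\mathcal{N}_{\kappa,\tau}=(\mathcal{N},g_{\kappa,\tau})$ with $$g_{\kappa,\tau}=\frac{dx^2+dy^2}{F^2}+\Big(dz+\tau\,\frac{y\,dx-x\,dy}{F}\Big)^2 .$$ It is a space form exactly when $\kappa=4\tau^2$. The Hopf fibration is the Riemannian submersion $\psi(x,y,z)=(x,y)$ onto $M^2(\kappa)$, the planar domain $\{F>0\}$ with the metric $h=(dx^2+dy^2)/F^2$. The unit Killing field $E_3=\partial/\partial z$ is the Hopf vector field. Surfaces. For a (connected) oriented surface $\mathcal{M}$ in $\mathcal{N}_{\kappa,\tau}$ with unit normal field $N$, the shape operator is $AX=-\overline{\nabla}_XN$ ($\overline\nabla$ the Levi-Civita connection of $\mathcal{N}_{\kappa,\tau}$), the mean curvature function is $f=\operatorname{trace}A$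 (so the mean curvature vector is $(f/2)N$), and the angle function $\alpha:\mathcal{M}\to[0,\pi]$ is given by $\cos\alpha=g_{\kappa,\tau}(E_3,N)$. Let $\operatorname{Ricci}(N)^{\top}=\sum_i\operatorname{Ricci}(N,e_i)e_i$, where $\operatorname{Ricci}$ is the Ricci curvature of $\mathcal{N}_{\kappa,\tau}$ and $\{e_1,e_2\}$ is a local orthonormal frame of $\mathcal{M}$. The surface is biconservative if $$2A(\operatorname{grad} f)+f\operatorname{grad} f-2f\operatorname{Ricci}(N)^\top=0 .$$ Surfaces of revolution. Rotations about the $z$-axis are isometries of $\mathcal{N}_{\kappa,\tau}$; a surface of revolution is a surface invariant under this $SO(2)$-action. In cylindrical coordinates $x=r\cos\theta$, $y=r\sin\theta$, $z=z$ it is locally parametrized by $X(\theta,s)=(r(s),\theta,z(s))$ with $r(s)>0$, the profile curve $(r(s),z(s))$ being parametrized by arc length for the metric $\frac{dr^2}{F^2}+\frac{dz^2}{1+\tau^2r^2}$, where $F=1+\frac{\kappa}{4}r^2$. A Hopf circular cylinder is (an open part of) a surface $\{r=\text{constant}\}$, $r>0$, i.e. the preimage under $\psi$ of a circle centered at the origin of $M^2(\kappa)$. *)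

theory Defs
  imports "HOL-Analysis.Analysis"
begin

section \<open>Smooth maps on open sets\<close>

fun Ck_on :: "nat \<Rightarrow> 'a::euclidean_space set \<Rightarrow> ('a \<Rightarrow> 'b::real_normed_vector) \<Rightarrow> bool" where
  "Ck_on 0 U f \<longleftrightarrow> continuous_on U f"
| "Ck_on (Suc k) U f \<longleftrightarrow> (\<forall>x\<in>U. f differentiable (at x)) \<and>
     (\<forall>v. Ck_on k U (\<lambda>x. frechet_derivative f (at x) v))"

definition smooth_on :: "'a::euclidean_space set \<Rightarrow> ('a \<Rightarrow> 'b::real_normed_vector) \<Rightarrow> bool" where
  "smooth_on U f \<longleftrightarrow> (\<forall>k. Ck_on k U f)"

section \<open>Riemannian metrics on open subsets of Euclidean space\<close>

text \<open>A metric is a map \<open>g\<close> with \<open>g p u v\<close> the inner product at \<open>p\<close> of the tangent vectors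
  \<open>u\<close>, \<open>v\<close>; tangent spaces are identified with the ambient space by the global coordinates.\<close>

type_synonym 'n metric = "real^'n \<Rightarrow> real^'n \<Rightarrow> real^'n \<Rightarrow> real"

text \<open>The Christoffel symbols of the Levi-Civita connection as a bilinear map:
  \<open>christoffel g p u v\<close> is \<open>\<nabla>\<^sub>U V\<close> at \<open>p\<close> for the constant vector fields \<open>U = u\<close>, \<open>V = v\<close>.
  It is characterised by the Koszul formula, in which the bracket terms vanish for constant
  fields.\<close>

definition christoffel :: "'n::finite metric \<Rightarrow> real^'n \<Rightarrow> real^'n \<Rightarrow> real^'n \<Rightarrow> real^'n" where
  "christoffel g p u v = (THE c. \<forall>w. 2 * g p c w =
       frechet_derivative (\<lambda>q. g q v w) (at p) u
     + frechet_derivative (\<lambda>q. g q u w) (at p) v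
     - frechet_derivative (\<lambda>q. g q u v) (at p) w)"

definition cov_deriv ::
  "'n::finite metric \<Rightarrow> (real^'n \<Rightarrow> real^'n) \<Rightarrow> real^'n \<Rightarrow> real^'n \<Rightarrow> real^'n" where
  "cov_deriv g Y p u = frechet_derivative Y (at p) u + christoffel g p u (Y p)"

text \<open>\<open>R(U,V)W = \<nabla>\<^sub>U \<nabla>\<^sub>V W - \<nabla>\<^sub>V \<nabla>\<^sub>U W\<close> for constant fields, whose bracket vanishes.
  With this sign \<open>Ricci(v,w) = trace (u \<mapsto> R(u,v)w)\<close> is positive on round spheres.\<close>

definition riemann ::
  "'n::finite metric \<Rightarrow> real^'n \<Rightarrow> real^'n \<Rightarrow> real^'n \<Rightarrow> real^'n \<Rightarrow> real^'n" where
  "riemann g p u v w = cov_deriv g (\<lambda>q. christoffel g q v w) p u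
                     - cov_deriv g (\<lambda>q. christoffel g q u w) p v"

definition ricci :: "'n::finite metric \<Rightarrow> real^'n \<Rightarrow> real^'n \<Rightarrow> real^'n \<Rightarrow> real" where
  "ricci g p v w = trace (matrix (\<lambda>u. riemann g p u v w))"

section \<open>Local geometry of a parametrized surface\<close>

text \<open>Here \<open>X\<close> is an immersion of an open set of the plane and \<open>n\<close> a unit normal field along
  \<open>X\<close>. The tangent plane at \<open>u\<close> is the range of the differential \<open>dmap X u\<close>.\<close>

definition dmap ::
  "('a::real_normed_vector \<Rightarrow> 'b::real_normed_vector) \<Rightarrow> 'a \<Rightarrow> 'a \<Rightarrow> 'b" where
  "dmap X u = frechet_derivative X (at u)"

text \<open>Covariant derivative, in the direction \<open>dX(w)\<close>, of a vector field \<open>Y\<close> along \<open>X\<close>.\<close>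

definition cov_along :: "3 metric \<Rightarrow> (real^2 \<Rightarrow> real^3) \<Rightarrow> (real^2 \<Rightarrow> real^3)
    \<Rightarrow> real^2 \<Rightarrow> real^2 \<Rightarrow> real^3" where
  "cov_along g X Y u w =
     frechet_derivative Y (at u) w + christoffel g (X u) (dmap X u w) (Y u)"

text \<open>\<open>A v = - \<nabla>\<^sub>v N\<close>, meaningful for \<open>v\<close> in the tangent plane only.\<close>

definition shape_op :: "3 metric \<Rightarrow> (real^2 \<Rightarrow> real^3) \<Rightarrow> (real^2 \<Rightarrow> real^3)
    \<Rightarrow> real^2 \<Rightarrow> real^3 \<Rightarrow> real^3" where
  "shape_op g X n u v = - cov_along g X n u (inv (dmap X u) v)"

text \<open>The trace of \<open>A\<close> (not half of it), computed in the coordinate basis of the tangent plane.\<close>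

definition mean_curvature :: "3 metric \<Rightarrow> (real^2 \<Rightarrow> real^3) \<Rightarrow> (real^2 \<Rightarrow> real^3)
    \<Rightarrow> real^2 \<Rightarrow> real" where
  "mean_curvature g X n u =
     trace (matrix (\<lambda>w. inv (dmap X u) (shape_op g X n u (dmap X u w))))"

definition surf_grad :: "3 metric \<Rightarrow> (real^2 \<Rightarrow> real^3) \<Rightarrow> (real^2 \<Rightarrow> real)
    \<Rightarrow> real^2 \<Rightarrow> real^3" where
  "surf_grad g X f u = (THE v. v \<in> range (dmap X u) \<and>
     (\<forall>w. g (X u) v (dmap X u w) = frechet_derivative f (at u) w))"

definition orthonormal_frame :: "3 metric \<Rightarrow> (real^2 \<Rightarrow> real^3) \<Rightarrow> real^2
    \<Rightarrow> real^3 \<Rightarrow> real^3 \<Rightarrow> bool" where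
  "orthonormal_frame g X u e1 e2 \<longleftrightarrow>
     e1 \<in> range (dmap X u) \<and> e2 \<in> range (dmap X u) \<and>
     g (X u) e1 e1 = 1 \<and> g (X u) e2 e2 = 1 \<and> g (X u) e1 e2 = 0"

section \<open>Surfaces\<close>

text \<open>A surface is an immersed one: a topological space \<open>S\<close> with a map \<open>\<phi>\<close> into
  coordinate space that is locally a smooth immersed patch. Since an immersion is locally an
  embedding, \<open>\<phi>\<close> and the topology determine the smooth structure of \<open>S\<close>: its maximal atlas
  consists of all \<open>(V, h)\<close> as below (with \<open>h\<close> the inverse of the chart). Embedded surfaces
  \<open>M\<close> are the case \<open>S = top_of_set M\<close>, \<open>\<phi> = id\<close>.\<close>

definition local_param :: "'a topology \<Rightarrow> ('a \<Rightarrow> real^3) \<Rightarrow> (real^2) set \<Rightarrow> (real^2 \<Rightarrow> 'a) \<Rightarrow> bool"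
  where
  "local_param S \<phi> V h \<longleftrightarrow>
     open V \<and> openin S (h ` V) \<and>
     homeomorphic_map (top_of_set V) (subtopology S (h ` V)) h \<and>
     smooth_on V (\<phi> \<circ> h) \<and> (\<forall>u\<in>V. inj (dmap (\<phi> \<circ> h) u))"

definition immersed_surface :: "(real^3) set \<Rightarrow> 'a topology \<Rightarrow> ('a \<Rightarrow> real^3) \<Rightarrow> bool" where
  "immersed_surface D S \<phi> \<longleftrightarrow>
     topspace S \<noteq> {} \<and> connected_space S \<and> Hausdorff_space S \<and> second_countable S \<and>
     \<phi> ` topspace S \<subseteq> D \<and>
     (\<forall>p\<in>topspace S. \<exists>V h. local_param S \<phi> V h \<and> p \<in> h ` V)"

definition unit_normal_field :: "3 metric \<Rightarrow> 'a topology \<Rightarrow> ('a \<Rightarrow> real^3) \<Rightarrow> ('a \<Rightarrow> real^3) \<Rightarrow> bool"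
  where
  "unit_normal_field g S \<phi> N \<longleftrightarrow>
     (\<forall>p\<in>topspace S. g (\<phi> p) (N p) (N p) = 1) \<and>
     (\<forall>V h. local_param S \<phi> V h \<longrightarrow>
        smooth_on V (N \<circ> h) \<and>
        (\<forall>u\<in>V. \<forall>w. g (\<phi> (h u)) (N (h u)) (dmap (\<phi> \<circ> h) u w) = 0))"

text \<open>The two conditions below are invariant under reparametrization; they are imposed in all
  local parametrizations, and these cover the surface.\<close>

definition mean_curvature_nowhere_zero ::
  "3 metric \<Rightarrow> 'a topology \<Rightarrow> ('a \<Rightarrow> real^3) \<Rightarrow> ('a \<Rightarrow> real^3) \<Rightarrow> bool" where
  "mean_curvature_nowhere_zero g S \<phi> N \<longleftrightarrow>
     (\<forall>V h. local_param S \<phi> V h \<longrightarrow> (\<forall>u\<in>V. mean_curvature g (\<phi> \<circ> h) (N \<circ> h) u \<noteq> 0))"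

definition biconservative ::
  "3 metric \<Rightarrow> 'a topology \<Rightarrow> ('a \<Rightarrow> real^3) \<Rightarrow> ('a \<Rightarrow> real^3) \<Rightarrow> bool" where
  "biconservative g S \<phi> N \<longleftrightarrow>
     (\<forall>V h. local_param S \<phi> V h \<longrightarrow>
        (let X = \<phi> \<circ> h; n = N \<circ> h; f = mean_curvature g X n in
          \<forall>u\<in>V. \<forall>e1 e2. orthonormal_frame g X u e1 e2 \<longrightarrow>
            2 *\<^sub>R shape_op g X n u (surf_grad g X f u) + f u *\<^sub>R surf_grad g X f u
            - (2 * f u) *\<^sub>R (ricci g (X u) (n u) e1 *\<^sub>R e1 + ricci g (X u) (n u) e2 *\<^sub>R e2) = 0))"

section \<open>BCV-spaces\<close>

definition bcv_F :: "real \<Rightarrow> real^3 \<Rightarrow> real" where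
  "bcv_F \<kappa> p = 1 + \<kappa> / 4 * ((p$1)^2 + (p$2)^2)"

definition bcv_domain :: "real \<Rightarrow> (real^3) set" where
  "bcv_domain \<kappa> = {p. bcv_F \<kappa> p > 0}"

definition bcv_metric :: "real \<Rightarrow> real \<Rightarrow> 3 metric" where
  "bcv_metric \<kappa> \<tau> p u v =
     (u$1 * v$1 + u$2 * v$2) / (bcv_F \<kappa> p)^2
     + (u$3 + \<tau> * (p$2 * u$1 - p$1 * u$2) / bcv_F \<kappa> p)
     * (v$3 + \<tau> * (p$2 * v$1 - p$1 * v$2) / bcv_F \<kappa> p)"

definition hopf_field :: "real^3" where
  "hopf_field = axis 3 1"

definition hopf_proj :: "real^3 \<Rightarrow> real^2" where
  "hopf_proj p = vector [p$1, p$2]"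

definition angle_fun ::
  "real \<Rightarrow> real \<Rightarrow> ('a \<Rightarrow> real^3) \<Rightarrow> ('a \<Rightarrow> real^3) \<Rightarrow> 'a \<Rightarrow> real" where
  "angle_fun \<kappa> \<tau> \<phi> N p = arccos (bcv_metric \<kappa> \<tau> (\<phi> p) hopf_field (N p))"

definition rot_z :: "real \<Rightarrow> real^3 \<Rightarrow> real^3" where
  "rot_z t p = vector [cos t * p$1 - sin t * p$2, sin t * p$1 + cos t * p$2, p$3]"

definition surface_of_revolution :: "'a topology \<Rightarrow> ('a \<Rightarrow> real^3) \<Rightarrow> bool" where
  "surface_of_revolution S \<phi> \<longleftrightarrow> (\<forall>t. rot_z t ` (\<phi> ` topspace S) = \<phi> ` topspace S)"

text \<open>A circle of \<open>M\<^sup>2(\<kappa>)\<close> centered at the origin is a Euclidean circle of radius \<open>r\<close> about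
  the origin, inside \<open>{F > 0}\<close>.\<close>

definition hopf_circular_cylinder :: "real \<Rightarrow> 'a topology \<Rightarrow> ('a \<Rightarrow> real^3) \<Rightarrow> bool" where
  "hopf_circular_cylinder \<kappa> S \<phi> \<longleftrightarrow>
     (\<exists>r>0. openin (top_of_set {p \<in> bcv_domain \<kappa>. hopf_proj p \<in> sphere 0 r}) (\<phi> ` topspace S))"

end

theory Submission
  imports Defs
begin

text \<open>
  Invariance under rotations makes the rotation field \<open>V\<close> tangent to the surface: otherwise the
  rotated copies of a patch would fill an open set, whereas the image of a second countable surface
  is negligible. If the surface met the axis, differentiating \<open>g(N, V) = 0\<close> there would show that
  \<open>N\<close> is vertical, which the angle condition excludes.

  Write \<open>\<rho> = x\<^sup>2 + y\<^sup>2\<close>, \<open>G = 1 + \<tau>\<^sup>2 \<rho>\<close>. Then \<open>N = p R + q P\<close>, where \<open>R\<close> is radial, \<open>P\<close> is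
  orthogonal to \<open>V\<close> and \<open>R\<close>, and \<open>q = cos \<alpha>\<close>. Let \<open>W\<close> be the tangent field orthogonal to \<open>V\<close>
  with the same length as \<open>V\<close>. Symmetry of second derivatives shows that \<open>p\<close>, \<open>q\<close> and the mean
  curvature \<open>f\<close> are constant along \<open>V\<close>. Because \<open>\<tau> \<noteq> 0\<close> and \<open>\<kappa> \<noteq> 4\<tau>\<^sup>2\<close>, both \<open>g(AW, V)\<close> and
  \<open>Ricci(N, V)\<close> are nonzero multiples of \<open>4\<tau>\<^sup>2 - \<kappa>\<close> (the latter times \<open>q\<close>), and the \<open>V\<close>-component of
  the biconservative equation becomes \<open>W f = - 4 f q G / F\<close>. Where \<open>q \<noteq> 0\<close> the \<open>W\<close>-component then
  collapses to \<open>p = - (3/2) f F\<close>; differentiating this relation along \<open>W\<close> and inserting the result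
  into the formula for \<open>f\<close> gives \<open>f = - 3 f\<close>, a contradiction. Hence \<open>q = 0\<close>, so \<open>\<rho>\<close> is constant.
  Conversely \<open>q = 0\<close> makes \<open>f\<close> constant and \<open>Ricci(N)\<^sup>T\<close> zero.
\<close>

section \<open>Functions of class $C^k$\<close>

lemma dmap_works: "f differentiable (at x) \<Longrightarrow> (f has_derivative dmap f x) (at x)"
  by (simp add: dmap_def frechet_derivative_works)

lemma dmap_eqI: "(f has_derivative f') (at x) \<Longrightarrow> dmap f x = f'"
  by (simp add: dmap_def frechet_derivative_at[symmetric])

lemma Ck_on_Suc_dmap:
  "Ck_on (Suc k) U f \<longleftrightarrow> (\<forall>x\<in>U. f differentiable (at x)) \<and> (\<forall>v. Ck_on k U (\<lambda>x. dmap f x v))"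
  by (simp add: dmap_def)

declare Ck_on.simps(2) [simp del]

lemma dmap_cong:
  assumes "open U" "x \<in> U" "\<And>x. x \<in> U \<Longrightarrow> f x = g x" "f differentiable (at x)"
  shows "g differentiable (at x)" "dmap g x = dmap f x"
proof -
  have "(g has_derivative dmap f x) (at x)"
    by (rule has_derivative_transform_within_open[OF dmap_works[OF assms(4)] assms(1,2)])
        (use assms(3) in auto)
  then show "g differentiable (at x)" "dmap g x = dmap f x"
    by (auto simp: differentiable_def dmap_eqI)
qed

lemma Ck_on_cong:
  assumes "open U" "\<And>x. x \<in> U \<Longrightarrow> f x = g x" "Ck_on k U f"
  shows "Ck_on k U g"
  using assms(2,3)
proof (induction k arbitrary: f g)
  case 0
  then show ?case by (simp cong: continuous_on_cong)
next
  case (Suc k)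
  have d: "g differentiable (at x) \<and> dmap g x = dmap f x" if "x \<in> U" for x
    using dmap_cong[OF assms(1) that, of f g] Suc.prems that by (auto simp: Ck_on_Suc_dmap)
  show ?case unfolding Ck_on_Suc_dmap
  proof (intro conjI ballI allI)
    fix v show "Ck_on k U (\<lambda>x. dmap g x v)"
      by (rule Suc.IH[of "\<lambda>x. dmap f x v"]) (use d Suc.prems in \<open>auto simp: Ck_on_Suc_dmap\<close>)
  qed (use d in auto)
qed

lemma Ck_on_subset: "V \<subseteq> U \<Longrightarrow> Ck_on k U f \<Longrightarrow> Ck_on k V f"
  by (induction k arbitrary: f) (auto simp: Ck_on_Suc_dmap continuous_on_subset)

lemma Ck_on_SucD: "Ck_on (Suc k) U f \<Longrightarrow> Ck_on k U f"
proof (induction k arbitrary: f)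
  case 0
  then show ?case
    by (auto simp: Ck_on_Suc_dmap intro!: continuous_at_imp_continuous_on
        differentiable_imp_continuous_within)
qed (simp add: Ck_on_Suc_dmap)

lemma Ck_on_const: "Ck_on k U (\<lambda>x. c)"
proof (induction k arbitrary: c)
  case (Suc k)
  have "dmap (\<lambda>x::'a. c) = (\<lambda>x v. 0)" by (simp add: dmap_def fun_eq_iff)
  then show ?case using Suc[of 0] by (simp add: Ck_on_Suc_dmap)
qed simp

lemma Ck_on_nth:
  fixes f :: "'a::euclidean_space \<Rightarrow> real^'n"
  assumes "open U"
  shows "Ck_on k U f \<Longrightarrow> Ck_on k U (\<lambda>x. f x $ i)"
proof (induction k arbitrary: f)
  case 0
  then show ?case by (auto intro: continuous_intros)
next
  case (Suc k)
  have d: "((\<lambda>x. f x $ i) has_derivative (\<lambda>v. dmap f x v $ i)) (at x)" if "x \<in> U" for x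
    using Suc.prems that
    by (intro bounded_linear.has_derivative[OF bounded_linear_vec_nth] dmap_works)
        (auto simp: Ck_on_Suc_dmap)
  show ?case unfolding Ck_on_Suc_dmap
  proof (intro conjI ballI allI)
    fix v show "Ck_on k U (\<lambda>x. dmap (\<lambda>x. f x $ i) x v)"
      by (rule Ck_on_cong[OF assms, of "\<lambda>x. dmap f x v $ i"])
        (use Suc in \<open>auto simp: Ck_on_Suc_dmap dmap_eqI[OF d]\<close>)
  qed (use d in \<open>auto simp: differentiable_def\<close>)
qed

lemma Ck_on_add:
  assumes "open U"
  shows "Ck_on k U f \<Longrightarrow> Ck_on k U g \<Longrightarrow> Ck_on k U (\<lambda>x. f x + g x)"
proof (induction k arbitrary: f g)
  case 0
  then show ?case by (auto intro: continuous_intros)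
next
  case (Suc k)
  have d: "((\<lambda>x. f x + g x) has_derivative (\<lambda>v. dmap f x v + dmap g x v)) (at x)" if "x \<in> U" for x
    using Suc.prems that by (intro has_derivative_add dmap_works) (auto simp: Ck_on_Suc_dmap)
  show ?case unfolding Ck_on_Suc_dmap
  proof (intro conjI ballI allI)
    fix v show "Ck_on k U (\<lambda>x. dmap (\<lambda>x. f x + g x) x v)"
      by (rule Ck_on_cong[OF assms, of "\<lambda>x. dmap f x v + dmap g x v"])
        (use Suc in \<open>auto simp: Ck_on_Suc_dmap dmap_eqI[OF d]\<close>)
  qed (use d in \<open>auto simp: differentiable_def\<close>)
qed

text \<open>The product rule gives a sum of products, each with one undifferentiated factor. The
  induction therefore runs over all pairs of functions, and \<open>Ck_on_SucD\<close> lowers the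
  order of that factor.\<close>

lemma Ck_on_mult:
  fixes f g :: "'a::euclidean_space \<Rightarrow> real"
  assumes "open U"
  shows "Ck_on k U f \<Longrightarrow> Ck_on k U g \<Longrightarrow> Ck_on k U (\<lambda>x. f x * g x)"
proof (induction k arbitrary: f g)
  case 0
  then show ?case by (auto intro: continuous_intros)
next
  case (Suc k)
  have d: "((\<lambda>x. f x * g x) has_derivative (\<lambda>v. f x * dmap g x v + dmap f x v * g x)) (at x)"
      if "x \<in> U" for x
    using Suc.prems that by (intro has_derivative_mult dmap_works) (auto simp: Ck_on_Suc_dmap)
  show ?case unfolding Ck_on_Suc_dmap
  proof (intro conjI ballI allI)
    fix v
    have "Ck_on k U (\<lambda>x. f x * dmap g x v + dmap f x v * g x)"
      using Suc.prems Suc.prems[THEN Ck_on_SucD] unfolding Ck_on_Suc_dmap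
      by (intro Ck_on_add[OF assms] Suc.IH) blast+
    then show "Ck_on k U (\<lambda>x. dmap (\<lambda>x. f x * g x) x v)"
      by (rule Ck_on_cong[OF assms, rotated]) (simp add: dmap_eqI[OF d])
  qed (use d in \<open>auto simp: differentiable_def\<close>)
qed

lemma Ck_on_inverse:
  fixes f :: "'a::euclidean_space \<Rightarrow> real"
  assumes "open U" and nz: "\<And>x. x \<in> U \<Longrightarrow> f x \<noteq> 0"
  shows "Ck_on k U f \<Longrightarrow> Ck_on k U (\<lambda>x. inverse (f x))"
proof (induction k)
  case 0
  then show ?case using nz by (auto intro: continuous_intros)
next
  case (Suc k)
  \<comment> \<open>The derivative contains the reciprocal itself, to which the induction hypothesis
    applies. Writing \<open>- 1\<close> as a factor makes the term a product to which
    \<open>Ck_on_mult\<close> and \<open>Ck_on_const\<close> apply directly.\<close>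
  have d: "((\<lambda>x. inverse (f x)) has_derivative (\<lambda>v.
      - 1 * dmap f x v * (inverse (f x) * inverse (f x)))) (at x)" if "x \<in> U" for x
  proof -
    have "f differentiable (at x)" using Suc.prems that by (simp add: Ck_on_Suc_dmap)
    from Deriv.has_derivative_inverse[OF nz[OF that] dmap_works[OF this]] show ?thesis
      by (rule has_derivative_eq_rhs) (simp add: fun_eq_iff)
  qed
  show ?case unfolding Ck_on_Suc_dmap
  proof (intro conjI ballI allI)
    fix v
    have "Ck_on k U (\<lambda>x. - 1 * dmap f x v * (inverse (f x) * inverse (f x)))"
      using Suc.prems Suc.IH[OF Suc.prems[THEN Ck_on_SucD]] unfolding Ck_on_Suc_dmap
      by (intro Ck_on_mult[OF assms(1)] Ck_on_const) blast+
    then show "Ck_on k U (\<lambda>x. dmap (\<lambda>x. inverse (f x)) x v)"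
      by (rule Ck_on_cong[OF assms(1), rotated]) (simp add: dmap_eqI[OF d])
  qed (use d in \<open>auto simp: differentiable_def\<close>)
qed

section \<open>Symmetry of second derivatives and a quotient of parallel differentials\<close>

lemma second_difference:
  fixes f :: "'a::euclidean_space \<Rightarrow> real"
  assumes f: "\<And>x. x \<in> U \<Longrightarrow> f differentiable (at x)"
    and f': "\<And>x. x \<in> U \<Longrightarrow> (\<lambda>x. dmap f x v) differentiable (at x)"
    and h: "h > 0" and box: "\<And>s t. s \<in> {0..h} \<Longrightarrow> t \<in> {0..h} \<Longrightarrow> u + s *\<^sub>R v + t *\<^sub>R w \<in> U"
  obtains s t where "s \<in> {0..h}" "t \<in> {0..h}"
    "f (u + h *\<^sub>R v + h *\<^sub>R w) - f (u + h *\<^sub>R v) - f (u + h *\<^sub>R w) + f u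
      = h^2 * dmap (\<lambda>x. dmap f x v) (u + s *\<^sub>R v + t *\<^sub>R w) w"
proof -
  have d1: "((\<lambda>s. f (u + s *\<^sub>R v + t *\<^sub>R w)) has_field_derivative dmap f (u + s *\<^sub>R v
      + t *\<^sub>R w) v) (at s)"
    if "s \<in> {0..h}" "t \<in> {0..h}" for s t
  proof -
    note fd = dmap_works[OF f[OF box[OF that]]]
    have "((\<lambda>s. f (u + s *\<^sub>R v + t *\<^sub>R w)) has_derivative
        (\<lambda>r. dmap f (u + s *\<^sub>R v + t *\<^sub>R w) (r *\<^sub>R v))) (at s)"
      by (rule has_derivative_compose[where f="\<lambda>s. u + s *\<^sub>R v + t *\<^sub>R w" and x=s and g=f, OF _ fd])
          (auto intro!: derivative_eq_intros)
    then show ?thesis unfolding has_field_derivative_def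
      by (rule has_derivative_eq_rhs) (simp add: fun_eq_iff linear_scale[OF has_derivative_linear[OF
          fd]])
  qed
  \<comment> \<open>Mean value theorem along v for the increment in direction w; the terms
    \<open>0 *\<^sub>R w\<close> keep both ends in the form of \<open>d1\<close>.\<close>
  have "\<exists>s. 0 < s \<and> s < h \<and> (f (u + h *\<^sub>R v + h *\<^sub>R w) - f (u + h *\<^sub>R v + 0 *\<^sub>R w)) - (f (u + 0 *\<^sub>R v
      + h *\<^sub>R w) - f (u + 0 *\<^sub>R v + 0 *\<^sub>R w))
     = (h - 0) * (dmap f (u + s *\<^sub>R v + h *\<^sub>R w) v - dmap f (u + s *\<^sub>R v + 0 *\<^sub>R w) v)"
    using h by (intro MVT2[where f="\<lambda>s. f (u + s *\<^sub>R v + h *\<^sub>R w) - f (u + s *\<^sub>R v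
        + 0 *\<^sub>R w)"] DERIV_diff d1) auto
  then obtain s where s: "0 < s" "s < h" and 1: "f (u + h *\<^sub>R v + h *\<^sub>R w) - f (u + h *\<^sub>R v) - f (u
      + h *\<^sub>R w) + f u
     = h * (dmap f (u + s *\<^sub>R v + h *\<^sub>R w) v - dmap f (u + s *\<^sub>R v + 0 *\<^sub>R w) v)"
    by (auto simp: algebra_simps)
  have d2: "((\<lambda>t. dmap f (u + s *\<^sub>R v + t *\<^sub>R w) v) has_field_derivative dmap
      (\<lambda>x. dmap f x v) (u + s *\<^sub>R v + t *\<^sub>R w) w) (at t)"
    if "t \<in> {0..h}" for t
  proof -
    have "u + s *\<^sub>R v + t *\<^sub>R w \<in> U" using box that s by auto
    note fd = dmap_works[OF f'[OF this]]
    have "((\<lambda>t. dmap f (u + s *\<^sub>R v + t *\<^sub>R w) v) has_derivative (\<lambda>r. dmap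
        (\<lambda>x. dmap f x v) (u + s *\<^sub>R v + t *\<^sub>R w) (r *\<^sub>R w))) (at t)"
      by (rule has_derivative_compose[where f="\<lambda>t. u + s *\<^sub>R v + t *\<^sub>R w" and x=t
          and g="\<lambda>x. dmap f x v", OF _ fd]) (auto intro!: derivative_eq_intros)
    then show ?thesis unfolding has_field_derivative_def
      by (rule has_derivative_eq_rhs) (simp add: fun_eq_iff linear_scale[OF has_derivative_linear[OF
          fd]])
  qed
  have "\<exists>t. 0 < t \<and> t < h \<and> dmap f (u + s *\<^sub>R v + h *\<^sub>R w) v - dmap f (u + s *\<^sub>R v + 0 *\<^sub>R w) v
     = (h - 0) * dmap (\<lambda>x. dmap f x v) (u + s *\<^sub>R v + t *\<^sub>R w) w"
    using h by (intro MVT2[where f="\<lambda>t. dmap f (u + s *\<^sub>R v + t *\<^sub>R w) v"] d2) auto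
  then obtain t where t: "0 < t" "t < h" and 2: "dmap f (u + s *\<^sub>R v + h *\<^sub>R w) v - dmap f (u + s *\<^sub>R v
      + 0 *\<^sub>R w) v
     = h * dmap (\<lambda>x. dmap f x v) (u + s *\<^sub>R v + t *\<^sub>R w) w"
    by auto
  show thesis
    by (rule that[of s t]) (use s t 1 2 in \<open>auto simp: power2_eq_square\<close>)
qed

text \<open>The second difference over a small parallelogram is symmetric in v and w. By
  \<open>second_difference\<close> it is h^2 times either mixed derivative at some nearby point, and
  continuity moves both points to u.\<close>

lemma dmap_dmap_commute:
  fixes f :: "'a::euclidean_space \<Rightarrow> real"
  assumes U: "open U" "u \<in> U" and f: "Ck_on 2 U f"
  shows "dmap (\<lambda>x. dmap f x v) u w = dmap (\<lambda>x. dmap f x w) u v"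
proof -
  have f1: "f differentiable (at x)" and f2: "(\<lambda>x. dmap f x v) differentiable (at x)" if "x \<in> U" for x v
    using f that by (auto simp: numeral_2_eq_2 Ck_on_Suc_dmap)
  have f3: "continuous_on U (\<lambda>x. dmap (\<lambda>x. dmap f x v) x w)" for v w
    using f by (auto simp: numeral_2_eq_2 Ck_on_Suc_dmap)
  define A where "A = (\<lambda>x. dmap (\<lambda>x. dmap f x v) x w)"
  define B where "B = (\<lambda>x. dmap (\<lambda>x. dmap f x w) x v)"
  have c: "isCont A u" "isCont B u"
    using f3 U by (auto simp: A_def B_def continuous_on_eq_continuous_at)
  have le: "\<bar>A u - B u\<bar> \<le> 0 + e" if "e > 0" for e
  proof -
    obtain d1 where d1: "d1 > 0" "ball u d1 \<subseteq> U" using U by (meson openE)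
    obtain d2 where d2: "d2 > 0" "\<And>x. dist x u < d2 \<Longrightarrow> dist (A x) (A u) < e / 2"
      using c(1) \<open>e > 0\<close> unfolding continuous_at_eps_delta by (meson half_gt_zero)
    obtain d3 where d3: "d3 > 0" "\<And>x. dist x u < d3 \<Longrightarrow> dist (B x) (B u) < e / 2"
      using c(2) \<open>e > 0\<close> unfolding continuous_at_eps_delta by (meson half_gt_zero)
    define d where "d = min d1 (min d2 d3)"
    \<comment> \<open>With sides scaled by this h the parallelogram stays within distance d of u;
      the summand 1 covers v = w = 0 and makes the estimate strict.\<close>
    define h where "h = d / (norm v + norm w + 1)"
    have n: "norm v + norm w + 1 > 0" by (smt (verit) norm_ge_zero)
    have h: "h > 0" using d1 d2 d3 n by (simp add: h_def d_def)
    have near: "dist (u + s *\<^sub>R v + t *\<^sub>R w) u < d" if "s \<in> {0..h}" "t \<in> {0..h}" for s t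
    proof -
      have "dist (u + s *\<^sub>R v + t *\<^sub>R w) u \<le> s * norm v + t * norm w"
        using that norm_triangle_ineq[of "s *\<^sub>R v" "t *\<^sub>R w"] by (simp add: dist_norm)
      also have "\<dots> \<le> h * norm v + h * norm w" using that by (intro add_mono mult_right_mono) auto
      also have "\<dots> < h * (norm v + norm w + 1)" using h by (simp add: algebra_simps)
      also have "\<dots> = d" using n by (simp add: h_def)
      finally show ?thesis .
    qed
    have inU: "x \<in> U" if "dist x u < d" for x using that d1 by (auto simp: d_def dist_commute)
    obtain s t where st: "s \<in> {0..h}" "t \<in> {0..h}"
      "f (u + h *\<^sub>R v + h *\<^sub>R w) - f (u + h *\<^sub>R v) - f (u + h *\<^sub>R w) + f u
          = h^2 * A (u + s *\<^sub>R v + t *\<^sub>R w)"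
      unfolding A_def by (rule second_difference[OF f1 f2 h]) (use near inU in auto)
    have box: "u + s *\<^sub>R w + t *\<^sub>R v \<in> U" if "s \<in> {0..h}" "t \<in> {0..h}" for s t
      using inU[OF near[OF that(2,1)]] by (simp add: add_ac)
    obtain s' t' where st': "s' \<in> {0..h}" "t' \<in> {0..h}"
      "f (u + h *\<^sub>R w + h *\<^sub>R v) - f (u + h *\<^sub>R w) - f (u + h *\<^sub>R v) + f u
          = h^2 * B (u + s' *\<^sub>R w + t' *\<^sub>R v)"
      unfolding B_def by (rule second_difference[OF f1 f2 h box])
    have "h^2 * A (u + s *\<^sub>R v + t *\<^sub>R w) = h^2 * B (u + t' *\<^sub>R v + s' *\<^sub>R w)"
      using st(3) st'(3) by (simp add: algebra_simps del: mult_cancel_left mult_cancel_right)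
    then have "A (u + s *\<^sub>R v + t *\<^sub>R w) = B (u + t' *\<^sub>R v + s' *\<^sub>R w)" using h by simp
    moreover have "dist (A (u + s *\<^sub>R v + t *\<^sub>R w)) (A u) < e / 2"
      by (rule d2) (use near[OF st(1,2)] in \<open>simp add: d_def\<close>)
    moreover have "dist (B (u + t' *\<^sub>R v + s' *\<^sub>R w)) (B u) < e / 2"
      by (rule d3) (use near[OF st'(2,1)] in \<open>simp add: d_def\<close>)
    ultimately show ?thesis unfolding dist_real_def by linarith
  qed
  have "\<bar>A u - B u\<bar> \<le> 0" by (rule field_le_epsilon) (rule le)
  then show ?thesis by (simp add: A_def B_def)
qed

text \<open>By \<open>par\<close> the differentials of a and b are parallel, and the quotient is the
  factor between them. It serves below for a = p and b = \<rho>, as a substitute for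
  dp/d\<rho>.\<close>

lemma dmap_quotient_eq_0:
  fixes a b :: "'a::euclidean_space \<Rightarrow> real"
  assumes U: "open U" "u \<in> U" and a: "Ck_on 2 U a" and b: "Ck_on 2 U b"
    and par: "\<And>x v w. x \<in> U \<Longrightarrow> dmap a x v * dmap b x w = dmap a x w * dmap b x v"
    and V: "dmap a u V = 0" "dmap b u V = 0" and w: "dmap b u w \<noteq> 0"
  shows "(\<lambda>x. dmap a x w / dmap b x w) differentiable (at u)"
      "dmap (\<lambda>x. dmap a x w / dmap b x w) u V = 0"
proof -
  have da: "((\<lambda>x. dmap a x v) has_derivative dmap (\<lambda>x. dmap a x v) u) (at u)"
    and db: "((\<lambda>x. dmap b x v) has_derivative dmap (\<lambda>x. dmap b x v) u) (at u)" for v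
    using a b U by (auto simp: numeral_2_eq_2 Ck_on_Suc_dmap intro!: dmap_works)
  have "((\<lambda>x. dmap a x V * dmap b x w) has_derivative
      (\<lambda>h. dmap a u V * dmap (\<lambda>x. dmap b x w) u h + dmap (\<lambda>x. dmap a x V) u h * dmap b u w)) (at u)"
    by (rule has_derivative_mult[OF da db])
  moreover have "((\<lambda>x. dmap a x V * dmap b x w) has_derivative
      (\<lambda>h. dmap a u w * dmap (\<lambda>x. dmap b x V) u h + dmap (\<lambda>x. dmap a x w) u h * dmap b u V)) (at u)"
    by (rule has_derivative_transform_within_open[OF has_derivative_mult[OF da db] U]) (erule par)
  ultimately have "(\<lambda>h. dmap a u V * dmap (\<lambda>x. dmap b x w) u h + dmap (\<lambda>x. dmap a x V) u h * dmap b u w)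
    = (\<lambda>h. dmap a u w * dmap (\<lambda>x. dmap b x V) u h + dmap (\<lambda>x. dmap a x w) u h * dmap b u V)"
    by (rule has_derivative_unique)
  \<comment> \<open>V annihilates both differentials at u itself. Symmetry of second derivatives
    turns the w-derivatives of da(V) and db(V) into V-derivatives of da(w) and db(w), which form the
    numerator of the quotient rule.\<close>
  from fun_cong[OF this, of w] have *: "dmap (\<lambda>x. dmap a x w) u V * dmap b u w = dmap a u w * dmap
      (\<lambda>x. dmap b x w) u V"
    using V dmap_dmap_commute[OF U a, of V w] dmap_dmap_commute[OF U b, of V w] by simp
  note q = has_derivative_divide'[OF da db w]
  show "(\<lambda>x. dmap a x w / dmap b x w) differentiable (at u)" using q by (auto simp: differentiable_def)
  show "dmap (\<lambda>x. dmap a x w / dmap b x w) u V = 0" unfolding dmap_eqI[OF q] using * by simp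
qed

section \<open>Levi-Civita connection and Ricci curvature of BCV-spaces\<close>

text \<open>The connection form \<open>\<eta>\<close> of the Hopf fibration; the metric is the pullback of the base metric
  plus \<open>\<eta>\<^sup>2\<close>.\<close>

definition bcv_eta :: "real \<Rightarrow> real \<Rightarrow> real^3 \<Rightarrow> real^3 \<Rightarrow> real" where
  "bcv_eta \<kappa> \<tau> p v = v$3 + \<tau> * (p$2 * v$1 - p$1 * v$2) / bcv_F \<kappa> p"

lemma bcv_metric_eta:
  "bcv_metric \<kappa> \<tau> p u v = (u$1 * v$1 + u$2 * v$2) / (bcv_F \<kappa> p)^2 + bcv_eta \<kappa> \<tau> p u * bcv_eta \<kappa> \<tau> p v"
  by (simp add: bcv_metric_def bcv_eta_def)

text \<open>Below, \<open>bcv_dF\<close>, \<open>bcv_deta\<close>, \<open>bcv_dmetric\<close>, \<open>bcv_dgamma\<close> are derivatives with respect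
  to the base point, in the direction of the first vector argument.\<close>

definition bcv_dF :: "real \<Rightarrow> real^3 \<Rightarrow> real^3 \<Rightarrow> real" where
  "bcv_dF \<kappa> p u = \<kappa> / 2 * (p$1 * u$1 + p$2 * u$2)"

lemma has_derivative_nth [derivative_intros]:
  fixes f :: "'b::real_normed_vector \<Rightarrow> real^'n"
  shows "(f has_derivative f') F \<Longrightarrow> ((\<lambda>x. f x $ i) has_derivative (\<lambda>h. f' h $ i)) F"
  by (rule bounded_linear.has_derivative[OF bounded_linear_vec_nth])

lemma has_derivative_bcv_F [derivative_intros]:
  "(bcv_F \<kappa> has_derivative bcv_dF \<kappa> p) (at p)"
  unfolding bcv_F_def bcv_dF_def
  by (auto intro!: derivative_eq_intros simp: fun_eq_iff algebra_simps)

definition bcv_deta :: "real \<Rightarrow> real \<Rightarrow> real^3 \<Rightarrow> real^3 \<Rightarrow> real^3 \<Rightarrow> real" where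
  "bcv_deta \<kappa> \<tau> p u v = \<tau> * (u$2 * v$1 - u$1 * v$2) / bcv_F \<kappa> p
     - \<tau> * (p$2 * v$1 - p$1 * v$2) * bcv_dF \<kappa> p u / (bcv_F \<kappa> p)^2"

lemma has_derivative_bcv_eta [derivative_intros]:
  assumes "bcv_F \<kappa> p \<noteq> 0"
  shows "((\<lambda>q. bcv_eta \<kappa> \<tau> q v) has_derivative (\<lambda>u. bcv_deta \<kappa> \<tau> p u v)) (at p)"
  unfolding bcv_eta_def bcv_deta_def using assms
  by (auto intro!: derivative_eq_intros simp: fun_eq_iff field_simps power2_eq_square)

definition bcv_dmetric :: "real \<Rightarrow> real \<Rightarrow> real^3 \<Rightarrow> real^3 \<Rightarrow> real^3 \<Rightarrow> real^3 \<Rightarrow> real" where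
  "bcv_dmetric \<kappa> \<tau> p u v w = - 2 * (v$1 * w$1 + v$2 * w$2) * bcv_dF \<kappa> p u / (bcv_F \<kappa> p)^3
     + bcv_deta \<kappa> \<tau> p u v * bcv_eta \<kappa> \<tau> p w + bcv_eta \<kappa> \<tau> p v * bcv_deta \<kappa> \<tau> p u w"

lemma has_derivative_bcv_metric:
  assumes "bcv_F \<kappa> p \<noteq> 0"
  shows "((\<lambda>q. bcv_metric \<kappa> \<tau> q v w) has_derivative (\<lambda>u. bcv_dmetric \<kappa> \<tau> p u v w)) (at p)"
  unfolding bcv_metric_eta bcv_dmetric_def using assms
  by (auto intro!: derivative_eq_intros simp: fun_eq_iff field_simps power2_eq_square power3_eq_cube)

text \<open>The Christoffel symbols in closed form, confirmed by \<open>bcv_gamma_koszul\<close>.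
  The first two components are those of the conformal base metric plus \<tau>-terms from the
  curvature of the Hopf fibration.\<close>

definition bcv_gamma :: "real \<Rightarrow> real \<Rightarrow> real^3 \<Rightarrow> real^3 \<Rightarrow> real^3 \<Rightarrow> real^3" where
  "bcv_gamma \<kappa> \<tau> p v w = (let l = 1 / bcv_F \<kappa> p; x = p$1; y = p$2;
      s = (\<lambda>u::real^3. x * u$1 + y * u$2); t = (\<lambda>u::real^3. y * u$1 - x * u$2);
      e = bcv_eta \<kappa> \<tau> p in
    vector [- (\<kappa> * l / 2) * (s v * w$1 + s w * v$1 - (v$1 * w$1 + v$2 * w$2) * x) + \<tau> *
        (e w * v$2 + e v * w$2),
            - (\<kappa> * l / 2) * (s v * w$2 + s w * v$2 - (v$1 * w$1 + v$2 * w$2) * y) - \<tau> *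
                (e w * v$1 + e v * w$1),
            \<kappa> * \<tau> * l^2 / 4 * (t w * s v + t v * s w) - \<tau>^2 * l * (e w * s v + e v * s w)])"

lemma bcv_gamma_nth:
  fixes p v w :: "real^3" and \<kappa> \<tau> :: real
  defines "l \<equiv> 1 / bcv_F \<kappa> p" and "s \<equiv> \<lambda>u::real^3. p$1 * u$1 + p$2 * u$2"
    and "t \<equiv> \<lambda>u::real^3. p$2 * u$1 - p$1 * u$2" and "e \<equiv> bcv_eta \<kappa> \<tau> p"
  shows "bcv_gamma \<kappa> \<tau> p v w $ 1 = - (\<kappa> * l / 2) * (s v * w$1 + s w * v$1 - (v$1 * w$1
      + v$2 * w$2) * p$1) + \<tau> * (e w * v$2 + e v * w$2)"
    and "bcv_gamma \<kappa> \<tau> p v w $ 2 = - (\<kappa> * l / 2) * (s v * w$2 + s w * v$2 - (v$1 * w$1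
        + v$2 * w$2) * p$2) - \<tau> * (e w * v$1 + e v * w$1)"
    and "bcv_gamma \<kappa> \<tau> p v w $ 3 = \<kappa> * \<tau> * l^2 / 4 * (t w * s v + t v * s w) - \<tau>^2 * l * (e w * s v
        + e v * s w)"
  unfolding bcv_gamma_def Let_def assms by simp_all

text \<open>This is the Koszul formula paired with the Hopf field: \<eta> is the metric dual of that
  field, and the metric does not change along it.\<close>

lemma bcv_eta_gamma:
  "bcv_eta \<kappa> \<tau> p (bcv_gamma \<kappa> \<tau> p v w) = (bcv_deta \<kappa> \<tau> p v w + bcv_deta \<kappa> \<tau> p w v) / 2"
proof -
  define l where "l = 1 / bcv_F \<kappa> p"
  define a where "a = bcv_eta \<kappa> \<tau> p v"
  define b where "b = bcv_eta \<kappa> \<tau> p w"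
  have d: "z / bcv_F \<kappa> p = l * z" "z / (bcv_F \<kappa> p)^2 = l^2 * z" for z
    by (simp_all add: l_def power_one_over)
  show ?thesis
    unfolding bcv_eta_def[of _ _ _ "bcv_gamma _ _ _ _ _"] bcv_gamma_nth bcv_deta_def bcv_dF_def
        a_def[symmetric] b_def[symmetric] d
    by (simp add: field_simps power2_eq_square)
qed

text \<open>The curvature of the Hopf fibration: \<open>d\<eta> = - 2 \<tau> F\<^sup>-\<^sup>2 dx \<and> dy\<close>.\<close>

lemma bcv_deta_skew:
  assumes "bcv_F \<kappa> p \<noteq> 0"
  shows "bcv_deta \<kappa> \<tau> p v w - bcv_deta \<kappa> \<tau> p w v = - 2 * \<tau> / (bcv_F \<kappa> p)^2 * (v$1 * w$2 - v$2 * w$1)"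
proof -
  define f where "f = bcv_F \<kappa> p"
  have "bcv_deta \<kappa> \<tau> p v w - bcv_deta \<kappa> \<tau> p w v = - \<tau> * (v$1 * w$2 - v$2 * w$1) * (2 * f
      - \<kappa> / 2 * ((p$1)^2 + (p$2)^2)) / f^2"
    using assms unfolding bcv_deta_def bcv_dF_def f_def[symmetric]
    by (simp add: divide_simps) (simp add: algebra_simps eval_nat_numeral)
  also have "2 * f - \<kappa> / 2 * ((p$1)^2 + (p$2)^2) = 2"
    unfolding f_def bcv_F_def by (simp add: field_simps)
  finally show ?thesis by (simp add: f_def)
qed

lemma bcv_gamma_koszul:
  assumes F: "bcv_F \<kappa> p \<noteq> 0"
  shows "2 * bcv_metric \<kappa> \<tau> p (bcv_gamma \<kappa> \<tau> p v w) z =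
    bcv_dmetric \<kappa> \<tau> p v w z + bcv_dmetric \<kappa> \<tau> p w v z - bcv_dmetric \<kappa> \<tau> p z v w"
proof -
  define f where "f = bcv_F \<kappa> p"
  note sk = bcv_deta_skew[OF F, of \<tau>]
  define a where "a = bcv_eta \<kappa> \<tau> p v"
  define b where "b = bcv_eta \<kappa> \<tau> p w"
  define c where "c = bcv_eta \<kappa> \<tau> p z"
  define A where "A = bcv_deta \<kappa> \<tau> p v w + bcv_deta \<kappa> \<tau> p w v"
  \<comment> \<open>Moving z into the differentiation slot lets these derivatives of \<eta> cancel
    against the last Koszul term; only the skew remainders survive.\<close>
  have 1: "bcv_deta \<kappa> \<tau> p v z = bcv_deta \<kappa> \<tau> p z v - 2 * \<tau> / f^2 * (v$1 * z$2 - v$2 * z$1)"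
    using sk[of v z] by (simp add: f_def)
  have 2: "bcv_deta \<kappa> \<tau> p w z = bcv_deta \<kappa> \<tau> p z w - 2 * \<tau> / f^2 * (w$1 * z$2 - w$2 * z$1)"
    using sk[of w z] by (simp add: f_def)
  have R: "bcv_dmetric \<kappa> \<tau> p v w z + bcv_dmetric \<kappa> \<tau> p w v z - bcv_dmetric \<kappa> \<tau> p z v w
    = -2 / f^3 * ((w$1 * z$1 + w$2 * z$2) * bcv_dF \<kappa> p v + (v$1 * z$1 + v$2 * z$2) * bcv_dF \<kappa> p w -
        (v$1 * w$1 + v$2 * w$2) * bcv_dF \<kappa> p z)
      + A * c - 2 * \<tau> / f^2 * (b * (v$1 * z$2 - v$2 * z$1) + a * (w$1 * z$2 - w$2 * z$1))"
    unfolding bcv_dmetric_def 1 2 a_def[symmetric] b_def[symmetric] c_def[symmetric] A_def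
        f_def[symmetric]
    by (simp add: algebra_simps add_divide_distrib diff_divide_distrib)
  have "2 * (bcv_gamma \<kappa> \<tau> p v w $ 1 * z $ 1 + bcv_gamma \<kappa> \<tau> p v w $ 2 * z $ 2) / f^2 =
     -2 / f^3 * ((w$1 * z$1 + w$2 * z$2) * bcv_dF \<kappa> p v + (v$1 * z$1 + v$2 * z$2) * bcv_dF \<kappa> p w -
         (v$1 * w$1 + v$2 * w$2) * bcv_dF \<kappa> p z)
     - 2 * \<tau> / f^2 * (b * (v$1 * z$2 - v$2 * z$1) + a * (w$1 * z$2 - w$2 * z$1))"
    using F unfolding bcv_gamma_def Let_def a_def[symmetric] b_def[symmetric] f_def[symmetric] bcv_dF_def
    by (simp add: vector_3) (simp add: field_simps power2_eq_square power3_eq_cube)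
  moreover have "2 * (bcv_eta \<kappa> \<tau> p (bcv_gamma \<kappa> \<tau> p v w) * c) = A * c"
    by (simp add: bcv_eta_gamma A_def)
  ultimately show ?thesis unfolding R bcv_metric_eta c_def[symmetric] f_def[symmetric]
    by (simp add: algebra_simps add_divide_distrib)
qed

lemma bcv_eta_linear: "linear (bcv_eta \<kappa> \<tau> p)"
  by (rule linearI) (simp_all add: bcv_eta_def algebra_simps add_divide_distrib diff_divide_distrib)

lemma bcv_metric_bilinear: "bilinear (bcv_metric \<kappa> \<tau> p)"
  unfolding bilinear_def
  by (auto intro!: linearI simp: bcv_metric_def algebra_simps add_divide_distrib diff_divide_distrib)

lemma bcv_metric_commute: "bcv_metric \<kappa> \<tau> p u v = bcv_metric \<kappa> \<tau> p v u"
  by (simp add: bcv_metric_def mult.commute)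

lemma bcv_metric_eq_0_iff:
  assumes F: "bcv_F \<kappa> p \<noteq> 0"
  shows "bcv_metric \<kappa> \<tau> p v v = 0 \<longleftrightarrow> v = 0"
proof
  assume "bcv_metric \<kappa> \<tau> p v v = 0"
  then have *: "(v$1 / bcv_F \<kappa> p)^2 + (v$2 / bcv_F \<kappa> p)^2 + (bcv_eta \<kappa> \<tau> p v)^2 = 0"
    by (simp add: bcv_metric_eta power_divide add_divide_distrib power2_eq_square)
  then have "(v$1 / bcv_F \<kappa> p)^2 = 0 \<and> (v$2 / bcv_F \<kappa> p)^2 = 0 \<and> (bcv_eta \<kappa> \<tau> p v)^2 = 0"
    by (smt (verit) zero_le_power2)
  then show "v = 0" using F by (auto simp: vec_eq_iff forall_3 bcv_eta_def)
qed (simp add: bcv_metric_def)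

lemma bcv_metric_eqI:
  assumes F: "bcv_F \<kappa> p \<noteq> 0" and e: "\<And>w. bcv_metric \<kappa> \<tau> p a w = bcv_metric \<kappa> \<tau> p b w"
  shows "a = b"
proof -
  have "bcv_metric \<kappa> \<tau> p (a - b) (a - b) = 0"
    using e[of "a - b"] by (simp add: bilinear_lsub[OF bcv_metric_bilinear])
  then show ?thesis using bcv_metric_eq_0_iff[OF F] by simp
qed

text \<open>The Koszul formula shows that \<open>bcv_gamma\<close> fits the definite description,
  and definiteness of the metric makes it the only such vector.\<close>

lemma christoffel_bcv:
  assumes F: "bcv_F \<kappa> p \<noteq> 0"
  shows "christoffel (bcv_metric \<kappa> \<tau>) p v w = bcv_gamma \<kappa> \<tau> p v w"
proof -
  have fd: "frechet_derivative (\<lambda>q. bcv_metric \<kappa> \<tau> q v w) (at p) = (\<lambda>u. bcv_dmetric \<kappa> \<tau> p u v w)" for v w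
    using frechet_derivative_at[OF has_derivative_bcv_metric[OF F]] by metis
  show ?thesis unfolding christoffel_def fd
  proof (rule the_equality)
    show "\<forall>z. 2 * bcv_metric \<kappa> \<tau> p (bcv_gamma \<kappa> \<tau> p v w) z =
        bcv_dmetric \<kappa> \<tau> p v w z + bcv_dmetric \<kappa> \<tau> p w v z - bcv_dmetric \<kappa> \<tau> p z v w"
      using bcv_gamma_koszul[OF F] by blast
    fix c assume c: "\<forall>z. 2 * bcv_metric \<kappa> \<tau> p c z =
        bcv_dmetric \<kappa> \<tau> p v w z + bcv_dmetric \<kappa> \<tau> p w v z - bcv_dmetric \<kappa> \<tau> p z v w"
    show "c = bcv_gamma \<kappa> \<tau> p v w"
      by (rule bcv_metric_eqI[OF F, of \<tau>]) (use c bcv_gamma_koszul[OF F, of \<tau> v w] in \<open>smt (verit)\<close>)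
  qed
qed

lemma has_derivative_componentwise_vec:
  fixes f :: "'b::real_normed_vector \<Rightarrow> real^'n"
  assumes "\<And>i. ((\<lambda>x. f x $ i) has_derivative (\<lambda>h. f' h $ i)) (at a)"
  shows "(f has_derivative f') (at a)"
  using assms
  by (subst has_derivative_componentwise_within) (auto simp: Basis_vec_def inner_axis)

lemma bcv_F_continuous: "continuous_on UNIV (bcv_F \<kappa>)"
  unfolding bcv_F_def by (intro continuous_intros)

lemma open_bcv_F_nonzero: "open {p. bcv_F \<kappa> p \<noteq> 0}"
  using open_Collect_neq[OF bcv_F_continuous continuous_on_const] by simp

section \<open>Ricci curvature\<close>

definition bcv_dgamma :: "real \<Rightarrow> real \<Rightarrow> real^3 \<Rightarrow> real^3 \<Rightarrow> real^3 \<Rightarrow> real^3 \<Rightarrow> real^3" where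
  "bcv_dgamma \<kappa> \<tau> p u v w = (let l = 1 / bcv_F \<kappa> p; x = p$1; y = p$2;
      s = (\<lambda>u::real^3. x * u$1 + y * u$2); t = (\<lambda>u::real^3. y * u$1 - x * u$2);
      e = bcv_eta \<kappa> \<tau> p; dl = - (\<kappa> / 2) * l^2 * s u;
      ds = (\<lambda>v::real^3. u$1 * v$1 + u$2 * v$2); dt = (\<lambda>v::real^3. u$2 * v$1 - u$1 * v$2);
      de = (\<lambda>v::real^3. \<tau> * l * dt v + \<tau> * dl * t v) in
    vector [- (\<kappa> * l / 2) * (ds v * w$1 + ds w * v$1 - (v$1 * w$1 + v$2 * w$2) * u$1)
              - (\<kappa> * dl / 2) * (s v * w$1 + s w * v$1 - (v$1 * w$1 + v$2 * w$2) * x) + \<tau> *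
                  (de w * v$2 + de v * w$2),
            - (\<kappa> * l / 2) * (ds v * w$2 + ds w * v$2 - (v$1 * w$1 + v$2 * w$2) * u$2)
              - (\<kappa> * dl / 2) * (s v * w$2 + s w * v$2 - (v$1 * w$1 + v$2 * w$2) * y) - \<tau> *
                  (de w * v$1 + de v * w$1),
            \<kappa> * \<tau> * l^2 / 4 * (t w * ds v + t v * ds w + dt w * s v + dt v * s w)
                + \<kappa> * \<tau> * l * dl / 2 * (t w * s v + t v * s w)
              - \<tau>^2 * l * (e w * ds v + e v * ds w + de w * s v + de v * s w) - \<tau>^2 * dl *
                  (e w * s v + e v * s w)])"

lemma has_derivative_bcv_gamma:
  assumes F: "bcv_F \<kappa> p \<noteq> 0"
  shows "((\<lambda>q. bcv_gamma \<kappa> \<tau> q v w) has_derivative (\<lambda>u. bcv_dgamma \<kappa> \<tau> p u v w)) (at p)"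
proof (rule has_derivative_componentwise_vec)
  fix i :: 3
  define l where "l = 1 / bcv_F \<kappa> p"
  have dl: "((\<lambda>q. 1 / bcv_F \<kappa> q) has_derivative (\<lambda>u. - (\<kappa> / 2) * l^2 * (p$1 * u$1 + p$2 * u$2))) (at p)"
    using F by (auto intro!: derivative_eq_intros simp: fun_eq_iff bcv_dF_def l_def field_simps
        power2_eq_square)
  have de: "((\<lambda>q. bcv_eta \<kappa> \<tau> q v) has_derivative
     (\<lambda>u. \<tau> * l * (u$2 * v$1 - u$1 * v$2) + \<tau> * (- (\<kappa> / 2) * l^2 * (p$1 * u$1 + p$2 * u$2)) *
         (p$2 * v$1 - p$1 * v$2))) (at p)" for v
    using has_derivative_bcv_eta[OF F, of \<tau> v]
    by (rule has_derivative_eq_rhs) (use F in \<open>simp add: fun_eq_iff bcv_deta_def bcv_dF_def l_def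
        field_simps power2_eq_square\<close>)
  consider "i = 1" | "i = 2" | "i = 3" using exhaust_3 by blast
  then show "((\<lambda>q. bcv_gamma \<kappa> \<tau> q v w $ i) has_derivative (\<lambda>u. bcv_dgamma \<kappa> \<tau> p u v w $ i)) (at p)"
  proof cases
    case 1
    show ?thesis unfolding 1 bcv_gamma_nth bcv_dgamma_def Let_def vector_3
      by (rule dl de derivative_eq_intros refl | (simp; fail))+
          (simp only: l_def[symmetric], simp add: fun_eq_iff field_simps power2_eq_square)
  next
    case 2
    show ?thesis unfolding 2 bcv_gamma_nth bcv_dgamma_def Let_def vector_3
      by (rule dl de derivative_eq_intros refl | (simp; fail))+
          (simp only: l_def[symmetric], simp add: fun_eq_iff field_simps power2_eq_square)
  next
    case 3
    show ?thesis unfolding 3 bcv_gamma_nth bcv_dgamma_def Let_def vector_3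
      by (rule dl de derivative_eq_intros refl | (simp; fail))+
          (simp only: l_def[symmetric], simp add: fun_eq_iff field_simps power2_eq_square)
  qed
qed

text \<open>\<open>christoffel\<close> is identified only where F is nonzero. That set is open, so
  its derivative there may be taken from \<open>bcv_gamma\<close>.\<close>

lemma riemann_bcv:
  assumes F: "bcv_F \<kappa> p \<noteq> 0"
  shows "riemann (bcv_metric \<kappa> \<tau>) p u v w =
    bcv_dgamma \<kappa> \<tau> p u v w - bcv_dgamma \<kappa> \<tau> p v u w
    + bcv_gamma \<kappa> \<tau> p u (bcv_gamma \<kappa> \<tau> p v w) - bcv_gamma \<kappa> \<tau> p v (bcv_gamma \<kappa> \<tau> p u w)"
proof -
  have "((\<lambda>q. christoffel (bcv_metric \<kappa> \<tau>) q v w) has_derivative (\<lambda>u. bcv_dgamma \<kappa> \<tau> p u v w)) (at p)"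
      for v w
    by (rule has_derivative_transform_within_open[OF has_derivative_bcv_gamma[OF F]
        open_bcv_F_nonzero[of \<kappa>]])
      (use F in \<open>auto simp: christoffel_bcv\<close>)
  then have "frechet_derivative (\<lambda>q. christoffel (bcv_metric \<kappa> \<tau>) q v w) (at p) =
      (\<lambda>u. bcv_dgamma \<kappa> \<tau> p u v w)" for v w
    by (metis frechet_derivative_at)
  then show ?thesis by (simp add: riemann_def cov_deriv_def christoffel_bcv[OF F])
qed

lemma trace_matrix_3: "trace (matrix (f :: real^3 \<Rightarrow> real^3))
    = f (axis 1 1) $ 1 + f (axis 2 1) $ 2 + f (axis 3 1) $ 3"
  by (simp add: trace_def matrix_def sum_3)

lemma axis_nth_3 [simp]:
  "(axis 1 c :: real^3) $ 1 = c" "(axis 1 c :: real^3) $ 2 = 0" "(axis 1 c :: real^3) $ 3 = 0"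
  "(axis 2 c :: real^3) $ 1 = 0" "(axis 2 c :: real^3) $ 2 = c" "(axis 2 c :: real^3) $ 3 = 0"
  "(axis 3 c :: real^3) $ 1 = 0" "(axis 3 c :: real^3) $ 2 = 0" "(axis 3 c :: real^3) $ 3 = c"
  by (simp_all add: axis_def)

text \<open>The Hopf field is an eigenvector for 2 \<tau>^2, and its orthogonal complement belongs
  to \<kappa> - 2 \<tau>^2; the two agree exactly for space forms. The proof traces the four terms
  of \<open>riemann_bcv\<close> separately over the coordinate basis.\<close>

lemma ricci_bcv:
  assumes F: "bcv_F \<kappa> p \<noteq> 0"
  shows "ricci (bcv_metric \<kappa> \<tau>) p v w =
    (\<kappa> - 2 * \<tau>^2) * bcv_metric \<kappa> \<tau> p v w + (4 * \<tau>^2 - \<kappa>) * bcv_eta \<kappa> \<tau> p v * bcv_eta \<kappa> \<tau> p w"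
proof -
  define l where "l = 1 / bcv_F \<kappa> p"
  define x y where "x = p$1" and "y = p$2"
  define a1 a2 a where "a1 = v$1" and "a2 = v$2" and "a = bcv_eta \<kappa> \<tau> p v"
  define b1 b2 b where "b1 = w$1" and "b2 = w$2" and "b = bcv_eta \<kappa> \<tau> p w"
  note d = l_def[symmetric] x_def[symmetric] y_def[symmetric] a1_def[symmetric] a2_def[symmetric]
      a_def[symmetric]
    b1_def[symmetric] b2_def[symmetric] b_def[symmetric]
  define sa sb ta tb where "sa = x * a1 + y * a2" and "sb = x * b1 + y * b2" and "ta = y * a1 - x * a2"
      and "tb = y * b1 - x * b2"
  define ab where "ab = a1 * b1 + a2 * b2"
  define r where "r = x^2 + y^2"
  note D = sa_def sb_def ta_def tb_def ab_def r_def
  have e1: "bcv_eta \<kappa> \<tau> p (axis 1 1) = \<tau> * l * y" "bcv_eta \<kappa> \<tau> p (axis 2 1) = - \<tau> * l * x"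
      "bcv_eta \<kappa> \<tau> p (axis 3 1) = 1"
    by (simp_all add: bcv_eta_def l_def x_def y_def)
  have e2: "bcv_eta \<kappa> \<tau> p (bcv_gamma \<kappa> \<tau> p v w) = - (\<kappa> * \<tau> * l^2 / 4) * ((p$2 * w$1
      - p$1 * w$2) * (p$1 * v$1 + p$2 * v$2) + (p$2 * v$1 - p$1 * v$2) *
      (p$1 * w$1 + p$2 * w$2))" for v w
    unfolding bcv_eta_gamma using F by (simp add: bcv_deta_def bcv_dF_def l_def field_simps)
  let ?D = "bcv_dgamma \<kappa> \<tau> p" and ?G = "bcv_gamma \<kappa> \<tau> p"
  have T1: "?D (axis 1 1) v w $ 1 + ?D (axis 2 1) v w $ 2 + ?D (axis 3 1) v w $ 3
      = \<kappa>^2 * l^2 / 4 * (2 * sa * sb - ab * r) - 2 * \<tau>^2 * l * ab + \<kappa> * \<tau>^2 * l^2 * ta * tb"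
    unfolding bcv_dgamma_def Let_def vector_3 axis_nth_3 d D
    by (simp add: field_simps power2_eq_square)
  have T2: "?D v (axis 1 1) w $ 1 + ?D v (axis 2 1) w $ 2 + ?D v (axis 3 1) w $ 3
      = - \<kappa> * (l * ab - \<kappa> / 2 * l^2 * sa * sb)"
    unfolding bcv_dgamma_def Let_def vector_3 axis_nth_3 d e1 D
    by (simp add: field_simps power2_eq_square)
  have T3: "?G (axis 1 1) (?G v w) $ 1 + ?G (axis 2 1) (?G v w) $ 2 + ?G (axis 3 1) (?G v w) $ 3
      = \<kappa>^2 * l^2 / 2 * (2 * sa * sb - ab * r) + \<kappa> * \<tau> * l * (b * ta + a * tb)"
    unfolding bcv_gamma_nth[of _ _ _ "axis _ _"] axis_nth_3 e1 e2 unfolding bcv_gamma_nth d D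
    by (simp add: field_simps power2_eq_square)
  have T4: "?G v (?G (axis 1 1) w) $ 1 + ?G v (?G (axis 2 1) w) $ 2 + ?G v (?G (axis 3 1) w) $ 3
      = \<kappa>^2 * l^2 / 2 * (sa * sb - ta * tb) + \<kappa> * \<tau> * l * (b * ta + a * tb) - 2 * \<tau>^2 * a * b
        + \<kappa> * \<tau>^2 * l^2 / 2 * (ta * tb - sa * sb)"
    unfolding bcv_gamma_nth[of _ _ _ v] axis_nth_3 e1 e2 unfolding bcv_gamma_nth d D axis_nth_3 e1
    by (simp add: field_simps power2_eq_square)
  \<comment> \<open>Expansion of the planar inner product in the orthogonal directions (x, y) and
    (y, -x).\<close>
  have r: "ab * r = sa * sb + ta * tb" unfolding D by (simp add: algebra_simps power2_eq_square)
  \<comment> \<open>This is F = 1 + \<kappa> r / 4 multiplied by l^2.\<close>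
  have l: "l = l^2 + \<kappa> / 4 * r * l^2"
  proof -
    have "\<kappa> / 4 * r = bcv_F \<kappa> p - 1" by (simp add: bcv_F_def r_def x_def y_def)
    then show ?thesis using F by (simp add: l_def field_simps power2_eq_square)
  qed
  have m: "bcv_metric \<kappa> \<tau> p v w = l^2 * ab + a * b"
    unfolding bcv_metric_eta l_def ab_def a_def b_def a1_def a2_def b1_def b2_def
      by (simp add: power_one_over)
  have "ricci (bcv_metric \<kappa> \<tau>) p v w =
      (\<kappa>^2 * l^2 / 4 * (2 * sa * sb - ab * r) - 2 * \<tau>^2 * l * ab + \<kappa> * \<tau>^2 * l^2 * ta * tb)
      + \<kappa> * (l * ab - \<kappa> / 2 * l^2 * sa * sb)
      + (\<kappa>^2 * l^2 / 2 * (2 * sa * sb - ab * r) + \<kappa> * \<tau> * l * (b * ta + a * tb))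
      - (\<kappa>^2 * l^2 / 2 * (sa * sb - ta * tb) + \<kappa> * \<tau> * l * (b * ta + a * tb) - 2 * \<tau>^2 * a * b
        + \<kappa> * \<tau>^2 * l^2 / 2 * (ta * tb - sa * sb))"
    unfolding ricci_def trace_matrix_3 riemann_bcv[OF F]
    using T1 T2 T3 T4 by simp
  also have "\<dots> = (\<kappa> - 2 * \<tau>^2) * ab * l - \<kappa>^2 * l^2 / 4 * (ab * r) + \<kappa> * \<tau>^2 * l^2 / 2 * (ab * r)
      + 2 * \<tau>^2 * a * b"
    unfolding r by (simp add: field_simps power2_eq_square)
  also have "\<dots> = (\<kappa> - 2 * \<tau>^2) * ab * (l - \<kappa> / 4 * r * l^2) + 2 * \<tau>^2 * a * b"
    by (simp add: field_simps power2_eq_square)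
  also have "l - \<kappa> / 4 * r * l^2 = l^2" using l by linarith
  finally show ?thesis unfolding m a_def[symmetric] b_def[symmetric] by (simp add: algebra_simps)
qed

section \<open>The frame adapted to rotations\<close>

text \<open>The rotation field \<open>rotv\<close>, the radial field \<open>radv\<close> and \<open>liftv\<close> are mutually orthogonal;
  \<open>liftv\<close> is the multiple with \<open>\<eta> = 1\<close> of the projection of the Hopf field off \<open>rotv\<close>.\<close>

definition hor :: "real^3 \<Rightarrow> real^3 \<Rightarrow> real" where
  "hor v w = v$1 * w$1 + v$2 * w$2"

definition rad2 :: "real^3 \<Rightarrow> real" where "rad2 a = (a$1)^2 + (a$2)^2"

definition rotv :: "real^3 \<Rightarrow> real^3" where "rotv a = vector [- a$2, a$1, 0]"

definition radv :: "real^3 \<Rightarrow> real^3" where "radv a = vector [a$1, a$2, 0]"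

definition bcv_G :: "real \<Rightarrow> real^3 \<Rightarrow> real" where "bcv_G \<tau> a = 1 + \<tau>^2 * rad2 a"

definition liftv :: "real \<Rightarrow> real \<Rightarrow> real^3 \<Rightarrow> real^3" where
  "liftv \<kappa> \<tau> a = vector [- \<tau> * bcv_F \<kappa> a * a$2, \<tau> * bcv_F \<kappa> a * a$1, bcv_G \<tau> a]"

lemma frame_nth [simp]:
  "rotv a $ 1 = - a$2" "rotv a $ 2 = a$1" "rotv a $ 3 = 0"
  "radv a $ 1 = a$1" "radv a $ 2 = a$2" "radv a $ 3 = 0"
  "liftv \<kappa> \<tau> a $ 1 = - \<tau> * bcv_F \<kappa> a * a$2" "liftv \<kappa> \<tau> a $ 2 = \<tau> * bcv_F \<kappa> a * a$1"
  "liftv \<kappa> \<tau> a $ 3 = bcv_G \<tau> a"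
  by (simp_all add: rotv_def radv_def liftv_def)

lemma bcv_F_rad2: "bcv_F \<kappa> a = 1 + \<kappa> / 4 * rad2 a"
  by (simp add: bcv_F_def rad2_def)

lemma bcv_G_pos: "bcv_G \<tau> a > 0"
  unfolding bcv_G_def rad2_def by (simp add: add_pos_nonneg)

lemma bcv_metric_hor: "bcv_metric \<kappa> \<tau> a v w = hor v w / (bcv_F \<kappa> a)^2
    + bcv_eta \<kappa> \<tau> a v * bcv_eta \<kappa> \<tau> a w"
  by (simp add: bcv_metric_eta hor_def)

lemma bcv_dmetric_hor:
  "bcv_dmetric \<kappa> \<tau> a u v w = - 2 * hor v w * bcv_dF \<kappa> a u / (bcv_F \<kappa> a)^3
     + bcv_deta \<kappa> \<tau> a u v * bcv_eta \<kappa> \<tau> a w + bcv_eta \<kappa> \<tau> a v * bcv_deta \<kappa> \<tau> a u w"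
  by (simp add: bcv_dmetric_def hor_def)

lemma hor_linear:
  "hor (v + v') w = hor v w + hor v' w" "hor (c *\<^sub>R v) w = c * hor v w"
  "hor v (w + w') = hor v w + hor v w'" "hor v (c *\<^sub>R w) = c * hor v w"
  by (simp_all add: hor_def algebra_simps)

lemma bcv_dF_linear:
  "bcv_dF \<kappa> a (v + w) = bcv_dF \<kappa> a v + bcv_dF \<kappa> a w" "bcv_dF \<kappa> a (c *\<^sub>R v) = c * bcv_dF \<kappa> a v"
  by (simp_all add: bcv_dF_def algebra_simps)

lemma bcv_eta_simps:
  "bcv_eta \<kappa> \<tau> a (v + w) = bcv_eta \<kappa> \<tau> a v + bcv_eta \<kappa> \<tau> a w"
  "bcv_eta \<kappa> \<tau> a (c *\<^sub>R v) = c * bcv_eta \<kappa> \<tau> a v"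
  by (simp_all add: linear_add[OF bcv_eta_linear] linear_scale[OF bcv_eta_linear])

lemma bcv_deta_simps:
  "bcv_deta \<kappa> \<tau> a (v + v') w = bcv_deta \<kappa> \<tau> a v w + bcv_deta \<kappa> \<tau> a v' w"
  "bcv_deta \<kappa> \<tau> a (c *\<^sub>R v) w = c * bcv_deta \<kappa> \<tau> a v w"
  "bcv_deta \<kappa> \<tau> a v (w + w') = bcv_deta \<kappa> \<tau> a v w + bcv_deta \<kappa> \<tau> a v w'"
  "bcv_deta \<kappa> \<tau> a v (c *\<^sub>R w) = c * bcv_deta \<kappa> \<tau> a v w"
  by (simp_all add: bcv_deta_def bcv_dF_linear algebra_simps add_divide_distrib diff_divide_distrib)

lemma bcv_dmetric_simps:
  "bcv_dmetric \<kappa> \<tau> a (u + u') v w = bcv_dmetric \<kappa> \<tau> a u v w + bcv_dmetric \<kappa> \<tau> a u' v w"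
  "bcv_dmetric \<kappa> \<tau> a (c *\<^sub>R u) v w = c * bcv_dmetric \<kappa> \<tau> a u v w"
  "bcv_dmetric \<kappa> \<tau> a u (v + v') w = bcv_dmetric \<kappa> \<tau> a u v w + bcv_dmetric \<kappa> \<tau> a u v' w"
  "bcv_dmetric \<kappa> \<tau> a u (c *\<^sub>R v) w = c * bcv_dmetric \<kappa> \<tau> a u v w"
  "bcv_dmetric \<kappa> \<tau> a u v (w + w') = bcv_dmetric \<kappa> \<tau> a u v w + bcv_dmetric \<kappa> \<tau> a u v w'"
  "bcv_dmetric \<kappa> \<tau> a u v (c *\<^sub>R w) = c * bcv_dmetric \<kappa> \<tau> a u v w"
  by (simp_all add: bcv_dmetric_hor bcv_eta_simps bcv_deta_simps hor_linear bcv_dF_linear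
      algebra_simps add_divide_distrib diff_divide_distrib)

lemma bcv_metric_simps:
  "bcv_metric \<kappa> \<tau> a (v + v') w = bcv_metric \<kappa> \<tau> a v w + bcv_metric \<kappa> \<tau> a v' w"
  "bcv_metric \<kappa> \<tau> a (v - v') w = bcv_metric \<kappa> \<tau> a v w - bcv_metric \<kappa> \<tau> a v' w"
  "bcv_metric \<kappa> \<tau> a (- v) w = - bcv_metric \<kappa> \<tau> a v w"
  "bcv_metric \<kappa> \<tau> a (c *\<^sub>R v) w = c * bcv_metric \<kappa> \<tau> a v w"
  "bcv_metric \<kappa> \<tau> a v (w + w') = bcv_metric \<kappa> \<tau> a v w + bcv_metric \<kappa> \<tau> a v w'"
  "bcv_metric \<kappa> \<tau> a v (w - w') = bcv_metric \<kappa> \<tau> a v w - bcv_metric \<kappa> \<tau> a v w'"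
  "bcv_metric \<kappa> \<tau> a v (- w) = - bcv_metric \<kappa> \<tau> a v w"
  "bcv_metric \<kappa> \<tau> a v (c *\<^sub>R w) = c * bcv_metric \<kappa> \<tau> a v w"
  by (simp_all add: bilinear_ladd[OF bcv_metric_bilinear] bilinear_lsub[OF bcv_metric_bilinear]
      bilinear_lneg[OF bcv_metric_bilinear] bilinear_lmul[OF bcv_metric_bilinear]
      bilinear_radd[OF bcv_metric_bilinear] bilinear_rsub[OF bcv_metric_bilinear]
      bilinear_rneg[OF bcv_metric_bilinear] bilinear_rmul[OF bcv_metric_bilinear])

lemma bcv_metric_0 [simp]: "bcv_metric \<kappa> \<tau> a 0 v = 0" "bcv_metric \<kappa> \<tau> a v 0 = 0"
  by (simp_all add: bcv_metric_def)

lemma hor_frame: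
  "hor (rotv a) (rotv a) = rad2 a" "hor (rotv a) (radv a) = 0"
      "hor (rotv a) (liftv \<kappa> \<tau> a) = \<tau> * bcv_F \<kappa> a * rad2 a"
  "hor (radv a) (rotv a) = 0" "hor (radv a) (radv a) = rad2 a" "hor (radv a) (liftv \<kappa> \<tau> a) = 0"
  "hor (liftv \<kappa> \<tau> a) (rotv a) = \<tau> * bcv_F \<kappa> a * rad2 a" "hor (liftv \<kappa> \<tau> a) (radv a) = 0"
  "hor (liftv \<kappa> \<tau> a) (liftv \<kappa> \<tau> a) = \<tau>^2 * (bcv_F \<kappa> a)^2 * rad2 a"
  by (simp_all add: hor_def rad2_def algebra_simps power2_eq_square)

lemma bcv_dF_frame:
  "bcv_dF \<kappa> a (rotv a) = 0" "bcv_dF \<kappa> a (radv a) = \<kappa> / 2 * rad2 a" "bcv_dF \<kappa> a (liftv \<kappa> \<tau> a) = 0"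
  by (simp_all add: bcv_dF_def rad2_def algebra_simps power2_eq_square)

lemma bcv_eta_frame:
  assumes "bcv_F \<kappa> a \<noteq> 0"
  shows "bcv_eta \<kappa> \<tau> a (rotv a) = - \<tau> * rad2 a / bcv_F \<kappa> a" "bcv_eta \<kappa> \<tau> a (radv a) = 0"
    "bcv_eta \<kappa> \<tau> a (liftv \<kappa> \<tau> a) = 1"
  using assms by (simp_all add: bcv_eta_def rad2_def bcv_G_def field_simps power2_eq_square)

lemma bcv_deta_frame:
  assumes F: "bcv_F \<kappa> a \<noteq> 0"
  shows
    "bcv_deta \<kappa> \<tau> a (rotv a) (rotv a) = 0"
    "bcv_deta \<kappa> \<tau> a (rotv a) (radv a) = \<tau> * rad2 a / bcv_F \<kappa> a"
    "bcv_deta \<kappa> \<tau> a (rotv a) (liftv \<kappa> \<tau> a) = 0"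
    "bcv_deta \<kappa> \<tau> a (radv a) (rotv a) = - \<tau> * rad2 a / bcv_F \<kappa> a
        + \<tau> * \<kappa> * (rad2 a)^2 / (2 * (bcv_F \<kappa> a)^2)"
    "bcv_deta \<kappa> \<tau> a (radv a) (radv a) = 0"
    "bcv_deta \<kappa> \<tau> a (radv a) (liftv \<kappa> \<tau> a) = \<tau>^2 * \<kappa> * (rad2 a)^2 / (2 * bcv_F \<kappa> a) - \<tau>^2 * rad2 a"
    "bcv_deta \<kappa> \<tau> a (liftv \<kappa> \<tau> a) (rotv a) = 0"
    "bcv_deta \<kappa> \<tau> a (liftv \<kappa> \<tau> a) (radv a) = \<tau>^2 * rad2 a"
    "bcv_deta \<kappa> \<tau> a (liftv \<kappa> \<tau> a) (liftv \<kappa> \<tau> a) = 0"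
  using F unfolding bcv_deta_def bcv_dF_frame
  by (simp_all add: rad2_def field_simps power2_eq_square)

lemma bcv_metric_frame:
  assumes F: "bcv_F \<kappa> a \<noteq> 0"
  shows "bcv_metric \<kappa> \<tau> a (rotv a) (rotv a) = rad2 a * bcv_G \<tau> a / (bcv_F \<kappa> a)^2"
    "bcv_metric \<kappa> \<tau> a (radv a) (radv a) = rad2 a / (bcv_F \<kappa> a)^2"
    "bcv_metric \<kappa> \<tau> a (liftv \<kappa> \<tau> a) (liftv \<kappa> \<tau> a) = bcv_G \<tau> a"
    "bcv_metric \<kappa> \<tau> a (rotv a) (radv a) = 0" "bcv_metric \<kappa> \<tau> a (radv a) (rotv a) = 0"
    "bcv_metric \<kappa> \<tau> a (rotv a) (liftv \<kappa> \<tau> a) = 0" "bcv_metric \<kappa> \<tau> a (liftv \<kappa> \<tau> a) (rotv a) = 0"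
    "bcv_metric \<kappa> \<tau> a (radv a) (liftv \<kappa> \<tau> a) = 0" "bcv_metric \<kappa> \<tau> a (liftv \<kappa> \<tau> a) (radv a) = 0"
  using F by (simp_all add: bcv_metric_hor hor_frame bcv_eta_frame bcv_G_def field_simps
      power2_eq_square)

lemma normal_decomposition:
  assumes F: "bcv_F \<kappa> a \<noteq> 0" and r: "rad2 a \<noteq> 0" and z: "bcv_metric \<kappa> \<tau> a z (rotv a) = 0"
  shows "z = (hor z (radv a) / rad2 a) *\<^sub>R radv a + (z$3 / bcv_G \<tau> a) *\<^sub>R liftv \<kappa> \<tau> a"
proof -
  \<comment> \<open>The planar pairing of z with the rotation field. Orthogonality to
    \<open>rotv\<close> determines it from \<open>z$3\<close>, so only the radial part and
    \<open>z$3\<close> remain as coefficients.\<close>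
  define m where "m = a$1 * z$2 - a$2 * z$1"
  have "m = \<tau> * rad2 a * bcv_F \<kappa> a * bcv_eta \<kappa> \<tau> a z"
  proof -
    have "bcv_metric \<kappa> \<tau> a z (rotv a) = (m - \<tau> * rad2 a * bcv_F \<kappa> a * bcv_eta \<kappa> \<tau> a z) / (bcv_F \<kappa> a)^2"
      using F by (simp add: bcv_metric_hor bcv_eta_frame hor_def m_def field_simps power2_eq_square)
    then show ?thesis using z F by simp
  qed
  also have "bcv_eta \<kappa> \<tau> a z = z$3 - \<tau> * m / bcv_F \<kappa> a"
    by (simp add: bcv_eta_def m_def algebra_simps diff_divide_distrib)
  finally have "m = \<tau> * rad2 a * bcv_F \<kappa> a * z$3 - \<tau>^2 * rad2 a * m" using F
    by (simp add: algebra_simps power2_eq_square)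
  then have "m * bcv_G \<tau> a = \<tau> * rad2 a * bcv_F \<kappa> a * z$3" by (simp add: bcv_G_def algebra_simps)
  then have m: "m = \<tau> * rad2 a * bcv_F \<kappa> a * (z$3 / bcv_G \<tau> a)" using bcv_G_pos[of \<tau> a]
    by (simp add: field_simps)
  have "z$1 * rad2 a = a$1 * hor z (radv a) - a$2 * m" "z$2 * rad2 a = a$2 * hor z (radv a) + a$1 * m"
    by (simp_all add: rad2_def hor_def m_def algebra_simps power2_eq_square)
  then show ?thesis using r bcv_G_pos[of \<tau> a] unfolding m by (simp add: vec_eq_iff forall_3 field_simps)
qed

lemma frame_eq_0I:
  assumes F: "bcv_F \<kappa> a \<noteq> 0" and r: "rad2 a \<noteq> 0"
    and z: "bcv_metric \<kappa> \<tau> a z (rotv a) = 0" "bcv_metric \<kappa> \<tau> a z (radv a) = 0"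
        "bcv_metric \<kappa> \<tau> a z (liftv \<kappa> \<tau> a) = 0"
  shows "z = 0"
proof -
  obtain b c where d: "z = b *\<^sub>R radv a + c *\<^sub>R liftv \<kappa> \<tau> a"
    using normal_decomposition[OF F r z(1)] by blast
  have "b * (rad2 a / (bcv_F \<kappa> a)^2) = 0" "c * bcv_G \<tau> a = 0"
    using z(2,3) unfolding d bcv_metric_simps bcv_metric_frame[OF F] by simp_all
  then show ?thesis using F r bcv_G_pos[of \<tau> a] by (simp add: d)
qed

lemma vec3_expand: "v = (v$1) *\<^sub>R axis 1 1 + (v$2) *\<^sub>R axis 2 1 + (v$3) *\<^sub>R (axis 3 1 :: real^3)"
  by (simp add: vec_eq_iff forall_3)

text \<open>Product rule with a moving base point. Expanding the two vector arguments in the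
  constant basis reduces it to \<open>has_derivative_bcv_metric\<close>.\<close>

lemma has_derivative_bcv_metric_along:
  fixes X :: "'b::real_normed_vector \<Rightarrow> real^3"
  assumes F: "bcv_F \<kappa> (X u) \<noteq> 0" and X: "(X has_derivative X') (at u)"
    and Y: "(Y has_derivative Y') (at u)" and Z: "(Z has_derivative Z') (at u)"
  shows "((\<lambda>u. bcv_metric \<kappa> \<tau> (X u) (Y u) (Z u)) has_derivative
    (\<lambda>w. bcv_dmetric \<kappa> \<tau> (X u) (X' w) (Y u) (Z u) + bcv_metric \<kappa> \<tau> (X u) (Y' w) (Z u) + bcv_metric \<kappa> \<tau>
        (X u) (Y u) (Z' w))) (at u)"
proof -
  have m: "((\<lambda>u. bcv_metric \<kappa> \<tau> (X u) v w) has_derivative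
      (\<lambda>h. bcv_dmetric \<kappa> \<tau> (X u) (X' h) v w)) (at u)" for v w
    by (rule has_derivative_compose[OF X has_derivative_bcv_metric[OF F]])
  have y: "((\<lambda>u. bcv_metric \<kappa> \<tau> (X u) (Y u) w) has_derivative
     (\<lambda>h. bcv_dmetric \<kappa> \<tau> (X u) (X' h) (Y u) w + bcv_metric \<kappa> \<tau> (X u) (Y' h) w)) (at u)" for w
  proof -
    have e: "bcv_metric \<kappa> \<tau> a v w = v$1 * bcv_metric \<kappa> \<tau> a (axis 1 1) w
        + v$2 * bcv_metric \<kappa> \<tau> a (axis 2 1) w + v$3 * bcv_metric \<kappa> \<tau> a (axis 3 1) w" for a v
      by (subst vec3_expand[of v]) (simp only: bcv_metric_simps)
    have de: "bcv_dmetric \<kappa> \<tau> a h v w = v$1 * bcv_dmetric \<kappa> \<tau> a h (axis 1 1) w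
        + v$2 * bcv_dmetric \<kappa> \<tau> a h (axis 2 1) w + v$3 * bcv_dmetric \<kappa> \<tau> a h (axis 3 1) w" for a h v
      by (subst vec3_expand[of v]) (simp only: bcv_dmetric_simps)
    show ?thesis
      unfolding e[of _ "Y _"] e[of _ "Y' _"] de[of _ _ "Y _"]
      by (rule derivative_eq_intros m Y refl)+ (simp add: fun_eq_iff algebra_simps)
  qed
  have e: "bcv_metric \<kappa> \<tau> a v w = w$1 * bcv_metric \<kappa> \<tau> a v (axis 1 1)
      + w$2 * bcv_metric \<kappa> \<tau> a v (axis 2 1) + w$3 * bcv_metric \<kappa> \<tau> a v (axis 3 1)" for a v w
    by (subst vec3_expand[of w]) (simp only: bcv_metric_simps)
  have de: "bcv_dmetric \<kappa> \<tau> a h v w = w$1 * bcv_dmetric \<kappa> \<tau> a h v (axis 1 1)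
      + w$2 * bcv_dmetric \<kappa> \<tau> a h v (axis 2 1) + w$3 * bcv_dmetric \<kappa> \<tau> a h v (axis 3 1)" for a h v w
    by (subst vec3_expand[of w]) (simp only: bcv_dmetric_simps)
  show ?thesis
    unfolding e[of _ _ "Z _"] e[of _ _ "Z' _"] de[of _ _ _ "Z _"]
    by (rule derivative_eq_intros y Z refl)+ (simp add: fun_eq_iff algebra_simps)
qed

text \<open>The metric duals of \<open>radv\<close> and \<open>liftv\<close> are d\<rho> / (2 F^2)
  and dz. Hence a normal combined from them is a one-form in d\<rho> and dz, whose coefficients are
  easy to differentiate.\<close>

lemma bcv_metric_radv_liftv:
  assumes "bcv_F \<kappa> a \<noteq> 0"
  shows "bcv_metric \<kappa> \<tau> a (radv a) v = hor (radv a) v / (bcv_F \<kappa> a)^2"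
    "bcv_metric \<kappa> \<tau> a (liftv \<kappa> \<tau> a) v = v$3"
  using assms by (simp_all add: bcv_metric_hor bcv_eta_frame)
    (simp add: hor_def bcv_eta_def field_simps power2_eq_square)

text \<open>For \<open>n\<close> a field along \<open>X\<close>, \<open>v\<close> the velocity and \<open>z\<close> constant, the Koszul formula
  turns \<open>g(\<nabla>\<^sub>v n, z)\<close> into the derivative of \<open>g(n, z)\<close> along \<open>X\<close> plus this correction.\<close>

definition sff_correction :: "real \<Rightarrow> real \<Rightarrow> real^3 \<Rightarrow> real^3 \<Rightarrow> real^3 \<Rightarrow> real^3 \<Rightarrow> real" where
  "sff_correction \<kappa> \<tau> a n v z =
    (bcv_dmetric \<kappa> \<tau> a n v z - bcv_dmetric \<kappa> \<tau> a v n z - bcv_dmetric \<kappa> \<tau> a z v n) / 2"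

lemma sff_correction_simps:
  "sff_correction \<kappa> \<tau> a (n + n') v z = sff_correction \<kappa> \<tau> a n v z + sff_correction \<kappa> \<tau> a n' v z"
  "sff_correction \<kappa> \<tau> a (c *\<^sub>R n) v z = c * sff_correction \<kappa> \<tau> a n v z"
  "sff_correction \<kappa> \<tau> a n (v + v') z = sff_correction \<kappa> \<tau> a n v z + sff_correction \<kappa> \<tau> a n v' z"
  "sff_correction \<kappa> \<tau> a n (c *\<^sub>R v) z = c * sff_correction \<kappa> \<tau> a n v z"
  "sff_correction \<kappa> \<tau> a n v (z + z') = sff_correction \<kappa> \<tau> a n v z + sff_correction \<kappa> \<tau> a n v z'"
  "sff_correction \<kappa> \<tau> a n v (c *\<^sub>R z) = c * sff_correction \<kappa> \<tau> a n v z"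
  by (simp_all add: sff_correction_def bcv_dmetric_simps algebra_simps add_divide_distrib
      diff_divide_distrib)

text \<open>The tangent vector orthogonal to \<open>rotv\<close> of a surface with normal
  \<open>p *\<^sub>R radv a + q *\<^sub>R liftv \<kappa> \<tau> a\<close>, scaled to the length of \<open>rotv\<close>.\<close>

definition profv :: "real \<Rightarrow> real \<Rightarrow> real \<Rightarrow> real \<Rightarrow> real^3 \<Rightarrow> real^3" where
  "profv \<kappa> \<tau> p q a = (q * bcv_G \<tau> a) *\<^sub>R radv a + (- p * rad2 a / (bcv_F \<kappa> a)^2) *\<^sub>R liftv \<kappa> \<tau> a"

lemma sff_correction_frame:
  fixes \<kappa> \<tau> :: real and a :: "real^3"
  assumes F: "bcv_F \<kappa> a \<noteq> 0"
  defines "f \<equiv> bcv_F \<kappa> a" and "r \<equiv> rad2 a" and "c \<equiv> sff_correction \<kappa> \<tau> a"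
    and "P \<equiv> liftv \<kappa> \<tau> a" and "R \<equiv> radv a" and "V \<equiv> rotv a"
  shows "c R V V = r / f^2 * (2 * \<tau>^2 * r - \<kappa> * r * bcv_G \<tau> a / (2 * f))" "c P V V = 0"
    "c R V R = 0" "c R R V = 0" "c P V P = 0" "c P P V = 0"
    "c R V P = \<tau> * r / f^2 * (\<tau>^2 * r - 1 - \<kappa> * r / 2)"
        "c R P V = \<tau> * r / f^2 * (\<tau>^2 * r - 1 - \<kappa> * r / 2)"
    "c P V R = - \<tau> * (4 * \<tau>^2 - \<kappa>) * r^2 / (4 * f^2)" "c P R V = - \<tau> * (4 * \<tau>^2 - \<kappa>) * r^2 / (4 * f^2)"
    "c R R R = \<kappa> * r^2 / (2 * f^3)" "c R R P = 0" "c R P R = 0" "c R P P = - 2 * \<tau>^2 * r"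
    "c P R R = 0" "c P R P = \<tau>^2 * r" "c P P R = \<tau>^2 * r" "c P P P = 0"
proof -
  have f: "f = 1 + \<kappa> * r / 4" by (simp add: f_def r_def bcv_F_rad2)
  have f0: "f \<noteq> 0" using F by (simp add: f_def)
  note D = c_def P_def R_def V_def sff_correction_def bcv_dmetric_hor
    hor_frame bcv_dF_frame bcv_eta_frame[OF F] bcv_deta_frame[OF F]
  note fr = f_def[symmetric] r_def[symmetric]
  show "c R V V = r / f^2 * (2 * \<tau>^2 * r - \<kappa> * r * bcv_G \<tau> a / (2 * f))" "c P V V = 0"
    "c R V R = 0" "c R R V = 0" "c P V P = 0" "c P P V = 0"
    "c R R R = \<kappa> * r^2 / (2 * f^3)" "c R R P = 0" "c R P R = 0" "c R P P = - 2 * \<tau>^2 * r"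
    "c P R R = 0" "c P R P = \<tau>^2 * r" "c P P R = \<tau>^2 * r" "c P P P = 0"
    unfolding D bcv_G_def fr using f0 by (simp_all add: field_simps power2_eq_square power3_eq_cube)
  have 1: "bcv_dmetric \<kappa> \<tau> a R V P = - \<tau> * \<kappa> * r^2 / (2 * f^2)
      + \<tau> * r * (\<tau>^2 * r - 1) / f - \<tau> * \<tau>^2 * \<kappa> * r * r^2 / (2 * f^2)"
    unfolding D fr using f0 by (simp add: field_simps power2_eq_square power3_eq_cube)
  have 2: "bcv_dmetric \<kappa> \<tau> a V R P = \<tau> * r / f" "bcv_dmetric \<kappa> \<tau> a V P R = \<tau> * r / f"
      "bcv_dmetric \<kappa> \<tau> a P V R = - \<tau> * \<tau>^2 * r^2 / f" "bcv_dmetric \<kappa> \<tau> a P R V = - \<tau> * \<tau>^2 * r^2 / f"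
      "bcv_dmetric \<kappa> \<tau> a R P V = bcv_dmetric \<kappa> \<tau> a R V P"
    unfolding D fr using f0 by (simp_all add: field_simps power2_eq_square power3_eq_cube)
  have 3: "c R V P = (- \<tau> * \<kappa> * r^2 / 2 - 2 * \<tau> * r * f
      + 2 * \<tau> * \<tau>^2 * r^2 * f - \<tau> * \<tau>^2 * \<kappa> * r * r^2 / 2) / f^2 / 2"
    unfolding c_def sff_correction_def 1 2 using f0 by (simp add: field_simps power2_eq_square)
  have 4: "c P V R = (\<tau> * \<kappa> * r^2 / 2 - 2 * \<tau> * \<tau>^2 * r^2 * f + \<tau> * \<tau>^2 * \<kappa> * r * r^2 / 2) / f^2 / 2"
    unfolding c_def sff_correction_def 1 2 using f0 by (simp add: field_simps power2_eq_square)
  \<comment> \<open>With denominators cleared, inserting f = 1 + \<kappa> r / 4 cancels the terms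
    cubic in r; in 6 it leaves the factor 4 \<tau>^2 - \<kappa> that controls the mixed
    entries.\<close>
  have 5: "- \<tau> * \<kappa> * r^2 / 2 - 2 * \<tau> * r * f + 2 * \<tau> * \<tau>^2 * r^2 * f - \<tau> * \<tau>^2 * \<kappa> * r * r^2 / 2
      = 2 * \<tau> * r * (\<tau>^2 * r - 1 - \<kappa> * r / 2)"
    unfolding f by (simp add: field_simps power2_eq_square)
  have 6: "\<tau> * \<kappa> * r^2 / 2 - 2 * \<tau> * \<tau>^2 * r^2 * f + \<tau> * \<tau>^2 * \<kappa> * r * r^2 / 2
      = - \<tau> * (4 * \<tau>^2 - \<kappa>) * r^2 / 2"
    unfolding f by (simp add: field_simps power2_eq_square)
  show RVP: "c R V P = \<tau> * r / f^2 * (\<tau>^2 * r - 1 - \<kappa> * r / 2)" unfolding 3 5 by simp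
  show PVR: "c P V R = - \<tau> * (4 * \<tau>^2 - \<kappa>) * r^2 / (4 * f^2)" unfolding 4 6 by simp
  show "c R P V = \<tau> * r / f^2 * (\<tau>^2 * r - 1 - \<kappa> * r / 2)"
    using RVP by (simp add: c_def sff_correction_def 2)
  show "c P R V = - \<tau> * (4 * \<tau>^2 - \<kappa>) * r^2 / (4 * f^2)"
    using PVR by (simp add: c_def sff_correction_def 2)
qed

text \<open>Here h is g(\<nabla>_v n, z) with p and q frozen. Its first two terms differentiate the
  dual of p \<open>radv\<close>; the dual of \<open>liftv\<close> is dz and contributes nothing. The
  factor p^2 r / f^2 + q^2 G is the squared length of n.\<close>

lemma sff_frame:
  fixes \<kappa> \<tau> p q :: real and a n :: "real^3"
  assumes F: "bcv_F \<kappa> a \<noteq> 0" and n: "n = p *\<^sub>R radv a + q *\<^sub>R liftv \<kappa> \<tau> a"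
  defines "f \<equiv> bcv_F \<kappa> a" and "r \<equiv> rad2 a" and "G \<equiv> bcv_G \<tau> a" and "W \<equiv> profv \<kappa> \<tau> p q a"
    and "h \<equiv> \<lambda>v z. p * hor v z / (bcv_F \<kappa> a)^2 - 2 * p * hor (radv a) z * bcv_dF \<kappa> a v / (bcv_F \<kappa> a)^3
        + sff_correction \<kappa> \<tau> a n v z"
  shows "h (rotv a) (rotv a) = p * r / f^2 * (G + \<tau>^2 * r - \<kappa> * r * G / (2 * f))"
    "h (rotv a) W = - \<tau> * (4 * \<tau>^2 - \<kappa>) * r^2 / (4 * f^2) * (p^2 * r / f^2 + q^2 * G)"
    "h W (rotv a) = - \<tau> * (4 * \<tau>^2 - \<kappa>) * r^2 / (4 * f^2) * (p^2 * r / f^2 + q^2 * G)"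
    "h W W = r * G / f^2 * (p * q^2 * (G * (1 - \<kappa> * r / (2 * f)) - \<tau>^2 * r)
      - \<tau>^2 * r * p / G * (p^2 * r / f^2 + q^2 * G))"
proof -
  have f: "f = 1 + \<kappa> * r / 4" by (simp add: f_def r_def bcv_F_rad2)
  have f0: "f \<noteq> 0" using F by (simp add: f_def)
  have G: "G = 1 + \<tau>^2 * r" by (simp add: G_def bcv_G_def r_def)
  have G0: "G \<noteq> 0" using bcv_G_pos[of \<tau> a] by (simp add: G_def)
  note S = n W_def profv_def
  note T = hor_linear bcv_dF_linear sff_correction_simps
  note U = hor_frame bcv_dF_frame sff_correction_frame[OF F]
  note fr = f_def[symmetric] r_def[symmetric] G_def[symmetric]
  show "h (rotv a) (rotv a) = p * r / f^2 * (G + \<tau>^2 * r - \<kappa> * r * G / (2 * f))"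
    unfolding h_def S unfolding T unfolding U unfolding fr
    using f0 by (simp add: field_simps power2_eq_square) (simp add: G algebra_simps power2_eq_square)
  have e: "\<tau>^2 * r - 1 - \<kappa> * r / 2 + f = \<tau>^2 * r - \<kappa> * r / 4" unfolding f by simp
  have "h (rotv a) W = - (p^2 * r / f^2) * (\<tau> * r / f^2 * (\<tau>^2 * r - 1 - \<kappa> * r / 2
      + f)) - \<tau> * (4 * \<tau>^2 - \<kappa>) * r^2 / (4 * f^2) * (q^2 * G)"
    unfolding h_def S unfolding T unfolding U unfolding fr
    using f0 by (simp add: field_simps power2_eq_square power3_eq_cube)
  also have "\<dots> = - \<tau> * (4 * \<tau>^2 - \<kappa>) * r^2 / (4 * f^2) * (p^2 * r / f^2 + q^2 * G)"
    unfolding e using f0 by (simp add: field_simps power2_eq_square)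
  finally show *: "h (rotv a) W = - \<tau> * (4 * \<tau>^2 - \<kappa>) * r^2 / (4 * f^2) * (p^2 * r / f^2 + q^2 * G)" .
  have "h W (rotv a) = h (rotv a) W"
    unfolding h_def S unfolding T unfolding U unfolding fr by simp
  then show "h W (rotv a) = - \<tau> * (4 * \<tau>^2 - \<kappa>) * r^2 / (4 * f^2) * (p^2 * r / f^2 + q^2 * G)"
    using * by simp
  have "h W W = p * (q * G)^2 * (r / f^2 - \<kappa> * r^2 / (2 * f^3)) - p^3 * \<tau>^2 * r^3 / f^4
      - 2 * p * q^2 * G * \<tau>^2 * r^2 / f^2"
    unfolding h_def S unfolding T unfolding U unfolding fr
    using f0 by (simp add: divide_simps) (simp add: algebra_simps eval_nat_numeral)
  also have "\<dots> = r * G / f^2 * (p * q^2 * (G * (1 - \<kappa> * r / (2 * f)) - \<tau>^2 * r)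
      - \<tau>^2 * r * p / G * (p^2 * r / f^2 + q^2 * G))"
    using f0 G0 by (simp add: divide_simps) (simp add: algebra_simps eval_nat_numeral)
  finally show "h W W = r * G / f^2 * (p * q^2 * (G * (1 - \<kappa> * r / (2 * f)) - \<tau>^2 * r)
      - \<tau>^2 * r * p / G * (p^2 * r / f^2 + q^2 * G))" .
qed

lemma has_derivative_constant_onD:
  assumes f: "(f has_derivative f') (at u)" and V: "open V" "u \<in> V" and c: "\<And>x. x \<in> V \<Longrightarrow> f x = c"
  shows "f' w = 0"
proof -
  have "(f has_derivative (\<lambda>w. 0)) (at u)"
    by (rule has_derivative_transform_within_open[OF has_derivative_const[of c] V]) (simp add: c)
  then show ?thesis using has_derivative_unique[OF f] by simp
qed

section \<open>Patches tangent to the rotation field\<close>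

text \<open>Rotational invariance enters infinitesimally, as tangency of the rotation field in
  \<open>n_rot\<close>, and \<open>rad2_pos\<close> keeps the patch off the axis. Both are derived
  for local parametrizations in \<open>revolution_patchI\<close>.\<close>

locale revolution_patch =
  fixes \<kappa> \<tau> :: real and V :: "(real^2) set" and X n :: "real^2 \<Rightarrow> real^3"
  assumes open_V: "open V" and X_smooth: "smooth_on V X" and n_smooth: "smooth_on V n"
    and X_inj: "u \<in> V \<Longrightarrow> inj (dmap X u)"
    and F_pos: "u \<in> V \<Longrightarrow> bcv_F \<kappa> (X u) > 0"
    and rad2_pos: "u \<in> V \<Longrightarrow> rad2 (X u) > 0"
    and n_unit: "u \<in> V \<Longrightarrow> bcv_metric \<kappa> \<tau> (X u) (n u) (n u) = 1"
    and n_normal: "u \<in> V \<Longrightarrow> bcv_metric \<kappa> \<tau> (X u) (n u) (dmap X u w) = 0"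
    and n_rot: "u \<in> V \<Longrightarrow> bcv_metric \<kappa> \<tau> (X u) (n u) (rotv (X u)) = 0"
begin

abbreviation "met u \<equiv> bcv_metric \<kappa> \<tau> (X u)"

definition "rho u = rad2 (X u)"
definition "F u = bcv_F \<kappa> (X u)"
definition "G u = bcv_G \<tau> (X u)"
definition "z u = X u $ 3"
text \<open>The coefficients provided by \<open>normal_decomposition\<close>; q is \<eta>(n), the
  cosine of the angle function.\<close>

definition "p u = hor (n u) (radv (X u)) / rho u"
definition "q u = n u $ 3 / G u"
text \<open>The squared length of the rotation field, and also of the profile field
  \<open>prof\<close>.\<close>

definition "J u = rho u * G u / (F u)^2"

lemma pos: "u \<in> V \<Longrightarrow> rho u > 0" "u \<in> V \<Longrightarrow> F u > 0" "G u > 0" "u \<in> V \<Longrightarrow> J u > 0"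
  using rad2_pos F_pos bcv_G_pos
  by (auto simp: rho_def F_def G_def J_def intro!: divide_pos_pos mult_pos_pos zero_less_power)

lemma F_nz: "u \<in> V \<Longrightarrow> bcv_F \<kappa> (X u) \<noteq> 0"
  using F_pos by force

lemma F_rho: "F u = 1 + \<kappa> / 4 * rho u" and G_rho: "G u = 1 + \<tau>^2 * rho u"
  by (simp_all add: F_def rho_def G_def bcv_F_rad2 bcv_G_def)

lemma n_eq: "u \<in> V \<Longrightarrow> n u = p u *\<^sub>R radv (X u) + q u *\<^sub>R liftv \<kappa> \<tau> (X u)"
  using normal_decomposition[OF F_nz _ n_rot] pos(1)[of u] by (simp add: p_def q_def rho_def G_def)

lemma norm_eq:
  assumes u: "u \<in> V"
  shows "(p u)^2 * rho u / (F u)^2 + (q u)^2 * G u = 1"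
proof -
  have "1 = met u (p u *\<^sub>R radv (X u) + q u *\<^sub>R liftv \<kappa> \<tau> (X u)) (p u *\<^sub>R radv (X u)
      + q u *\<^sub>R liftv \<kappa> \<tau> (X u))"
    using n_unit[OF u] n_eq[OF u] by simp
  also have "\<dots> = (p u)^2 * rho u / (F u)^2 + (q u)^2 * G u"
    unfolding bcv_metric_simps bcv_metric_frame[OF F_nz[OF u]]
    by (simp add: rho_def F_def G_def power2_eq_square algebra_simps)
  finally show ?thesis by simp
qed

lemma met_n: "u \<in> V \<Longrightarrow> met u (n u) v = p u * hor (radv (X u)) v / (F u)^2 + q u * v$3"
  by (simp add: n_eq bcv_metric_simps bcv_metric_radv_liftv[OF F_nz] F_def)

lemma Ck_X: "Ck_on k V X" and Ck_n: "Ck_on k V n"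
  using X_smooth n_smooth by (auto simp: smooth_on_def)

lemma X_deriv: "u \<in> V \<Longrightarrow> (X has_derivative dmap X u) (at u)"
  and n_deriv: "u \<in> V \<Longrightarrow> (n has_derivative dmap n u) (at u)"
  using Ck_X[of 1] Ck_n[of 1] by (auto intro!: dmap_works simp: Ck_on_Suc_dmap)

lemma X_linear: "u \<in> V \<Longrightarrow> linear (dmap X u)"
  using X_deriv has_derivative_linear by blast

lemma Ck_rho: "Ck_on k V rho"
proof -
  have "rho = (\<lambda>u. X u $ 1 * X u $ 1 + X u $ 2 * X u $ 2)"
    by (simp add: fun_eq_iff rho_def rad2_def power2_eq_square)
  then show ?thesis
    by (simp only:) (intro Ck_on_add Ck_on_mult Ck_on_nth open_V Ck_X)
qed

lemma Ck_z: "Ck_on k V z"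
  unfolding z_def[abs_def] by (intro Ck_on_nth open_V Ck_X)

lemma Ck_p: "Ck_on k V p"
proof -
  have "p = (\<lambda>u. (n u $ 1 * X u $ 1 + n u $ 2 * X u $ 2) * inverse (rho u))"
    by (simp add: fun_eq_iff p_def hor_def divide_inverse)
  then show ?thesis using pos(1)
    by (simp only:) (intro Ck_on_add Ck_on_mult Ck_on_inverse Ck_on_nth open_V Ck_X Ck_n Ck_rho, force)
qed

lemma Ck_q: "Ck_on k V q"
proof -
  have "q = (\<lambda>u. n u $ 3 * inverse (1 + \<tau>^2 * rho u))"
    by (simp add: fun_eq_iff q_def G_rho divide_inverse)
  moreover have "1 + \<tau>^2 * rho u \<noteq> 0" for u using pos(3)[of u] by (simp add: G_rho)
  ultimately show ?thesis
    by (simp only:) (intro Ck_on_add Ck_on_mult Ck_on_inverse Ck_on_nth Ck_on_const open_V Ck_n Ck_rho)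
qed

lemma Ck_deriv:
  assumes "\<And>k. Ck_on k V (f::real^2\<Rightarrow>real)" "u \<in> V"
  shows "(f has_derivative dmap f u) (at u)" "((\<lambda>x. dmap f x w) has_derivative dmap
      (\<lambda>x. dmap f x w) u) (at u)"
  using assms(1)[of 2] assms(2) by (auto simp: numeral_2_eq_2 Ck_on_Suc_dmap intro!: dmap_works)

lemmas scalar_deriv = Ck_deriv(1)[OF Ck_rho] Ck_deriv(1)[OF Ck_z] Ck_deriv(1)[OF Ck_p] Ck_deriv(1)[OF
    Ck_q]

lemma dmap_rho: "u \<in> V \<Longrightarrow> dmap rho u w = 2 * hor (radv (X u)) (dmap X u w)"
proof -
  assume u: "u \<in> V"
  have "(rho has_derivative (\<lambda>w. 2 * hor (radv (X u)) (dmap X u w))) (at u)"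
    unfolding rho_def[abs_def] rad2_def
    by (rule derivative_eq_intros X_deriv[OF u] refl)+ (simp add: fun_eq_iff hor_def)
  then show ?thesis by (simp add: dmap_eqI)
qed

lemma dmap_z: "u \<in> V \<Longrightarrow> dmap z u w = dmap X u w $ 3"
  using dmap_eqI[OF has_derivative_nth[OF X_deriv], of u 3] by (simp add: z_def[abs_def])

text \<open>As a one-form, the unit normal is \<open>p d\<rho> / (2 F\<^sup>2) + q dz\<close>.\<close>

lemma constraint: "u \<in> V \<Longrightarrow> p u * dmap rho u w / (2 * (F u)^2) + q u * dmap z u w = 0"
  using n_normal[of u w] by (simp add: met_n dmap_rho dmap_z)

abbreviation "prof u \<equiv> profv \<kappa> \<tau> (p u) (q u) (X u)"
abbreviation "rot u \<equiv> rotv (X u)"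

lemma met_frame:
  assumes "u \<in> V"
  shows "met u (rot u) (rot u) = J u" "met u (prof u) (prof u) = J u"
    "met u (rot u) (prof u) = 0" "met u (prof u) (rot u) = 0" "met u (n u) (prof u) = 0"
        "met u (prof u) (n u) = 0"
proof -
  note S = bcv_metric_simps bcv_metric_frame[OF F_nz[OF assms]]
  have F: "F u \<noteq> 0" using pos(2)[OF assms] by simp
  show "met u (rot u) (rot u) = J u"
    unfolding S by (simp add: J_def rho_def F_def G_def)
  show "met u (rot u) (prof u) = 0" "met u (prof u) (rot u) = 0"
    unfolding profv_def S by simp_all
  show "met u (n u) (prof u) = 0"
    unfolding n_eq[OF assms] profv_def S using F
    by (simp add: field_simps)
  then show "met u (prof u) (n u) = 0" by (simp add: bcv_metric_commute)
  have "met u (prof u) (prof u) = J u * ((p u)^2 * rho u / (F u)^2 + (q u)^2 * G u)"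
    unfolding profv_def S J_def rho_def[symmetric] G_def[symmetric] F_def[symmetric] using F
    by (simp add: field_simps power2_eq_square)
  then show "met u (prof u) (prof u) = J u" by (simp add: norm_eq[OF assms])
qed

lemma tangent_decomposition:
  assumes u: "u \<in> V" and v: "met u v (n u) = 0"
  shows "v = (met u v (rot u) / J u) *\<^sub>R rot u + (met u v (prof u) / J u) *\<^sub>R prof u" (is "v = ?w")
proof -
  have J: "J u \<noteq> 0" using pos(4)[OF u] by simp
  define y where "y = v - ?w"
  have a: "met u y (rot u) = 0" "met u y (prof u) = 0" "met u y (n u) = 0"
    using v J n_rot[OF u] unfolding y_def bcv_metric_simps met_frame[OF u]
    by (simp_all add: bcv_metric_commute[of _ _ _ "rot u" "n u"])
  define b where "b = met u y (radv (X u))"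
  define c where "c = met u y (liftv \<kappa> \<tau> (X u))"
  have 1: "p u * b + q u * c = 0"
    using a(3) unfolding n_eq[OF u] bcv_metric_simps b_def c_def by simp
  have 2: "q u * G u * b = p u * rho u / (F u)^2 * c"
    using a(2) unfolding profv_def bcv_metric_simps b_def c_def by (simp add: rho_def F_def G_def)
  have "b = b * ((p u)^2 * rho u / (F u)^2 + (q u)^2 * G u)" by (simp add: norm_eq[OF u])
  also have "\<dots> = p u * rho u / (F u)^2 * (p u * b) + q u * (q u * G u * b)"
    by (simp add: power2_eq_square algebra_simps)
  also have "\<dots> = p u * rho u / (F u)^2 * (p u * b + q u * c)"
    unfolding 2 by (simp add: algebra_simps add_divide_distrib)
  finally have b: "b = 0" by (simp add: 1)
  have "c = c * ((p u)^2 * rho u / (F u)^2 + (q u)^2 * G u)" by (simp add: norm_eq[OF u])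
  also have "\<dots> = p u * (p u * rho u / (F u)^2 * c) + q u * G u * (q u * c)"
    by (simp add: power2_eq_square algebra_simps)
  also have "\<dots> = q u * G u * (p u * b + q u * c)"
    unfolding 2[symmetric] by (simp add: algebra_simps)
  finally have c: "c = 0" by (simp add: 1)
  have "y = 0"
    by (rule frame_eq_0I[OF F_nz[OF u] _ a(1)]) (use b c rad2_pos[OF u] in \<open>auto simp: b_def c_def\<close>)
  then show ?thesis by (simp add: y_def)
qed

text \<open>In the frame \<open>rot\<close>, \<open>prof\<close> the differential becomes the
  injective linear map L of the plane into itself, so it reaches every vector orthogonal to the
  normal.\<close>

lemma range_dmap:
  assumes u: "u \<in> V"
  shows "range (dmap X u) = {v. met u v (n u) = 0}"
proof -
  have n: "met u (dmap X u w) (n u) = 0" for w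
    using n_normal[OF u] by (simp add: bcv_metric_commute)
  define L where "L w = (vector [met u (dmap X u w) (rot u) / J u, met u (dmap X u w) (prof u)
      / J u] :: real^2)" for w
  have dL: "dmap X u w = (L w $ 1) *\<^sub>R rot u + (L w $ 2) *\<^sub>R prof u" for w
    using tangent_decomposition[OF u n[of w]] by (simp add: L_def)
  have lin: "linear L"
    by (rule linearI) (simp_all add: L_def vec_eq_iff forall_2 linear_add[OF X_linear[OF u]]
      linear_scale[OF X_linear[OF u]] bcv_metric_simps add_divide_distrib)
  have "inj L"
  proof (rule injI)
    fix w w' assume "L w = L w'"
    then have "dmap X u w = dmap X u w'" by (simp only: dL)
    then show "w = w'" using X_inj[OF u] by (simp add: inj_eq)
  qed
  then have "surj L" using lin linear_injective_imp_surjective by blast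
  have "v \<in> range (dmap X u)" if v: "met u v (n u) = 0" for v
  proof -
    obtain w where "L w = vector [met u v (rot u) / J u, met u v (prof u) / J u]"
      using \<open>surj L\<close> by (metis surjD)
    then have "dmap X u w = v" using tangent_decomposition[OF u v] by (simp add: dL)
    then show ?thesis by blast
  qed
  then show ?thesis using n by auto
qed

definition "wrot u = inv (dmap X u) (rot u)"
definition "wprof u = inv (dmap X u) (prof u)"

lemma dmap_wrot: "u \<in> V \<Longrightarrow> dmap X u (wrot u) = rot u"
  and dmap_wprof: "u \<in> V \<Longrightarrow> dmap X u (wprof u) = prof u"
  unfolding wrot_def wprof_def
  using n_rot[of u] met_frame[of u]
  by (auto intro!: f_inv_into_f simp: range_dmap bcv_metric_commute[of _ _ _ "rot u" "n u"])

text \<open>The profile derivative of \<rho> vanishes exactly where q does. This is the link between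
  q = 0 and constant radius, used in both directions of the theorem.\<close>

lemma dmap_rho_frame:
  assumes "u \<in> V"
  shows "dmap rho u (wrot u) = 0" "dmap rho u (wprof u) = 2 * q u * G u * rho u"
    "dmap z u (wrot u) = 0" "dmap z u (wprof u) = - p u * rho u * G u / (F u)^2"
  unfolding dmap_rho[OF assms] dmap_z[OF assms] dmap_wrot[OF assms] dmap_wprof[OF assms] profv_def
      hor_linear hor_frame
  by (simp_all add: rho_def F_def G_def)

lemma F_G_deriv:
  assumes "u \<in> V"
  shows "(F has_derivative (\<lambda>w. \<kappa> / 4 * dmap rho u w)) (at u)"
      "(G has_derivative (\<lambda>w. \<tau>^2 * dmap rho u w)) (at u)"
  unfolding F_rho[abs_def] G_rho[abs_def] by (auto intro!: derivative_eq_intros scalar_deriv[OF assms])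

lemma dmap_norm_eq:
  assumes u: "u \<in> V"
  shows "2 * p u * dmap p u w * rho u / (F u)^2 + (p u)^2 * dmap rho u w / (F u)^2 * (1
      - \<kappa> * rho u / (2 * F u))
    + 2 * q u * dmap q u w * G u + (q u)^2 * \<tau>^2 * dmap rho u w = 0"
proof -
  have F: "F u \<noteq> 0" using pos(2)[OF u] by simp
  \<comment> \<open>The unit length condition is cleared of denominators before differentiation, so
    that only a polynomial in p, q, \<rho>, F and G is differentiated.\<close>
  have e: "(p x)^2 * rho x + (q x)^2 * G x * (F x)^2 - (F x)^2 = 0" if "x \<in> V" for x
    using norm_eq[OF that] pos(2)[OF that] by (simp add: field_simps)
  let ?D = "2 * p u * dmap p u w * rho u + (p u)^2 * dmap rho u w + (2 * q u * dmap q u w * G u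
      + (q u)^2 * \<tau>^2 * dmap rho u w) * (F u)^2
     - (\<kappa> / 2 * dmap rho u w * F u) * (1 - (q u)^2 * G u)"
  have "((\<lambda>u. (p u)^2 * rho u + (q u)^2 * G u * (F u)^2 - (F u)^2) has_derivative
     (\<lambda>w. 2 * p u * dmap p u w * rho u + (p u)^2 * dmap rho u w + (2 * q u * dmap q u w * G u +
         (q u)^2 * \<tau>^2 * dmap rho u w) * (F u)^2
     - (\<kappa> / 2 * dmap rho u w * F u) * (1 - (q u)^2 * G u))) (at u)"
    by (rule scalar_deriv[OF u] F_G_deriv[OF u] derivative_eq_intros refl)+
      (simp add: fun_eq_iff field_simps)
  from has_derivative_constant_onD[OF this open_V u e, of w] have "?D = 0" .
  moreover have "1 - (q u)^2 * G u = (p u)^2 * rho u / (F u)^2" using norm_eq[OF u] by simp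
  ultimately have D: "2 * p u * dmap p u w * rho u + (p u)^2 * dmap rho u w
      + (2 * q u * dmap q u w * G u + (q u)^2 * \<tau>^2 * dmap rho u w) * (F u)^2
     - (\<kappa> / 2 * dmap rho u w * F u) * ((p u)^2 * rho u / (F u)^2) = 0" (is "?E = 0") by simp
  have "2 * p u * dmap p u w * rho u / (F u)^2 + (p u)^2 * dmap rho u w / (F u)^2 * (1
      - \<kappa> * rho u / (2 * F u))
    + 2 * q u * dmap q u w * G u + (q u)^2 * \<tau>^2 * dmap rho u w = ?E / (F u)^2"
    using F by (simp add: field_simps eval_nat_numeral)
  then show ?thesis unfolding D by simp
qed

text \<open>The one-form p d\<rho> + 2 F^2 q dz vanishes on the patch, and so does its exterior
  derivative. Together with the differentiated unit length condition this gives two linear equations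
  for the rotational derivatives of p and q.\<close>

lemma dmap_pq_wrot:
  assumes u: "u \<in> V"
  shows "dmap p u (wrot u) = 0" "dmap q u (wrot u) = 0"
proof -
  have F: "F u \<noteq> 0" using pos(2)[OF u] by simp
  have e: "p x * dmap rho x w + 2 * (F x)^2 * q x * dmap z x w = 0" if "x \<in> V" for x w
    using constraint[OF that, of w] pos(2)[OF that] by (simp add: field_simps)
  have d: "dmap p u w' * dmap rho u w + p u * dmap (\<lambda>x. dmap rho x w) u w'
      + (\<kappa> * F u * dmap rho u w' * q u + 2 * (F u)^2 * dmap q u w') * dmap z u w + 2 *
          (F u)^2 * q u * dmap (\<lambda>x. dmap z x w) u w' = 0" for w w'
  proof -
    have "((\<lambda>u. p u * dmap rho u w + 2 * (F u)^2 * q u * dmap z u w) has_derivative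
      (\<lambda>w'. dmap p u w' * dmap rho u w + p u * dmap (\<lambda>x. dmap rho x w) u w'
      + (\<kappa> * F u * dmap rho u w' * q u + 2 * (F u)^2 * dmap q u w') * dmap z u w + 2 *
          (F u)^2 * q u * dmap (\<lambda>x. dmap z x w) u w')) (at u)"
      by (rule scalar_deriv[OF u] F_G_deriv[OF u] Ck_deriv(2)[OF Ck_rho u] Ck_deriv(2)[OF Ck_z u]
          derivative_eq_intros refl)+
        (simp add: fun_eq_iff field_simps)
    from has_derivative_constant_onD[OF this open_V u e, of w'] show ?thesis .
  qed
  \<comment> \<open>The difference of the two instances of \<open>d\<close>: symmetry removes the
    second derivatives, and \<rho>, z have no derivative along \<open>wrot\<close>.\<close>
  have "dmap p u (wrot u) * dmap rho u (wprof u) + 2 * (F u)^2 * dmap q u (wrot u) * dmap z u (wprof u)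
      = 0"
    using d[of "wrot u" "wprof u"] d[of "wprof u" "wrot u"]
      dmap_dmap_commute[OF open_V u Ck_rho, of "wrot u"
          "wprof u"] dmap_dmap_commute[OF open_V u Ck_z, of "wrot u" "wprof u"]
    unfolding dmap_rho_frame[OF u] by simp
  then have "2 * rho u * G u * (q u * dmap p u (wrot u) - p u * dmap q u (wrot u)) = 0"
    unfolding dmap_rho_frame[OF u] using F by (simp add: field_simps)
  then have 1: "q u * dmap p u (wrot u) = p u * dmap q u (wrot u)" using pos(1,2)[OF u] pos(3)[of u]
    by auto
  have 2: "p u * dmap p u (wrot u) * rho u / (F u)^2 + q u * dmap q u (wrot u) * G u = 0"
    using dmap_norm_eq[OF u, of "wrot u"] by (simp add: dmap_rho_frame[OF u])
  \<comment> \<open>The system has determinant given by \<open>norm_eq\<close>, hence only the zero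
    solution.\<close>
  define dp dq where "dp = dmap p u (wrot u)" and "dq = dmap q u (wrot u)"
  note D = 1[folded dp_def dq_def] 2[folded dp_def dq_def]
  have "dp = dp * ((p u)^2 * rho u / (F u)^2 + (q u)^2 * G u)" by (simp add: norm_eq[OF u])
  also have "\<dots> = p u * (p u * dp * rho u / (F u)^2) + q u * G u * (q u * dp)"
    by (simp add: power2_eq_square algebra_simps)
  also have "\<dots> = p u * (p u * dp * rho u / (F u)^2 + q u * dq * G u)" unfolding D(1)
    by (simp add: algebra_simps)
  finally have "dp = 0" unfolding D(2) by simp
  then show "dmap p u (wrot u) = 0" by (simp add: dp_def)
  have "dq = dq * ((p u)^2 * rho u / (F u)^2 + (q u)^2 * G u)" by (simp add: norm_eq[OF u])
  also have "\<dots> = p u * rho u / (F u)^2 * (p u * dq) + q u * (q u * dq * G u)"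
    by (simp add: power2_eq_square algebra_simps)
  also have "\<dots> = q u * (p u * dp * rho u / (F u)^2 + q u * dq * G u)" unfolding D(1)[symmetric]
    by (simp add: algebra_simps)
  finally have "dq = 0" unfolding D(2) by simp
  then show "dmap q u (wrot u) = 0" by (simp add: dq_def)
qed

end

section \<open>Shape operator and mean curvature\<close>

lemma bcv_gamma_add_left: "bcv_gamma \<kappa> \<tau> a (v + v') w = bcv_gamma \<kappa> \<tau> a v w + bcv_gamma \<kappa> \<tau> a v' w"
  and bcv_gamma_scale_left: "bcv_gamma \<kappa> \<tau> a (c *\<^sub>R v) w = c *\<^sub>R bcv_gamma \<kappa> \<tau> a v w"
  by (simp_all add: vec_eq_iff forall_3 bcv_gamma_nth bcv_eta_simps algebra_simps)

text \<open>The reason is det(La, b) + det(a, Lb) = (tr L) det(a, b), evaluated once with matrix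
  entries and once with the given expansions.\<close>

lemma trace_matrix_2_basis:
  fixes L :: "real^2 \<Rightarrow> real^2"
  assumes L: "linear L" and a: "L a = \<alpha> *\<^sub>R a + \<beta> *\<^sub>R b" and b: "L b = \<gamma> *\<^sub>R a + \<delta> *\<^sub>R b"
    and d: "a$1 * b$2 - a$2 * b$1 \<noteq> 0"
  shows "trace (matrix L) = \<alpha> + \<delta>"
proof -
  define m where "m i j = L (axis j 1) $ i" for i j
  have e: "w = (w$1) *\<^sub>R axis 1 1 + (w$2) *\<^sub>R (axis 2 1 :: real^2)" for w
    by (simp add: vec_eq_iff forall_2 axis_def)
  have L': "L w $ i = w$1 * m i 1 + w$2 * m i 2" for w i
    by (subst e[of w]) (simp only: linear_add[OF L] linear_scale[OF L] m_def vector_add_component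
        vector_scaleR_component real_scaleR_def)
  have "m 1 1 * a$1 + m 1 2 * a$2 = \<alpha> * a$1 + \<beta> * b$1" "m 2 1 * a$1 + m 2 2 * a$2 = \<alpha> * a$2 + \<beta> * b$2"
    "m 1 1 * b$1 + m 1 2 * b$2 = \<gamma> * a$1 + \<delta> * b$1" "m 2 1 * b$1 + m 2 2 * b$2 = \<gamma> * a$2 + \<delta> * b$2"
    using L'[of a 1] L'[of a 2] L'[of b 1] L'[of b 2] unfolding a b by (simp_all add: mult.commute)
  then have "b$2 * (m 1 1 * a$1 + m 1 2 * a$2) - a$2 * (m 1 1 * b$1 + m 1 2 * b$2)
      + a$1 * (m 2 1 * b$1 + m 2 2 * b$2) - b$1 * (m 2 1 * a$1 + m 2 2 * a$2) = (\<alpha> + \<delta>) *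
          (a$1 * b$2 - a$2 * b$1)"
    by (simp add: algebra_simps)
  then have "(m 1 1 + m 2 2) * (a$1 * b$2 - a$2 * b$1) = (\<alpha> + \<delta>) * (a$1 * b$2 - a$2 * b$1)"
    by (simp add: algebra_simps)
  then have "m 1 1 + m 2 2 = \<alpha> + \<delta>" using d by simp
  then show ?thesis by (simp add: trace_def matrix_def sum_2 m_def)
qed

context revolution_patch
begin

abbreviation "cov u w \<equiv> cov_along (bcv_metric \<kappa> \<tau>) X n u w"

lemma cov_eq: "u \<in> V \<Longrightarrow> cov u w = dmap n u w + bcv_gamma \<kappa> \<tau> (X u) (dmap X u w) (n u)"
  by (simp add: cov_along_def dmap_def christoffel_bcv[OF F_nz])

text \<open>The derivative of g(n, v) is computed once by the product rule and once from
  \<open>met_n\<close>. Comparing the two eliminates the derivative of n in favour of those of p and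
  q.\<close>

lemma met_cov:
  assumes u: "u \<in> V"
  shows "met u (cov u w) v = dmap p u w * hor (radv (X u)) v / (F u)^2 + dmap q u w * v$3
     + (p u * hor (dmap X u w) v / (bcv_F \<kappa> (X u))^2 - 2 * p u * hor (radv (X u)) v * bcv_dF \<kappa> (X u)
         (dmap X u w) / (bcv_F \<kappa> (X u))^3
       + sff_correction \<kappa> \<tau> (X u) (n u) (dmap X u w) v)"
proof -
  have F: "F u \<noteq> 0" using pos(2)[OF u] by simp
  have 1: "((\<lambda>u. met u (n u) v) has_derivative
      (\<lambda>w. bcv_dmetric \<kappa> \<tau> (X u) (dmap X u w) (n u) v + met u (dmap n u w) v)) (at u)"
    using has_derivative_bcv_metric_along[OF F_nz[OF u] X_deriv[OF u] n_deriv[OF u]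
        has_derivative_const] by simp
  have hX: "((\<lambda>u. hor (radv (X u)) v) has_derivative (\<lambda>w. hor (dmap X u w) v)) (at u)"
    unfolding hor_def frame_nth by (rule derivative_eq_intros X_deriv[OF u] refl)+ simp
  have dF: "\<kappa> * dmap rho u w = 4 * bcv_dF \<kappa> (X u) (dmap X u w)" for w
    by (simp add: dmap_rho[OF u] hor_def bcv_dF_def)
  have "((\<lambda>u. p u * hor (radv (X u)) v / (F u)^2 + q u * v$3) has_derivative
      (\<lambda>w. dmap p u w * hor (radv (X u)) v / (F u)^2 + dmap q u w * v$3
     + p u * hor (dmap X u w) v / (F u)^2 - 2 * p u * hor (radv (X u)) v * bcv_dF \<kappa> (X u)
         (dmap X u w) / (F u)^3)) (at u)"
    by (rule scalar_deriv[OF u] F_G_deriv[OF u] hX derivative_eq_intros refl | (simp add: F; fail))+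
      (use F in \<open>simp add: fun_eq_iff dF divide_simps\<close>, simp add: algebra_simps eval_nat_numeral)
  then have 2: "((\<lambda>u. met u (n u) v) has_derivative
      (\<lambda>w. dmap p u w * hor (radv (X u)) v / (F u)^2 + dmap q u w * v$3
     + p u * hor (dmap X u w) v / (F u)^2 - 2 * p u * hor (radv (X u)) v * bcv_dF \<kappa> (X u)
         (dmap X u w) / (F u)^3)) (at u)"
    by (rule has_derivative_transform_within_open[OF _ open_V u]) (simp add: met_n)
  have "bcv_dmetric \<kappa> \<tau> (X u) (dmap X u w) (n u) v + met u (dmap n u w) v
    = dmap p u w * hor (radv (X u)) v / (F u)^2 + dmap q u w * v$3
     + p u * hor (dmap X u w) v / (F u)^2 - 2 * p u * hor (radv (X u)) v * bcv_dF \<kappa> (X u)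
         (dmap X u w) / (F u)^3"
    using fun_cong[OF has_derivative_unique[OF 1 2], of w] .
  moreover have "2 * met u (bcv_gamma \<kappa> \<tau> (X u) (dmap X u w) (n u)) v
      = bcv_dmetric \<kappa> \<tau> (X u) (dmap X u w) (n u) v
     + bcv_dmetric \<kappa> \<tau> (X u) (n u) (dmap X u w) v - bcv_dmetric \<kappa> \<tau> (X u) v (dmap X u w) (n u)"
    by (rule bcv_gamma_koszul[OF F_nz[OF u]])
  ultimately show ?thesis
    unfolding cov_eq[OF u] bcv_metric_simps sff_correction_def F_def[symmetric]
      by (simp add: field_simps)
qed

lemma met_cov_n:
  assumes u: "u \<in> V"
  shows "met u (cov u w) (n u) = 0"
proof -
  have "bcv_dmetric \<kappa> \<tau> (X u) (dmap X u w) (n u) (n u) + met u (dmap n u w) (n u)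
      + met u (n u) (dmap n u w) = 0"
    using has_derivative_constant_onD[OF has_derivative_bcv_metric_along[OF F_nz[OF u] X_deriv[OF u]
        n_deriv[OF u] n_deriv[OF u]] open_V u n_unit] .
  moreover have "2 * met u (bcv_gamma \<kappa> \<tau> (X u) (dmap X u w) (n u)) (n u)
      = bcv_dmetric \<kappa> \<tau> (X u) (dmap X u w) (n u) (n u)
     + bcv_dmetric \<kappa> \<tau> (X u) (n u) (dmap X u w) (n u) - bcv_dmetric \<kappa> \<tau> (X u) (n u) (dmap X u w) (n u)"
    by (rule bcv_gamma_koszul[OF F_nz[OF u]])
  ultimately show ?thesis
    unfolding cov_eq[OF u] bcv_metric_simps by (simp add: bcv_metric_commute[of _ _ _ "n u"
        "dmap n u w"])
qed

text \<open>The mixed entries contain no derivative of p or q: these vanish along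
  \<open>wrot\<close>, and \<open>rot\<close> has neither a radial part nor a third component. By
  \<open>norm_eq\<close> the entries become a multiple of \<tau> (4 \<tau>^2 - \<kappa>), nonzero
  under the hypotheses of the theorem.\<close>

lemma met_cov_frame:
  assumes u: "u \<in> V"
  shows "met u (cov u (wrot u)) (rot u) = p u * rho u / (F u)^2 * (G u
      + \<tau>^2 * rho u - \<kappa> * rho u * G u / (2 * F u))"
    and "met u (cov u (wrot u)) (prof u) = - \<tau> * (4 * \<tau>^2 - \<kappa>) * (rho u)^2 / (4 * (F u)^2)"
    and "met u (cov u (wprof u)) (rot u) = - \<tau> * (4 * \<tau>^2 - \<kappa>) * (rho u)^2 / (4 * (F u)^2)"
    and "met u (cov u (wprof u)) (prof u) = J u * (q u * dmap p u (wprof u) - p u * dmap q u (wprof u)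
      + p u * (q u)^2 * (G u * (1 - \<kappa> * rho u / (2 * F u)) - \<tau>^2 * rho u) - \<tau>^2 * rho u * p u / G u)"
proof -
  note S = sff_frame[OF F_nz[OF u] n_eq[OF u]]
  note fold = F_def[symmetric] rho_def[symmetric] G_def[symmetric]
  note pq = dmap_pq_wrot[OF u]
  show "met u (cov u (wrot u)) (rot u) = p u * rho u / (F u)^2 * (G u
      + \<tau>^2 * rho u - \<kappa> * rho u * G u / (2 * F u))"
    unfolding met_cov[OF u] dmap_wrot[OF u] pq S unfolding fold by simp
  show "met u (cov u (wrot u)) (prof u) = - \<tau> * (4 * \<tau>^2 - \<kappa>) * (rho u)^2 / (4 * (F u)^2)"
    unfolding met_cov[OF u] dmap_wrot[OF u] pq S unfolding fold norm_eq[OF u] by simp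
  show "met u (cov u (wprof u)) (rot u) = - \<tau> * (4 * \<tau>^2 - \<kappa>) * (rho u)^2 / (4 * (F u)^2)"
    unfolding met_cov[OF u] dmap_wprof[OF u] S unfolding fold norm_eq[OF u] hor_frame by simp
  have c: "hor (radv (X u)) (prof u) = q u * G u * rho u" "prof u $ 3 = - p u * rho u * G u / (F u)^2"
    unfolding profv_def hor_linear hor_frame by (simp_all add: rho_def G_def F_def)
  have F: "F u \<noteq> 0" "G u \<noteq> 0" using pos(2)[OF u] pos(3)[of u] by simp_all
  show "met u (cov u (wprof u)) (prof u) = J u * (q u * dmap p u (wprof u) - p u * dmap q u (wprof u)
      + p u * (q u)^2 * (G u * (1 - \<kappa> * rho u / (2 * F u)) - \<tau>^2 * rho u) - \<tau>^2 * rho u * p u / G u)"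
    unfolding met_cov[OF u] dmap_wprof[OF u] S unfolding fold norm_eq[OF u] c J_def using F
    by (simp add: algebra_simps add_divide_distrib diff_divide_distrib)
qed

abbreviation "shape u \<equiv> shape_op (bcv_metric \<kappa> \<tau>) X n u"

lemma shape_dmap: "u \<in> V \<Longrightarrow> shape u (dmap X u w) = - cov u w"
  by (simp add: shape_op_def inv_f_f[OF X_inj])

text \<open>Minus the sum of the two diagonal entries of \<open>met_cov_frame\<close> divided by J,
  simplified; see \<open>mean_curvature_eq\<close>.\<close>

definition "mean u = p u * dmap q u (wprof u) - q u * dmap p u (wprof u)
   - p u * ((q u)^2 * (1 - \<kappa> * rho u * G u / (2 * F u)) + 1 - \<kappa> * rho u / (2 * F u))"

lemma frame_det:
  assumes u: "u \<in> V"
  shows "wrot u $ 1 * wprof u $ 2 - wrot u $ 2 * wprof u $ 1 \<noteq> 0"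
proof
  assume d: "wrot u $ 1 * wprof u $ 2 - wrot u $ 2 * wprof u $ 1 = 0"
  have z: "s = 0" if "s *\<^sub>R wrot u + t *\<^sub>R wprof u = 0" for s t
  proof -
    have "s *\<^sub>R rot u + t *\<^sub>R prof u = 0"
      using that linear_add[OF X_linear[OF u], of "s *\<^sub>R wrot u" "t *\<^sub>R wprof u"]
      by (simp add: linear_scale[OF X_linear[OF u]] linear_0[OF X_linear[OF u]] dmap_wrot[OF u]
          dmap_wprof[OF u])
    then have "met u (s *\<^sub>R rot u + t *\<^sub>R prof u) (rot u) = 0" by simp
    then show ?thesis using pos(4)[OF u] unfolding bcv_metric_simps met_frame[OF u] by simp
  qed
  have t: "t = 0" if "s *\<^sub>R wrot u + t *\<^sub>R wprof u = 0" for s t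
  proof -
    have "s = 0" using z that .
    then have "met u (t *\<^sub>R prof u) (prof u) = 0"
      using arg_cong[OF that, of "dmap X u"] by (simp add: linear_scale[OF X_linear[OF u]] linear_0[OF
          X_linear[OF u]] dmap_wprof[OF u] del: scaleR_eq_0_iff)
    then show ?thesis using pos(4)[OF u] unfolding bcv_metric_simps met_frame[OF u] by simp
  qed
  have "(- wprof u $ 1) *\<^sub>R wrot u + (wrot u $ 1) *\<^sub>R wprof u = 0"
      "(wprof u $ 2) *\<^sub>R wrot u + (- wrot u $ 2) *\<^sub>R wprof u = 0"
    using d by (simp_all add: vec_eq_iff forall_2 algebra_simps)
  from t[OF this(1)] t[OF this(2)] have "wrot u = 0" by (simp add: vec_eq_iff forall_2)
  then have "rot u = 0" using dmap_wrot[OF u] linear_0[OF X_linear[OF u]] by simp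
  then show False using met_frame(1)[OF u] pos(4)[OF u] by simp
qed

lemma shape_frame:
  assumes u: "u \<in> V"
  shows "shape u (dmap X u w) = (- met u (cov u w) (rot u) / J u) *\<^sub>R rot u
      + (- met u (cov u w) (prof u) / J u) *\<^sub>R prof u"
  using tangent_decomposition[OF u, of "- cov u w"]
    by (simp add: shape_dmap[OF u] bcv_metric_simps met_cov_n[OF u])

lemma mean_curvature_eq:
  assumes u: "u \<in> V"
  shows "mean_curvature (bcv_metric \<kappa> \<tau>) X n u = mean u"
proof -
  define L where "L w = inv (dmap X u) (shape u (dmap X u w))" for w
  have dL: "dmap X u (L w) = - cov u w" for w
  proof -
    have "- cov u w \<in> range (dmap X u)" by (simp add: range_dmap[OF u] bcv_metric_simps met_cov_n[OF u])
    then show ?thesis unfolding L_def shape_dmap[OF u] by (rule f_inv_into_f)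
  qed
  have n_lin: "linear (dmap n u)" using n_deriv[OF u] has_derivative_linear by blast
  have "linear L"
  proof (rule linearI)
    fix w w' c
    have "dmap X u (L (w + w')) = dmap X u (L w + L w')"
      unfolding linear_add[OF X_linear[OF u]] dL cov_eq[OF u] linear_add[OF n_lin] bcv_gamma_add_left
        by simp
    then show "L (w + w') = L w + L w'" using X_inj[OF u] by (simp only: inj_eq)
    have "dmap X u (L (c *\<^sub>R w)) = dmap X u (c *\<^sub>R L w)"
      unfolding linear_scale[OF X_linear[OF u]] dL cov_eq[OF u] linear_scale[OF n_lin]
          bcv_gamma_scale_left
      by (simp add: scaleR_add_right scaleR_diff_right)
    then show "L (c *\<^sub>R w) = c *\<^sub>R L w" using X_inj[OF u] by (simp only: inj_eq)
  qed
  have Lw: "L w = (- met u (cov u w) (rot u) / J u) *\<^sub>R wrot u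
      + (- met u (cov u w) (prof u) / J u) *\<^sub>R wprof u" for w
  proof -
    have "dmap X u (L w) = dmap X u ((- met u (cov u w) (rot u) / J u) *\<^sub>R wrot u
        + (- met u (cov u w) (prof u) / J u) *\<^sub>R wprof u)"
      unfolding dL linear_add[OF X_linear[OF u]] linear_scale[OF X_linear[OF u]] dmap_wrot[OF u]
          dmap_wprof[OF u]
      using shape_frame[OF u, of w] shape_dmap[OF u, of w] by simp
    then show ?thesis using X_inj[OF u] by (simp only: inj_eq)
  qed
  have "mean_curvature (bcv_metric \<kappa> \<tau>) X n u = trace (matrix L)"
    by (simp add: mean_curvature_def L_def[abs_def])
  also have "\<dots> = - met u (cov u (wrot u)) (rot u) / J u + - met u (cov u (wprof u)) (prof u) / J u"
    by (rule trace_matrix_2_basis[OF \<open>linear L\<close> Lw Lw frame_det[OF u]])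
  also have "\<dots> = mean u"
  proof -
    have F: "F u \<noteq> 0" "G u \<noteq> 0" "rho u \<noteq> 0" "J u \<noteq> 0" using pos(1,2,4)[OF u] pos(3)[of u] by simp_all
    have 1: "met u (cov u (wrot u)) (rot u) / J u = p u * (1
        + \<tau>^2 * rho u / G u - \<kappa> * rho u / (2 * F u))"
      unfolding met_cov_frame[OF u] J_def using F by (simp add: field_simps)
    have 2: "met u (cov u (wprof u)) (prof u) / J u = q u * dmap p u (wprof u) - p u * dmap q u (wprof u)
      + p u * (q u)^2 * (G u * (1 - \<kappa> * rho u / (2 * F u)) - \<tau>^2 * rho u) - \<tau>^2 * rho u * p u / G u"
      unfolding met_cov_frame[OF u] using F by simp
    have 3: "\<tau>^2 * rho u = G u - 1" by (simp add: G_rho)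
    have 4: "G u * (1 - \<kappa> * rho u / (2 * F u)) - \<tau>^2 * rho u = 1 - \<kappa> * rho u * G u / (2 * F u)"
      unfolding 3 by (simp add: algebra_simps)
    show ?thesis
      using 1 2[unfolded 4] unfolding mean_def by (simp add: algebra_simps)
  qed
  finally show ?thesis .
qed

text \<open>Multiplying by q G brings the derivative of q into the combination that
  \<open>dmap_norm_eq\<close> can eliminate. Since \<rho> has profile derivative 2 q G \<rho>, this
  expresses the mean curvature through dp/d\<rho> where q is nonzero.\<close>

lemma mean_q:
  assumes u: "u \<in> V"
  shows "q u * G u * mean u = - dmap p u (wprof u) - 2 * p u * q u * G u * (1 - \<kappa> * rho u / (2 * F u))"
proof -
  define P Q where "P = dmap p u (wprof u)" and "Q = dmap q u (wprof u)"
  define k where "k = 1 - \<kappa> * rho u / (2 * F u)"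
  define t where "t = (p u)^2 * rho u / (F u)^2"
  have F: "F u \<noteq> 0" using pos(2)[OF u] by simp
  have t: "t = 1 - (q u)^2 * G u" using norm_eq[OF u] by (simp add: t_def)
  have "2 * (p u * P * rho u / (F u)^2 + q u * G u * t * k + q u * Q * G u
      + (q u)^2 * \<tau>^2 * q u * G u * rho u) = 0"
    using dmap_norm_eq[OF u, of "wprof u"] unfolding dmap_rho_frame[OF u] P_def Q_def t_def k_def
    by (simp add: algebra_simps power2_eq_square)
  then have Q: "q u * Q * G u = - (p u * P * rho u / (F u)^2) - q u * G u * t * k
      - (q u)^2 * \<tau>^2 * q u * G u * rho u" by simp
  have "q u * G u * mean u = p u * (q u * Q * G u) - (q u)^2 * G u * P
      - p u * q u * G u * ((q u)^2 * (1 - \<kappa> * rho u * G u / (2 * F u)) + k)"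
    unfolding mean_def P_def Q_def k_def by (simp add: algebra_simps power2_eq_square)
  also have "\<dots> = - P * (t + (q u)^2 * G u) - p u * q u * G u * (t * k + (q u)^2 * (\<tau>^2 * rho u)
      + (q u)^2 * (1 - \<kappa> * rho u * G u / (2 * F u)) + k)"
    unfolding Q t_def by (simp add: algebra_simps power2_eq_square)
  also have "\<dots> = - P - p u * q u * G u * (t * k + (q u)^2 * (G u - 1 + 1 - \<kappa> * rho u * G u / (2 * F u))
      + k)"
    unfolding t by (simp add: G_rho algebra_simps)
  also have "G u - 1 + 1 - \<kappa> * rho u * G u / (2 * F u) = G u * k" by (simp add: k_def algebra_simps)
  also have "t * k + (q u)^2 * (G u * k) + k = 2 * k" unfolding t by (simp add: algebra_simps)
  finally show ?thesis by (simp add: P_def k_def)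
qed

end

section \<open>The biconservative equation in the adapted frame\<close>

context revolution_patch
begin

lemma frame_expand:
  assumes u: "u \<in> V"
  shows "w = (met u (dmap X u w) (rot u) / J u) *\<^sub>R wrot u
      + (met u (dmap X u w) (prof u) / J u) *\<^sub>R wprof u" (is "w = ?w")
proof -
  have "dmap X u w = dmap X u ?w"
    unfolding linear_add[OF X_linear[OF u]] linear_scale[OF X_linear[OF u]] dmap_wrot[OF u]
        dmap_wprof[OF u]
    by (rule tangent_decomposition[OF u]) (simp add: bcv_metric_commute[of _ _ _
        "dmap X u w"] n_normal[OF u])
  then show ?thesis using X_inj[OF u] by (simp only: inj_eq)
qed

lemma linear_frame_expand:
  assumes u: "u \<in> V" and l: "linear (l :: real^2 \<Rightarrow> real)" and z: "l (wrot u) = 0"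
  shows "l w = met u (dmap X u w) (prof u) / J u * l (wprof u)"
  by (subst frame_expand[OF u, of w]) (simp add: linear_add[OF l] linear_scale[OF l] z)

lemma surf_grad_eq:
  assumes u: "u \<in> V" and l: "linear (dmap f u)" and z: "dmap f u (wrot u) = 0"
  shows "surf_grad (bcv_metric \<kappa> \<tau>) X f u = (dmap f u (wprof u) / J u) *\<^sub>R prof u"
  unfolding surf_grad_def
proof (rule the_equality)
  let ?v = "(dmap f u (wprof u) / J u) *\<^sub>R prof u"
  have v: "met u ?v (dmap X u w) = frechet_derivative f (at u) w" for w
    using linear_frame_expand[OF u l z, of w]
    by (simp add: bcv_metric_simps dmap_def[of f] bcv_metric_commute[of _ _ _ "prof u"])
  have r: "?v \<in> range (dmap X u)" by (simp add: range_dmap[OF u] bcv_metric_simps met_frame[OF u])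
  then show "?v \<in> range (dmap X u) \<and> (\<forall>w. met u ?v (dmap X u w) = frechet_derivative f (at u) w)"
    using v by blast
  fix y assume y: "y \<in> range (dmap X u) \<and> (\<forall>w. met u y (dmap X u w) = frechet_derivative f (at u) w)"
  obtain w1 where w1: "y = dmap X u w1" using y by blast
  obtain w2 where w2: "?v = dmap X u w2" using r by blast
  have "met u (y - ?v) (dmap X u w) = 0" for w
    using y v[of w] unfolding bcv_metric_simps(2) by simp
  then have "met u (y - ?v) (dmap X u (w1 - w2)) = 0" .
  \<comment> \<open>The difference of two candidates is itself tangent, so it may be paired with
    itself.\<close>
  moreover have "dmap X u (w1 - w2) = y - ?v" by (simp only: linear_diff[OF X_linear[OF u]] w1 w2)
  ultimately have "met u (y - ?v) (y - ?v) = 0" by simp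
  then show "y = ?v" using bcv_metric_eq_0_iff[OF F_nz[OF u]] by (metis eq_iff_diff_eq_0)
qed

lemma ricci_normal:
  assumes u: "u \<in> V" and e: "met u (n u) e = 0"
  shows "ricci (bcv_metric \<kappa> \<tau>) (X u) (n u) e = (4 * \<tau>^2 - \<kappa>) * q u * bcv_eta \<kappa> \<tau> (X u) e"
proof -
  have "bcv_eta \<kappa> \<tau> (X u) (n u) = q u"
    by (subst n_eq[OF u]) (simp add: bcv_eta_simps bcv_eta_frame[OF F_nz[OF u]])
  then show ?thesis by (simp add: ricci_bcv[OF F_nz[OF u]] e)
qed

abbreviation "mc \<equiv> mean_curvature (bcv_metric \<kappa> \<tau>) X n"

abbreviation "bitension u e1 e2 \<equiv>
  2 *\<^sub>R shape u (surf_grad (bcv_metric \<kappa> \<tau>) X mc u) + mc u *\<^sub>R surf_grad (bcv_metric \<kappa> \<tau>) X mc u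
  - (2 * mc u) *\<^sub>R (ricci (bcv_metric \<kappa> \<tau>) (X u) (n u) e1 *\<^sub>R e1 + ricci (bcv_metric \<kappa> \<tau>) (X u)
      (n u) e2 *\<^sub>R e2)"

lemma frame_orthonormal:
  assumes u: "u \<in> V"
  defines "s \<equiv> 1 / sqrt (J u)"
  shows "orthonormal_frame (bcv_metric \<kappa> \<tau>) X u (s *\<^sub>R rot u) (s *\<^sub>R prof u)"
proof -
  have "s * (s * J u) = 1" using pos(4)[OF u] by (simp add: s_def field_simps)
  then show ?thesis
    using n_rot[OF u] by (simp add: orthonormal_frame_def range_dmap[OF u] bcv_metric_simps
        met_frame[OF u]
      bcv_metric_commute[of _ _ _ "rot u" "n u"])
qed

text \<open>The equation is taken in the normalized frame \<open>rot\<close>, \<open>prof\<close>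
  and paired with each of the two fields. The gradient lies along \<open>prof\<close> because the
  mean curvature is constant along \<open>rot\<close>.\<close>

lemma biconservative_components:
  assumes u: "u \<in> V" and l: "linear (dmap mc u)" and z: "dmap mc u (wrot u) = 0"
    and bi: "\<And>e1 e2. orthonormal_frame (bcv_metric \<kappa> \<tau>) X u e1 e2 \<Longrightarrow> bitension u e1 e2 = 0"
  defines "a \<equiv> dmap mc u (wprof u)" and "K \<equiv> 4 * \<tau>^2 - \<kappa>"
  shows "a * \<tau> * K * rho u / (2 * G u) + 2 * mean u * K * q u * \<tau> * rho u / F u = 0"
    "a * (3 * mean u + 2 * p u * (1 + \<tau>^2 * rho u / G u - \<kappa> * rho u / (2 * F u)))
        + 2 * mean u * K * q u * p u * rho u / (F u)^2 = 0"
proof -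
  define s where "s = 1 / sqrt (J u)"
  have s: "s * s * J u = 1" using pos(4)[OF u] by (simp add: s_def field_simps)
  have J: "J u \<noteq> 0" using pos(4)[OF u] by simp
  have F: "F u \<noteq> 0" "G u \<noteq> 0" "rho u \<noteq> 0" using pos(1,2)[OF u] pos(3)[of u] by simp_all
  have nr: "met u (n u) (s *\<^sub>R rot u) = 0" "met u (n u) (s *\<^sub>R prof u) = 0"
    using n_rot[OF u] by (simp_all add: bcv_metric_simps met_frame[OF u])
  have eta: "bcv_eta \<kappa> \<tau> (X u) (rot u) = - \<tau> * rho u / F u"
      "bcv_eta \<kappa> \<tau> (X u) (prof u) = - p u * rho u / (F u)^2"
    unfolding profv_def bcv_eta_simps bcv_eta_frame[OF F_nz[OF u]] by (simp_all add: rho_def F_def)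
  have grad: "surf_grad (bcv_metric \<kappa> \<tau>) X mc u = (a / J u) *\<^sub>R prof u"
    unfolding a_def by (rule surf_grad_eq[OF u l z])
  have "(a / J u) *\<^sub>R prof u = dmap X u ((a / J u) *\<^sub>R wprof u)"
    by (simp add: linear_scale[OF X_linear[OF u]] dmap_wprof[OF u])
  moreover have "linear (dmap n u)" using n_deriv[OF u] has_derivative_linear by blast
  then have "cov u ((a / J u) *\<^sub>R wprof u) = (a / J u) *\<^sub>R cov u (wprof u)"
    by (simp add: cov_eq[OF u] linear_scale linear_scale[OF X_linear[OF u]] bcv_gamma_scale_left
        scaleR_add_right)
  ultimately have sh: "shape u ((a / J u) *\<^sub>R prof u) = (- (a / J u)) *\<^sub>R cov u (wprof u)"
    by (simp add: shape_dmap[OF u])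
  have b: "2 *\<^sub>R ((- (a / J u)) *\<^sub>R cov u (wprof u)) + mean u *\<^sub>R ((a / J u) *\<^sub>R prof u)
     - (2 * mean u) *\<^sub>R ((K * q u * (s * (- \<tau> * rho u / F u))) *\<^sub>R (s *\<^sub>R rot u) + (K * q u * (s *
         (- p u * rho u / (F u)^2))) *\<^sub>R (s *\<^sub>R prof u)) = 0" (is "?B = 0")
    using bi[OF frame_orthonormal[OF u], folded s_def]
    unfolding grad mean_curvature_eq[OF u] ricci_normal[OF u nr(1)] ricci_normal[OF u nr(2)]
        bcv_eta_simps eta sh K_def .
  have "met u ?B (rot u) = 0" unfolding b by simp
  then have "2 * (- (a / J u) * (- \<tau> * K * (rho u)^2 / (4 * (F u)^2)))
      - 2 * mean u * (K * q u * (- \<tau> * rho u / F u)) * (s * s * J u) = 0"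
    unfolding bcv_metric_simps met_frame[OF u] met_cov_frame[OF u] K_def[symmetric]
      by (simp add: algebra_simps)
  then show "a * \<tau> * K * rho u / (2 * G u) + 2 * mean u * K * q u * \<tau> * rho u / F u = 0"
    unfolding s unfolding J_def using F by (simp add: field_simps power2_eq_square)
  \<comment> \<open>The trace relation: this diagonal entry is recovered from the mean curvature and
    the rotational entry, which removes the derivatives of p and q.\<close>
  have m: "met u (cov u (wprof u)) (prof u) / J u
      = - mean u - p u * (1 + \<tau>^2 * rho u / G u - \<kappa> * rho u / (2 * F u))"
  proof -
    have g: "\<tau>^2 * rho u = G u - 1" by (simp add: G_rho)
    show ?thesis unfolding met_cov_frame[OF u] mean_def g using F J
      by (simp add: field_simps power2_eq_square)
  qed
  have "met u ?B (prof u) = 0" unfolding b by simp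
  then have "- 2 * a * (met u (cov u (wprof u)) (prof u) / J u)
      + mean u * a - 2 * mean u * (K * q u * (- p u * rho u / (F u)^2)) * (s * s * J u) = 0"
    unfolding bcv_metric_simps met_frame[OF u] using J by (simp add: algebra_simps)
  then show "a * (3 * mean u + 2 * p u * (1 + \<tau>^2 * rho u / G u - \<kappa> * rho u / (2 * F u)))
      + 2 * mean u * K * q u * p u * rho u / (F u)^2 = 0"
    unfolding s m by (simp add: algebra_simps)
qed

lemma biconservative_pointwise:
  assumes u: "u \<in> V" and l: "linear (dmap mc u)" and z: "dmap mc u (wrot u) = 0"
    and bi: "\<And>e1 e2. orthonormal_frame (bcv_metric \<kappa> \<tau>) X u e1 e2 \<Longrightarrow> bitension u e1 e2 = 0"
    and K: "\<kappa> \<noteq> 4 * \<tau>^2" and \<tau>: "\<tau> \<noteq> 0"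
  shows "dmap mc u (wprof u) = - 4 * mean u * q u * G u / F u"
    and "mean u \<noteq> 0 \<Longrightarrow> q u \<noteq> 0 \<Longrightarrow> p u = - 3 / 2 * mean u * F u"
proof -
  define a where "a = dmap mc u (wprof u)"
  define k where "k = 4 * \<tau>^2 - \<kappa>"
  have k: "k \<noteq> 0" using K by (simp add: k_def)
  have F: "F u \<noteq> 0" "G u \<noteq> 0" "rho u \<noteq> 0" using pos(1,2)[OF u] pos(3)[of u] by simp_all
  note C = biconservative_components[OF u l z bi, folded a_def k_def]
  \<comment> \<open>The rotation component has this common factor, which is nonzero because \<tau>
    and 4 \<tau>^2 - \<kappa> are.\<close>
  have "(\<tau> * k * rho u / (2 * G u)) * (a + 4 * mean u * q u * G u / F u) = 0"
    using C(1) F by (simp add: field_simps)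
  then have a: "a = - 4 * mean u * q u * G u / F u"
    using k F \<tau> by (simp add: add_eq_0_iff)
  then show "dmap mc u (wprof u) = - 4 * mean u * q u * G u / F u" by (simp add: a_def)
  assume m: "mean u \<noteq> 0" "q u \<noteq> 0"
  have g: "G u = 1 + \<tau>^2 * rho u" "F u = 1 + \<kappa> / 4 * rho u" by (simp_all add: G_rho F_rho)
  \<comment> \<open>After substituting for a, the Ricci term of the profile component supplies the
    last summand here. The whole coefficient of 2 p then collapses to 1 / F, leaving 3 f + 2 p / F =
    0.\<close>
  have e: "1 + \<tau>^2 * rho u / G u - \<kappa> * rho u / (2 * F u) - k * rho u / (4 * F u * G u) = 1 / F u"
  proof -
    have "F u * G u * (1 + \<tau>^2 * rho u / G u - \<kappa> * rho u / (2 * F u) - k * rho u / (4 * F u * G u))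
        = F u * G u + \<tau>^2 * rho u * F u - \<kappa> * rho u * G u / 2 - k * rho u / 4"
      using F by (simp add: field_simps)
    also have "\<dots> = G u" unfolding g k_def by (simp add: field_simps power2_eq_square)
    finally have *: "F u * G u * (1 + \<tau>^2 * rho u / G u - \<kappa> * rho u / (2 * F u)
        - k * rho u / (4 * F u * G u)) = G u" .
    have "x = 1 / F u" if "F u * G u * x = G u" for x using that F by (simp add: field_simps)
    from this[OF *] show ?thesis .
  qed
  define x where "x = 1 + \<tau>^2 * rho u / G u - \<kappa> * rho u / (2 * F u)"
  have "(4 * mean u * q u * G u / F u) * (2 * p u * (k * rho u / (4 * F u * G u)))
      = 2 * mean u * k * q u * p u * rho u / (F u)^2"
    using F by (simp add: field_simps power2_eq_square)
  then have "(- 4 * mean u * q u * G u / F u) * (3 * mean u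
      + 2 * p u * (x - k * rho u / (4 * F u * G u))) = 0"
    using C(2)[folded x_def] unfolding a by (simp add: algebra_simps)
  then have "3 * mean u + 2 * p u * (1 / F u) = 0" unfolding x_def e using F m by simp
  then show "p u = - 3 / 2 * mean u * F u" using F by (simp add: field_simps)
qed

section \<open>Biconservative patches are those with q = 0\<close>

lemma dmap_linear_scalar:
  assumes "u \<in> V"
  shows "linear (dmap rho u)" "linear (dmap p u)" "linear (dmap q u)"
  using scalar_deriv[OF assms] has_derivative_linear by blast+

lemma biconservative_imp_vertical:
  assumes K: "\<kappa> \<noteq> 4 * \<tau>^2" and \<tau>: "\<tau> \<noteq> 0"
    and nz: "\<And>u. u \<in> V \<Longrightarrow> mc u \<noteq> 0"
    and bi: "\<And>u e1 e2. u \<in> V \<Longrightarrow> orthonormal_frame (bcv_metric \<kappa> \<tau>) X u e1 e2 \<Longrightarrow> bitension u e1 e2 = 0"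
    and u0: "u0 \<in> V"
  shows "q u0 = 0"
proof (rule ccontr)
  assume q0: "q u0 \<noteq> 0"
  define w where "w = wprof u0"
  \<comment> \<open>A neighbourhood of u0 on which q and the derivative of \<rho> in the fixed
    direction w stay nonzero.\<close>
  define U where "U = (V \<inter> q -` (- {0})) \<inter> (V \<inter> (\<lambda>u. dmap rho u w) -` (- {0}))"
  have "continuous_on V q" using Ck_q[of 0] by simp
  moreover have "continuous_on V (\<lambda>u. dmap rho u w)" using Ck_rho[of 1] by (simp add: Ck_on_Suc_dmap)
  ultimately have U: "open U" unfolding U_def
    by (intro open_Int continuous_open_preimage open_V) auto
  have UV: "u \<in> V" "q u \<noteq> 0" "dmap rho u w \<noteq> 0" if "u \<in> U" for u using that by (auto simp: U_def)
  have u0U: "u0 \<in> U" using u0 q0 pos(1)[OF u0] pos(3)[of u0] by (simp add: U_def w_def dmap_rho_frame)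
  \<comment> \<open>Both differentials annihilate \<open>wrot\<close>, so in the plane they are
    parallel.\<close>
  have par: "dmap p u v * dmap rho u v' = dmap p u v' * dmap rho u v" if "u \<in> V" for u v v'
    using linear_frame_expand[OF that dmap_linear_scalar(1)[OF that], of v] linear_frame_expand[OF that
        dmap_linear_scalar(1)[OF that], of v']
      linear_frame_expand[OF that dmap_linear_scalar(2)[OF that], of v] linear_frame_expand[OF that
          dmap_linear_scalar(2)[OF that], of v']
      dmap_pq_wrot[OF that] dmap_rho_frame[OF that] by simp
  \<comment> \<open>The derivative \<open>dp/d\<rho>\<close>, expressed through a fixed direction \<open>w\<close> so that it is visibly smooth.\<close>
  define k where "k u = dmap p u w / dmap rho u w" for u
  have CkU: "Ck_on 2 U rho" "Ck_on 2 U p"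
    by (rule Ck_on_subset[OF _ Ck_rho], use UV(1) in blast)
        (rule Ck_on_subset[OF _ Ck_p], use UV(1) in blast)
  \<comment> \<open>\<open>mean\<close> involves the direction \<open>wprof u\<close>, whose
    smoothness in u has not been established. This expression, obtained from \<open>mean_q\<close>,
    contains only k, p, \<rho> and F and can be differentiated.\<close>
  define m where "m u = - 2 * rho u * k u - p u * (2 - \<kappa> * rho u / F u)" for u
  have m: "mc u = m u" if u: "u \<in> U" for u
  proof -
    have "dmap p u (wprof u) * dmap rho u w = dmap p u w * dmap rho u (wprof u)"
      by (rule par[OF UV(1)[OF u]])
    then have "dmap p u (wprof u) = k u * (2 * q u * G u * rho u)"
      using UV(3)[OF u] by (simp add: k_def dmap_rho_frame[OF UV(1)[OF u]] field_simps)
    then have "q u * G u * mean u = q u * G u * m u"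
      using mean_q[OF UV(1)[OF u]] by (simp add: m_def algebra_simps)
    then show ?thesis using UV(2)[OF u] pos(3)[of u] by (simp add: mean_curvature_eq[OF UV(1)[OF u]])
  qed
  have md: "(m has_derivative dmap m u) (at u) \<and> dmap m u (wrot u) = 0" if u: "u \<in> U" for u
  proof -
    note uV = UV(1)[OF u]
    have F: "F u \<noteq> 0" using pos(2)[OF uV] by simp
    have dk: "(k has_derivative dmap k u) (at u)" "dmap k u (wrot u) = 0"
      using dmap_quotient_eq_0[OF U u CkU(2,1), of "wrot u" w] par UV u dmap_pq_wrot[OF uV]
          dmap_rho_frame[OF uV]
      by (auto simp: k_def[abs_def] intro!: dmap_works)
    define D where "D v = - 2 * dmap rho u v * k u - 2 * rho u * dmap k u v - dmap p u v * (2
        - \<kappa> * rho u / F u)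
        + p u * (\<kappa> * dmap rho u v / F u - \<kappa> * rho u * (\<kappa> / 4 * dmap rho u v) / (F u)^2)" for v
    have "(m has_derivative D) (at u)"
      unfolding m_def[abs_def] D_def[abs_def]
      by (rule scalar_deriv[OF uV] F_G_deriv[OF uV] dk(1) derivative_eq_intros refl |
          (simp add: F; fail))+
        (use F in \<open>simp add: fun_eq_iff field_simps power2_eq_square\<close>)
    moreover have "D (wrot u) = 0" by (simp add: D_def dk dmap_pq_wrot[OF uV] dmap_rho_frame[OF uV])
    ultimately show ?thesis by (simp add: dmap_eqI)
  qed
  have mcd: "(mc has_derivative dmap mc u) (at u) \<and> dmap mc u (wrot u) = 0" if u: "u \<in> U" for u
  proof -
    have "(mc has_derivative dmap m u) (at u)"
      by (rule has_derivative_transform_within_open[OF conjunct1[OF md[OF u]] U u]) (simp add: m)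
    then show ?thesis using md[OF u] by (simp add: dmap_eqI)
  qed
  note bp = biconservative_pointwise[OF UV(1) has_derivative_linear[OF conjunct1[OF mcd]] conjunct2[OF
      mcd] bi[OF UV(1)] K \<tau>]
  have p: "p u = - 3 / 2 * mc u * F u" if u: "u \<in> U" for u
    using bp(2)[OF u u u u _ _] nz[OF UV(1)[OF u]] UV(2)[OF u]
      by (simp add: mean_curvature_eq[OF UV(1)[OF u]])
  \<comment> \<open>The relation p = - (3/2) f F holds on all of U, so it may be differentiated at
    u0.\<close>
  have "(p has_derivative (\<lambda>v. - 3 / 2 * (mc u0 * (\<kappa> / 4 * dmap rho u0 v)
      + dmap mc u0 v * F u0))) (at u0)"
  proof (rule has_derivative_transform_within_open[OF _ U u0U])
    show "((\<lambda>u. - 3 / 2 * (mc u * F u)) has_derivative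
        (\<lambda>v. - 3 / 2 * (mc u0 * (\<kappa> / 4 * dmap rho u0 v) + dmap mc u0 v * F u0))) (at u0)"
      by (intro has_derivative_mult_right has_derivative_mult conjunct1[OF mcd[OF u0U]] F_G_deriv[OF u0])
  qed (simp add: p)
  from dmap_eqI[OF this] have dp: "dmap p u0 (wprof u0)
      = - 3 / 2 * (mean u0 * (\<kappa> / 2 * q u0 * G u0 * rho u0) - 4 * mean u0 * q u0 * G u0)"
    using bp(1)[OF u0U u0U u0U u0U] pos(2)[OF u0]
    by (simp add: mean_curvature_eq[OF u0] dmap_rho_frame[OF u0])
  have F: "F u0 \<noteq> 0" using pos(2)[OF u0] by simp
  \<comment> \<open>Inserting p and its derivative expresses the right side through f alone; the
    \<kappa>-terms cancel and the factor -3 remains.\<close>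
  have "q u0 * G u0 * mean u0 = - dmap p u0 (wprof u0) - q u0 * G u0 * (2 * p u0
      - \<kappa> * rho u0 * (p u0 / F u0))"
    using mean_q[OF u0] by (simp add: algebra_simps)
  also have "p u0 / F u0 = - 3 / 2 * mean u0" using p[OF u0U] F by (simp add: mean_curvature_eq[OF u0])
  also have "p u0 = - 3 / 2 * mean u0 * F u0" using p[OF u0U] by (simp add: mean_curvature_eq[OF u0])
  finally have "q u0 * G u0 * mean u0 = - 3 * (q u0 * G u0 * mean u0)"
    unfolding dp F_rho by (simp add: algebra_simps)
  then show False using q0 nz[OF u0] pos(3)[of u0] by (simp add: mean_curvature_eq[OF u0])
qed

text \<open>Unit length forces p to be nonzero when q = 0, so the constraint reduces to d\<rho> = 0;
  the differentiated unit length condition then gives dp = 0.\<close>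

lemma vertical_imp_constant:
  assumes q: "\<And>u. u \<in> V \<Longrightarrow> q u = 0" and u: "u \<in> V"
  shows "dmap rho u w = 0" "dmap p u w = 0" "dmap q u w = 0"
proof -
  have p: "p u \<noteq> 0" using norm_eq[OF u] q[OF u] by (intro notI) simp
  have F: "F u \<noteq> 0" "rho u \<noteq> 0" using pos(1,2)[OF u] by simp_all
  show r: "dmap rho u w = 0" using constraint[OF u, of w] q[OF u] p F by simp
  show q': "dmap q u w = 0" by (rule has_derivative_constant_onD[OF scalar_deriv(4)[OF u] open_V u q])
  show "dmap p u w = 0" using dmap_norm_eq[OF u, of w] q[OF u] p F by (simp add: r)
qed

lemma vertical_imp_biconservative:
  assumes q: "\<And>u. u \<in> V \<Longrightarrow> q u = 0" and u: "u \<in> V"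
    and e: "orthonormal_frame (bcv_metric \<kappa> \<tau>) X u e1 e2"
  shows "bitension u e1 e2 = 0"
proof -
  have c: "dmap rho x w = 0" "dmap p x w = 0" "dmap q x w = 0" if "x \<in> V" for x w
    using vertical_imp_constant[of x w] q that by blast+
  have F: "F u \<noteq> 0" using pos(2)[OF u] by simp
  have mc: "mc x = - p x * (1 - \<kappa> * rho x / (2 * F x))" if "x \<in> V" for x
    using q[OF that] c(3)[OF that] by (simp add: mean_curvature_eq[OF that] mean_def)
  have "((\<lambda>x. - p x * (1 - \<kappa> * rho x / (2 * F x))) has_derivative (\<lambda>w. 0)) (at u)"
    by (rule scalar_deriv[OF u] F_G_deriv[OF u] derivative_eq_intros refl | (simp add: F; fail))+
      (simp add: fun_eq_iff c[OF u])
  then have "(mc has_derivative (\<lambda>w. 0)) (at u)"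
    by (rule has_derivative_transform_within_open[OF _ open_V u]) (simp add: mc)
  then have d: "dmap mc u = (\<lambda>w. 0)" by (rule dmap_eqI)
  have g: "surf_grad (bcv_metric \<kappa> \<tau>) X mc u = 0"
    using surf_grad_eq[OF u, of mc] by (simp add: d linear_zero)
  have "linear (dmap n u)" using n_deriv[OF u] has_derivative_linear by blast
  then have "cov u 0 = 0"
    using bcv_gamma_scale_left[of \<kappa> \<tau> "X u" 0 0 "n u"]
      by (simp add: cov_eq[OF u] linear_0 linear_0[OF X_linear[OF u]])
  then have "shape u 0 = 0" using shape_dmap[OF u, of 0] by (simp add: linear_0[OF X_linear[OF u]])
  moreover have "met u (n u) e1 = 0" "met u (n u) e2 = 0"
    using e by (auto simp: orthonormal_frame_def range_dmap[OF u] bcv_metric_commute)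
  ultimately show ?thesis unfolding g by (simp add: ricci_normal[OF u] q[OF u])
qed

end

section \<open>Surfaces of revolution\<close>

lemma local_param_in_topspace: "local_param S \<phi> V h \<Longrightarrow> u \<in> V \<Longrightarrow> h u \<in> topspace S"
  unfolding local_param_def using openin_subset by fastforce

lemma smooth_on_dmap: "smooth_on V X \<Longrightarrow> u \<in> V \<Longrightarrow> (X has_derivative dmap X u) (at u)"
  unfolding smooth_on_def by (metis Ck_on_Suc_dmap dmap_works)

text \<open>Each patch has a negligible image because it is a differentiable image of a planar set.
  Second countability makes the surface Lindelof, so countably many patches suffice.\<close>

lemma negligible_immersed_surface:
  assumes "immersed_surface D S \<phi>"
  shows "negligible (\<phi> ` topspace S)"
proof -
  have n: "negligible (\<phi> ` (h ` V))" if "local_param S \<phi> V h" for V h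
  proof -
    have "smooth_on V (\<phi> \<circ> h)" using that by (simp add: local_param_def)
    then have "(\<phi> \<circ> h) differentiable_on V"
      using smooth_on_dmap by (meson differentiable_at_imp_differentiable_on differentiable_def)
    then have "negligible ((\<phi> \<circ> h) ` V)" by (intro negligible_differentiable_image_lowdim) auto
    then show ?thesis by (simp add: image_comp)
  qed
  define \<U> where "\<U> = {h ` V | V h. local_param S \<phi> V h}"
  have L: "Lindelof_space S"
    using assms by (auto simp: immersed_surface_def intro: second_countable_imp_Lindelof_space)
  have O: "\<And>U. U \<in> \<U> \<Longrightarrow> openin S U" by (auto simp: \<U>_def local_param_def)
  have Un: "\<Union>\<U> = topspace S"
  proof
    show "\<Union>\<U> \<subseteq> topspace S" using local_param_in_topspace by (fastforce simp: \<U>_def)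
    show "topspace S \<subseteq> \<Union>\<U>"
    proof
      fix x assume "x \<in> topspace S"
      then obtain V h where "local_param S \<phi> V h" "x \<in> h ` V" using assms
        unfolding immersed_surface_def by meson
      then show "x \<in> \<Union>\<U>" by (auto simp: \<U>_def)
    qed
  qed
  have ex: "\<exists>\<V>. countable \<V> \<and> \<V> \<subseteq> \<U> \<and> \<Union>\<V> = topspace S"
    by (rule Lindelof_spaceD[OF L _ Un]) (rule O)
  obtain \<V> where \<V>: "countable \<V>" "\<V> \<subseteq> \<U>" "\<Union>\<V> = topspace S"
    using ex by (elim exE conjE)
  have "negligible (\<Union>((`) \<phi> ` \<V>))"
    by (rule negligible_countable_Union) (use \<V> n in \<open>auto simp: \<U>_def\<close>)
  moreover have "\<phi> ` topspace S = \<Union>((`) \<phi> ` \<V>)" using \<V>(3) by auto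
  ultimately show ?thesis by simp
qed

lemma rot_z_nth [simp]:
  "rot_z t a $ 1 = cos t * a$1 - sin t * a$2" "rot_z t a $ 2 = sin t * a$1 + cos t * a$2"
      "rot_z t a $ 3 = a$3"
  by (simp_all add: rot_z_def)

text \<open>If the rotation field were transversal, rotating the patch would give a map \<Psi> of a
  three-dimensional domain with invertible derivative at (0, u). Its image would have interior, yet
  invariance places it inside the negligible surface image.\<close>

lemma rotation_field_tangent:
  assumes S: "immersed_surface (bcv_domain \<kappa>) S \<phi>" and R: "surface_of_revolution S \<phi>"
    and V: "local_param S \<phi> V h" and u: "u \<in> V"
    and n: "\<And>w. bcv_metric \<kappa> \<tau> (\<phi> (h u)) m (dmap (\<phi> \<circ> h) u w) = 0"
  shows "bcv_metric \<kappa> \<tau> (\<phi> (h u)) m (rotv (\<phi> (h u))) = 0"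
proof (rule ccontr)
  let ?X = "\<phi> \<circ> h"
  assume nz: "bcv_metric \<kappa> \<tau> (\<phi> (h u)) m (rotv (\<phi> (h u))) \<noteq> 0"
  have oV: "open V" and sm: "smooth_on V ?X" and inj: "inj (dmap ?X u)"
    using V u by (auto simp: local_param_def)
  note X = smooth_on_dmap[OF sm u]
  define \<Psi> where "\<Psi> z = rot_z (fst z) (?X (snd z))" for z :: "real \<times> (real^2)"
  define \<Psi>' where "\<Psi>' z = fst z *\<^sub>R rotv (?X u) + dmap ?X u (snd z)" for z :: "real \<times> (real^2)"
  have d: "(\<Psi> has_derivative \<Psi>') (at (0, u))"
  proof (rule has_derivative_componentwise_vec)
    have X': "((\<lambda>z. ?X (snd z) $ i) has_derivative (\<lambda>z. dmap ?X u (snd z) $ i)) (at (0::real, u))" for i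
    proof (rule has_derivative_nth)
      show "((\<lambda>z. ?X (snd z)) has_derivative (\<lambda>z. dmap ?X u (snd z))) (at (0::real, u))"
        by (rule has_derivative_compose[OF bounded_linear_imp_has_derivative[OF bounded_linear_snd]])
            (simp only: snd_conv X)
    qed
    fix i :: 3
    consider "i = 1" | "i = 2" | "i = 3" using exhaust_3 by blast
    then show "((\<lambda>z. \<Psi> z $ i) has_derivative (\<lambda>z. \<Psi>' z $ i)) (at (0, u))"
    proof cases
      case 1
      show ?thesis unfolding 1 \<Psi>_def \<Psi>'_def rot_z_nth
        by (rule X' derivative_eq_intros refl)+ (simp add: fun_eq_iff)
    next
      case 2
      show ?thesis unfolding 2 \<Psi>_def \<Psi>'_def rot_z_nth
        by (rule X' derivative_eq_intros refl)+ (simp add: fun_eq_iff)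
    next
      case 3
      show ?thesis unfolding 3 \<Psi>_def \<Psi>'_def rot_z_nth
        by (rule has_derivative_eq_rhs[OF X']) (simp add: fun_eq_iff)
    qed
  qed
  have lin: "linear \<Psi>'" using d has_derivative_linear by blast
  have "z = 0" if "\<Psi>' z = 0" for z
  proof -
    \<comment> \<open>Pairing with m kills the tangent part and isolates the coefficient of the
      rotation field.\<close>
    have "bcv_metric \<kappa> \<tau> (\<phi> (h u)) m (\<Psi>' z) = 0" by (simp add: that)
    then have f: "fst z = 0" using nz by (simp add: \<Psi>'_def bcv_metric_simps n)
    then have "dmap ?X u (snd z) = dmap ?X u 0"
      using that linear_0[OF has_derivative_linear[OF X]] by (simp add: \<Psi>'_def)
    then show ?thesis using f inj by (simp add: inj_eq prod_eq_iff)
  qed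
  then have "inj \<Psi>'" using linear_injective_0[OF lin] by blast
  then have "surj \<Psi>'" using linear_injective_imp_surjective[OF lin] by simp
  then obtain g where g: "linear g" "\<Psi>' \<circ> g = id" using linear_surjective_right_inverse[OF lin] by blast
  have cX: "continuous_on V ?X" using sm by (metis smooth_on_def Ck_on.simps(1))
  have "continuous_on (UNIV \<times> V) (\<lambda>z. ?X (snd z))"
    by (rule continuous_on_compose2[OF cX]) (auto intro!: continuous_intros)
  then have cont: "continuous_on (UNIV \<times> V) \<Psi>"
    unfolding \<Psi>_def rot_z_def by (subst continuous_on_componentwise)
        (auto simp: Basis_vec_def inner_axis forall_3 intro!: continuous_intros)
  \<comment> \<open>This open mapping theorem asks for continuity and for a derivative with right
    inverse at the single point (0, u).\<close>
  have "\<Psi> (0, u) \<in> interior (\<Psi> ` (UNIV \<times> V))"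
    by (rule sussmann_open_mapping[OF _ cont _ d _ g(2)])
      (use u oV g(1) in \<open>auto simp: open_Times linear_conv_bounded_linear interior_open\<close>)
  moreover have "\<Psi> ` (UNIV \<times> V) \<subseteq> \<phi> ` topspace S"
  proof
    fix y assume "y \<in> \<Psi> ` (UNIV \<times> V)"
    then obtain t w where "w \<in> V" "y = rot_z t (\<phi> (h w))" by (auto simp: \<Psi>_def)
    then have "y \<in> rot_z t ` (\<phi> ` topspace S)" using local_param_in_topspace[OF V] by blast
    then show "y \<in> \<phi> ` topspace S" using R unfolding surface_of_revolution_def by blast
  qed
  then have "negligible (interior (\<Psi> ` (UNIV \<times> V)))"
    using negligible_immersed_surface[OF S] by (meson negligible_subset interior_subset subset_trans)
  ultimately show False using open_not_negligible[OF open_interior] by blast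
qed

lemma rotv_linear: "linear rotv"
  by (rule linearI) (simp_all add: vec_eq_iff forall_3)

lemma meets_axis_imp_vertical:
  assumes V: "local_param S \<phi> V h" and u: "u \<in> V" and N: "smooth_on V (N \<circ> h)"
    and F: "\<And>u. u \<in> V \<Longrightarrow> bcv_F \<kappa> (\<phi> (h u)) > 0"
    and unit: "bcv_metric \<kappa> \<tau> (\<phi> (h u)) (N (h u)) (N (h u)) = 1"
    and normal: "\<And>w. bcv_metric \<kappa> \<tau> (\<phi> (h u)) (N (h u)) (dmap (\<phi> \<circ> h) u w) = 0"
    and rot: "\<And>u. u \<in> V \<Longrightarrow> bcv_metric \<kappa> \<tau> (\<phi> (h u)) (N (h u)) (rotv (\<phi> (h u))) = 0"
    and axis: "rad2 (\<phi> (h u)) = 0"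
  shows "\<bar>bcv_metric \<kappa> \<tau> (\<phi> (h u)) hopf_field (N (h u))\<bar> = 1"
proof -
  define X n where "X = \<phi> \<circ> h" and "n = N \<circ> h"
  define a m where "a = X u" and "m = n u"
  have oV: "open V" and sm: "smooth_on V X" and inj: "inj (dmap X u)"
    using V u by (auto simp: local_param_def X_def)
  have dX: "(X has_derivative dmap X u) (at u)" and dn: "(n has_derivative dmap n u) (at u)"
    using smooth_on_dmap[OF sm u] smooth_on_dmap[OF N u] by (auto simp: n_def)
  have lin: "linear (dmap X u)" using dX has_derivative_linear by blast
  have a0: "a $ 1 = 0" "a $ 2 = 0" using axis by (auto simp: rad2_def a_def X_def sum_power2_eq_zero_iff)
  have r0: "rotv (X u) = 0" using a0 by (simp add: vec_eq_iff forall_3 a_def)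
  \<comment> \<open>On the axis F = 1 and the metric is Euclidean.\<close>
  have g: "bcv_metric \<kappa> \<tau> a v w = v$1 * w$1 + v$2 * w$2 + v$3 * w$3" for v w
    by (simp add: bcv_metric_def a0 bcv_F_def)
  have "((\<lambda>u. rotv (X u)) has_derivative (\<lambda>w. rotv (dmap X u w))) (at u)"
    using bounded_linear.has_derivative[OF _ dX] rotv_linear linear_conv_bounded_linear by blast
  from has_derivative_bcv_metric_along[OF _ dX dn this, of \<kappa> \<tau>]
  have "((\<lambda>u. bcv_metric \<kappa> \<tau> (X u) (n u) (rotv (X u))) has_derivative
     (\<lambda>w. bcv_dmetric \<kappa> \<tau> (X u) (dmap X u w) (n u) (rotv (X u)) + bcv_metric \<kappa> \<tau> (X u) (dmap n u w)
         (rotv (X u))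
       + bcv_metric \<kappa> \<tau> (X u) (n u) (rotv (dmap X u w)))) (at u)"
    using F[OF u] by (simp add: X_def)
  from has_derivative_constant_onD[OF this oV u, of 0]
  have "bcv_dmetric \<kappa> \<tau> (X u) (dmap X u w) (n u) (rotv (X u))
      + bcv_metric \<kappa> \<tau> (X u) (dmap n u w) (rotv (X u))
       + bcv_metric \<kappa> \<tau> (X u) (n u) (rotv (dmap X u w)) = 0" for w
    using rot by (simp add: X_def n_def)
  moreover have "bcv_dmetric \<kappa> \<tau> a v w 0 = 0" for v w
    using bcv_dmetric_simps(6)[of \<kappa> \<tau> a v w 0 0] by simp
  ultimately have "bcv_metric \<kappa> \<tau> a m (rotv (dmap X u w)) = 0" for w
    unfolding r0 by (simp add: a_def m_def)
  then have 1: "m$2 * dmap X u w $ 1 = m$1 * dmap X u w $ 2" for w by (simp add: g)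
  have 2: "m$1 * dmap X u w $ 1 + m$2 * dmap X u w $ 2 + m$3 * dmap X u w $ 3 = 0" for w
    using normal[of w] by (simp add: g[symmetric] a_def m_def X_def n_def)
  \<comment> \<open>A tangent plane contains a nonzero vector with vanishing third component. If the
    first basis vector does not map to one, a combination of both basis vectors does.\<close>
  obtain w where w: "w \<noteq> 0" "dmap X u w $ 3 = 0"
  proof (cases "dmap X u (axis 1 1) $ 3 = 0")
    case True
    then show ?thesis by (rule that[rotated]) (simp add: axis_eq_0_iff)
  next
    case False
    let ?w = "(dmap X u (axis 2 1) $ 3) *\<^sub>R axis 1 1
        - (dmap X u (axis 1 1) $ 3) *\<^sub>R (axis 2 1 :: real^2)"
    have "?w $ 2 \<noteq> 0" using False by (simp add: axis_def)
    then have "?w \<noteq> 0" by (metis zero_index)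
    moreover have "dmap X u ?w $ 3 = 0" by (simp add: linear_diff[OF lin] linear_scale[OF lin])
    ultimately show ?thesis by (rule that)
  qed
  define v where "v = dmap X u w"
  have v: "v $ 3 = 0" "v \<noteq> 0"
    using w inj linear_0[OF lin] by (auto simp: v_def inj_def)
  have e: "m$2 * v$1 = m$1 * v$2" "m$1 * v$1 + m$2 * v$2 = 0" using 1[of w] 2[of w] v
    by (simp_all add: v_def)
  \<comment> \<open>By \<open>e\<close> the planar part of the normal is both parallel and
    orthogonal to the nonzero planar vector v, hence zero.\<close>
  have "((m$1)^2 + (m$2)^2) * v$1 = m$1 * (m$1 * v$1 + m$2 * v$2) + m$2 * (m$2 * v$1 - m$1 * v$2)"
    "((m$1)^2 + (m$2)^2) * v$2 = m$2 * (m$1 * v$1 + m$2 * v$2) - m$1 * (m$2 * v$1 - m$1 * v$2)"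
    by (simp_all add: algebra_simps power2_eq_square)
  then have "(m$1)^2 + (m$2)^2 = 0" using e v by (auto simp: vec_eq_iff forall_3)
  then have "m$1 = 0" "m$2 = 0" by (auto simp: sum_power2_eq_zero_iff)
  moreover have "bcv_metric \<kappa> \<tau> a m m = 1" using unit by (simp add: a_def m_def X_def n_def)
  ultimately have "m$3 * m$3 = 1" by (simp add: g)
  then have "\<bar>m$3\<bar> = 1" by (metis abs_mult_self_eq abs_1 abs_mult mult_cancel_left1 abs_minus_cancel
      abs_eq_iff square_eq_1_iff power2_eq_square)
  moreover have "bcv_metric \<kappa> \<tau> a hopf_field m = m$3" by (simp add: g hopf_field_def)
  ultimately show ?thesis by (simp add: a_def m_def X_def n_def)
qed

lemma revolution_patchI:
  assumes S: "immersed_surface (bcv_domain \<kappa>) S \<phi>" and N: "unit_normal_field (bcv_metric \<kappa> \<tau>) S \<phi> N"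
    and R: "surface_of_revolution S \<phi>"
    and ang: "\<forall>p\<in>topspace S. angle_fun \<kappa> \<tau> \<phi> N p \<in> {0<..<pi}"
    and V: "local_param S \<phi> V h"
  shows "revolution_patch \<kappa> \<tau> V (\<phi> \<circ> h) (N \<circ> h)"
proof
  note top = local_param_in_topspace[OF V]
  show "open V" "smooth_on V (\<phi> \<circ> h)" using V by (auto simp: local_param_def)
  show smN: "smooth_on V (N \<circ> h)" using N V by (auto simp: unit_normal_field_def)
  fix u assume u: "u \<in> V"
  show "inj (dmap (\<phi> \<circ> h) u)" using V u by (auto simp: local_param_def)
  have F: "bcv_F \<kappa> (\<phi> (h u)) > 0" if "u \<in> V" for u
    using S top[OF that] by (auto simp: immersed_surface_def bcv_domain_def)
  then show "bcv_F \<kappa> ((\<phi> \<circ> h) u) > 0" using u by simp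
  have unit: "bcv_metric \<kappa> \<tau> (\<phi> (h u)) (N (h u)) (N (h u)) = 1"
    using N top[OF u] by (auto simp: unit_normal_field_def)
  then show "bcv_metric \<kappa> \<tau> ((\<phi> \<circ> h) u) ((N \<circ> h) u) ((N \<circ> h) u) = 1" by simp
  have nor: "bcv_metric \<kappa> \<tau> (\<phi> (h u)) (N (h u)) (dmap (\<phi> \<circ> h) u w) = 0" if "u \<in> V" for u w
    using N V that by (auto simp: unit_normal_field_def)
  then show "bcv_metric \<kappa> \<tau> ((\<phi> \<circ> h) u) ((N \<circ> h) u) (dmap (\<phi> \<circ> h) u w) = 0" for w using u by simp
  have rot: "bcv_metric \<kappa> \<tau> (\<phi> (h u)) (N (h u)) (rotv (\<phi> (h u))) = 0" if "u \<in> V" for u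
    by (rule rotation_field_tangent[OF S R V that nor[OF that]])
  then show "bcv_metric \<kappa> \<tau> ((\<phi> \<circ> h) u) ((N \<circ> h) u) (rotv ((\<phi> \<circ> h) u)) = 0" using u by simp
  show "rad2 ((\<phi> \<circ> h) u) > 0"
  proof (rule ccontr)
    assume "\<not> rad2 ((\<phi> \<circ> h) u) > 0"
    moreover have "rad2 (\<phi> (h u)) \<ge> 0" by (simp add: rad2_def)
    ultimately have "rad2 (\<phi> (h u)) = 0" by simp
    from meets_axis_imp_vertical[OF V u smN F unit nor[OF u] rot this]
    \<comment> \<open>A point on the axis would have normal parallel to the Hopf field; this is
      where the angle hypothesis enters.\<close>
    have "angle_fun \<kappa> \<tau> \<phi> N (h u) \<in> {0, pi}" by (auto simp: angle_fun_def abs_if split: if_splits)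
    moreover have "angle_fun \<kappa> \<tau> \<phi> N (h u) \<in> {0<..<pi}" using ang top[OF u] by blast
    ultimately show False by auto
  qed
qed

section \<open>From patches to the whole surface\<close>

lemma locally_constant_imp_constant:
  assumes S: "connected_space S"
    and loc: "\<And>x. x \<in> topspace S \<Longrightarrow> \<exists>U. openin S U \<and> x \<in> U \<and> (\<forall>y\<in>U. f y = f x)"
    and x: "x \<in> topspace S" and y: "y \<in> topspace S"
  shows "f y = f x"
proof -
  \<comment> \<open>A general P covers both a level set and its complement.\<close>
  have op: "openin S {z \<in> topspace S. P (f z)}" for P
  proof (subst openin_subopen, intro ballI)
    fix z assume z: "z \<in> {z \<in> topspace S. P (f z)}"
    then obtain U where U: "openin S U" "z \<in> U" "\<forall>y\<in>U. f y = f z" using loc[of z] by auto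
    have "U \<subseteq> {z \<in> topspace S. P (f z)}" using z U(3) openin_subset[OF U(1)] by auto
    then show "\<exists>T. openin S T \<and> z \<in> T \<and> T \<subseteq> {z \<in> topspace S. P (f z)}" using U(1,2) by blast
  qed
  let ?A = "{z \<in> topspace S. f z = f x}"
  have "topspace S - ?A = {z \<in> topspace S. f z \<noteq> f x}" by blast
  then have "closedin S ?A" using op[of "\<lambda>c. c \<noteq> f x"] by (simp add: closedin_def)
  moreover have "openin S ?A" by (rule op)
  ultimately have "?A = {} \<or> ?A = topspace S" using S unfolding connected_space_clopen_in by blast
  then show ?thesis using x y by blast
qed

lemma local_param_openin:
  assumes V: "local_param S \<phi> V h" and W: "open W" "W \<subseteq> V"
  shows "openin S (h ` W)"
proof -
  have "openin (top_of_set V) W" using W by (simp add: open_subset)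
  then have "openin (subtopology S (h ` V)) (h ` W)"
    using V W homeomorphic_map_openness[of "top_of_set V" "subtopology S (h ` V)" h W]
    by (simp add: local_param_def)
  then show ?thesis using V by (auto simp: local_param_def intro: openin_trans_full)
qed

lemma norm_hopf_proj: "norm (hopf_proj a) = sqrt (rad2 a)"
  by (simp add: norm_eq_sqrt_inner inner_vec_def sum_2 hopf_proj_def rad2_def power2_eq_square)

lemma rot_z_transitive:
  assumes "rad2 a = rad2 b" "rad2 a > 0" "a $ 3 = b $ 3"
  shows "\<exists>t. b = rot_z t a"
proof -
  \<comment> \<open>Cosine and sine of the angle from a to b, as inner product and determinant of
    the planar parts over the squared radius.\<close>
  define c s where "c = (a$1 * b$1 + a$2 * b$2) / rad2 a" and "s = (a$1 * b$2 - a$2 * b$1) / rad2 a"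
  have "(a$1 * b$1 + a$2 * b$2)^2 + (a$1 * b$2 - a$2 * b$1)^2 = rad2 a * rad2 b"
    by (simp add: rad2_def algebra_simps power2_eq_square)
  also have "\<dots> = (rad2 a)^2" using assms by (simp add: power2_eq_square)
  finally have "c^2 + s^2 = 1" using assms(2) by
      (simp add: c_def s_def power_divide add_divide_distrib[symmetric])
  then obtain t where t: "c = cos t" "s = sin t" by (metis sincos_total_2pi)
  have "rad2 a * (c * a$1 - s * a$2) = (a$1 * b$1 + a$2 * b$2) * a$1 - (a$1 * b$2 - a$2 * b$1) * a$2"
    "rad2 a * (s * a$1 + c * a$2) = (a$1 * b$2 - a$2 * b$1) * a$1 + (a$1 * b$1 + a$2 * b$2) * a$2"
    using assms(2) by (simp_all add: c_def s_def field_simps)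
  moreover have "(a$1 * b$1 + a$2 * b$2) * a$1 - (a$1 * b$2 - a$2 * b$1) * a$2 = rad2 a * b$1"
    "(a$1 * b$2 - a$2 * b$1) * a$1 + (a$1 * b$1 + a$2 * b$2) * a$2 = rad2 a * b$2"
    by (simp_all add: rad2_def algebra_simps power2_eq_square)
  ultimately have "c * a$1 - s * a$2 = b$1" "s * a$1 + c * a$2 = b$2" using assms(2) by simp_all
  then have "b = rot_z t a" using assms(3) by (simp add: vec_eq_iff forall_3 t)
  then show ?thesis ..
qed

text \<open>Needed for openness in the cylinder: rotations supply all angles and this lemma an open
  range of heights. When q = 0, p is nonzero, so z has nonzero profile derivative.\<close>

lemma (in revolution_patch) height_open:
  assumes "q u = 0" and u: "u \<in> V"
  shows "X u $ 3 \<in> interior (z ` V)"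
proof -
  have "p u \<noteq> 0" using norm_eq[OF u] assms(1) by (intro notI) simp
  then have d: "dmap z u (wprof u) \<noteq> 0"
    using pos(1,2)[OF u] pos(3)[of u] by (simp add: dmap_rho_frame[OF u])
  have lin: "linear (dmap z u)" using scalar_deriv(2)[OF u] has_derivative_linear by blast
  have "z u \<in> interior (z ` V)"
  proof (rule sussmann_open_mapping[OF open_V _ u scalar_deriv(2)[OF u]])
    show "continuous_on V z" using Ck_z[of 0] by simp
    show "bounded_linear (\<lambda>t. t *\<^sub>R ((1 / dmap z u (wprof u)) *\<^sub>R wprof u))"
      by (rule bounded_linear_scaleR_left)
    show "dmap z u \<circ> (\<lambda>t. t *\<^sub>R ((1 / dmap z u (wprof u)) *\<^sub>R wprof u)) = id"
      using d by (simp add: fun_eq_iff linear_scale[OF lin])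
  qed (use u open_V in \<open>auto simp: interior_open\<close>)
  then show ?thesis by (simp add: z_def)
qed

theorem theorem5p3:
  fixes \<kappa> \<tau> :: real
    and S :: "'a topology"
    and \<phi> :: "'a \<Rightarrow> real^3"
    and N :: "'a \<Rightarrow> real^3"
  assumes "\<kappa> \<noteq> 4 * \<tau>^2" and "\<tau> \<noteq> 0"
    and "immersed_surface (bcv_domain \<kappa>) S \<phi>"
    and "unit_normal_field (bcv_metric \<kappa> \<tau>) S \<phi> N"
    and "surface_of_revolution S \<phi>"
    and "mean_curvature_nowhere_zero (bcv_metric \<kappa> \<tau>) S \<phi> N"
    and "\<forall>p\<in>topspace S. angle_fun \<kappa> \<tau> \<phi> N p \<in> {0<..<pi}"
  shows "biconservative (bcv_metric \<kappa> \<tau>) S \<phi> N \<longleftrightarrow> hopf_circular_cylinder \<kappa> S \<phi>"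
proof -
  note patch = revolution_patchI[OF assms(3,4,5,7)]
  have cover: "\<exists>V h u. local_param S \<phi> V h \<and> u \<in> V \<and> h u = x" if "x \<in> topspace S" for x
    using assms(3) that unfolding immersed_surface_def by (metis imageE)
  show ?thesis
  proof
    assume bi: "biconservative (bcv_metric \<kappa> \<tau>) S \<phi> N"
    have vert: "revolution_patch.q \<tau> (\<phi> \<circ> h) (N \<circ> h) u = 0"
        if V: "local_param S \<phi> V h" and u: "u \<in> V" for V h u
    proof -
      interpret revolution_patch \<kappa> \<tau> V "\<phi> \<circ> h" "N \<circ> h" by (rule patch[OF V])
      show ?thesis
      proof (rule biconservative_imp_vertical[OF assms(1,2) _ _ u])
        show "mc u \<noteq> 0" if "u \<in> V" for u
          using assms(6) V that by (auto simp: mean_curvature_nowhere_zero_def)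
        show "bitension u e1 e2 = 0" if "u \<in> V" "orthonormal_frame (bcv_metric \<kappa> \<tau>) (\<phi> \<circ> h) u e1 e2"
            for u e1 e2
          using bi V that unfolding biconservative_def Let_def by blast
      qed
    qed
    have loc: "\<exists>U. openin S U \<and> x \<in> U \<and> (\<forall>y\<in>U. rad2 (\<phi> y) = rad2 (\<phi> x))" if x: "x \<in> topspace S" for x
    proof -
      obtain V h u where V: "local_param S \<phi> V h" "u \<in> V" "h u = x" using cover[OF x] by blast
      interpret revolution_patch \<kappa> \<tau> V "\<phi> \<circ> h" "N \<circ> h" by (rule patch[OF V(1)])
      obtain e where e: "e > 0" "ball u e \<subseteq> V" using open_V V(2) by (meson openE)
      have c: "rho y = rho u" if "y \<in> ball u e" for y
      proof (rule has_derivative_zero_unique[OF convex_ball _ that])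
        fix w assume "w \<in> ball u e"
        then have w: "w \<in> V" using e by blast
        have "dmap rho w = (\<lambda>v. 0)" using vertical_imp_constant(1)[OF vert[OF V(1)] w] by blast
        then show "(rho has_derivative (\<lambda>v. 0)) (at w within ball u e)"
          using scalar_deriv(1)[OF w] by (simp add: has_derivative_at_withinI)
      qed (use e in simp)
      have "openin S (h ` ball u e)" by (rule local_param_openin[OF V(1) open_ball e(2)])
      moreover have "x \<in> h ` ball u e" using V(3) e(1) by auto
      moreover have "\<forall>y\<in>h ` ball u e. rad2 (\<phi> y) = rad2 (\<phi> x)"
        using c V(3) by (auto simp: rho_def simp del: mem_ball)
      ultimately show ?thesis by blast
    qed
    obtain x0 where x0: "x0 \<in> topspace S" using assms(3) unfolding immersed_surface_def by blast
    have conn: "connected_space S" using assms(3) by (simp add: immersed_surface_def)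
    have rad: "rad2 (\<phi> x) = rad2 (\<phi> x0)" if "x \<in> topspace S" for x
      by (rule locally_constant_imp_constant[OF conn loc x0 that])
    have rpos: "rad2 (\<phi> x0) > 0"
      using cover[OF x0] patch revolution_patch.rad2_pos by fastforce
    define r where "r = sqrt (rad2 (\<phi> x0))"
    have "openin (top_of_set {p \<in> bcv_domain \<kappa>. hopf_proj p \<in> sphere 0 r}) (\<phi> ` topspace S)"
      unfolding openin_euclidean_subtopology_iff
    proof (intro conjI ballI)
      show "\<phi> ` topspace S \<subseteq> {p \<in> bcv_domain \<kappa>. hopf_proj p \<in> sphere 0 r}"
        using assms(3) rad by (auto simp: immersed_surface_def r_def norm_hopf_proj)
      fix a assume "a \<in> \<phi> ` topspace S"
      then obtain x where x: "x \<in> topspace S" "a = \<phi> x" by blast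
      obtain V h u where V: "local_param S \<phi> V h" "u \<in> V" "h u = x" using cover[OF x(1)] by blast
      interpret revolution_patch \<kappa> \<tau> V "\<phi> \<circ> h" "N \<circ> h" by (rule patch[OF V(1)])
      have "a $ 3 \<in> interior (z ` V)"
        using height_open[OF vert[OF V(1,2)] V(2)] V(3) x(2) by simp
      then obtain e where e: "e > 0" "ball (a$3) e \<subseteq> z ` V" by (auto simp: mem_interior)
      show "\<exists>e>0. \<forall>b\<in>{p \<in> bcv_domain \<kappa>. hopf_proj p \<in> sphere 0 r}. dist b a < e \<longrightarrow> b \<in> \<phi> ` topspace S"
      proof (intro exI[of _ e] conjI ballI impI)
        fix b assume b: "b \<in> {p \<in> bcv_domain \<kappa>. hopf_proj p \<in> sphere 0 r}" "dist b a < e"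
        \<comment> \<open>A nearby point b of the cylinder has the height of some point of the patch
          and the same radius, so it is a rotated copy of that point.\<close>
        have rb: "rad2 b = rad2 (\<phi> x0)" using b(1) by (simp add: norm_hopf_proj r_def)
        have "dist (a$3) (b$3) < e" using b(2) dist_vec_nth_le[of a 3 b] by (simp add: dist_commute)
        then obtain u' where u': "u' \<in> V" "b$3 = z u'" using e(2) by auto
        have hu: "h u' \<in> topspace S" by (rule local_param_in_topspace[OF V(1) u'(1)])
        have "\<exists>t. b = rot_z t (\<phi> (h u'))"
          by (rule rot_z_transitive) (use rad[OF hu] rb rpos u'(2) in \<open>auto simp: z_def\<close>)
        then obtain t where "b = rot_z t (\<phi> (h u'))" ..
        then have "b \<in> rot_z t ` (\<phi> ` topspace S)" using hu by blast
        then show "b \<in> \<phi> ` topspace S" using assms(5) unfolding surface_of_revolution_def by blast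
      qed (rule e)
    qed
    then show "hopf_circular_cylinder \<kappa> S \<phi>"
      using rpos unfolding hopf_circular_cylinder_def by (intro exI[of _ r]) (simp add: r_def)
  next
    assume "hopf_circular_cylinder \<kappa> S \<phi>"
    then obtain r where r: "r > 0" "\<phi> ` topspace S \<subseteq> {p \<in> bcv_domain \<kappa>. hopf_proj p \<in> sphere 0 r}"
      unfolding hopf_circular_cylinder_def using openin_subset by fastforce
    have rad: "rad2 (\<phi> x) = r^2" if "x \<in> topspace S" for x
    proof -
      have "sqrt (rad2 (\<phi> x)) = r" using r that by (auto simp: norm_hopf_proj)
      then show ?thesis by (metis real_sqrt_pow2 real_sqrt_ge_0_iff r(1) less_imp_le)
    qed
    show "biconservative (bcv_metric \<kappa> \<tau>) S \<phi> N"
      unfolding biconservative_def Let_def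
    proof (intro allI impI ballI)
      fix V h u e1 e2
      assume V: "local_param S \<phi> V h" and u: "u \<in> V"
        and e: "orthonormal_frame (bcv_metric \<kappa> \<tau>) (\<phi> \<circ> h) u e1 e2"
      interpret revolution_patch \<kappa> \<tau> V "\<phi> \<circ> h" "N \<circ> h" by (rule patch[OF V])
      have q: "q u = 0" if u: "u \<in> V" for u
      proof -
        \<comment> \<open>On the cylinder \<rho> is constant, while its profile derivative is 2 q G
          \<rho> with G and \<rho> positive.\<close>
        have "dmap rho u (wprof u) = 0"
          by (rule has_derivative_constant_onD[OF scalar_deriv(1)[OF u] open_V u, of "r^2"])
            (simp add: rho_def rad local_param_in_topspace[OF V])
        then show ?thesis using pos(1)[OF u] pos(3)[of u] by (simp add: dmap_rho_frame[OF u])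
      qed
      show "bitension u e1 e2 = 0" by (rule vertical_imp_biconservative[OF q u e])
    qed
  qed
qed

end
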